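(* Let $n\ge 2$, let $M$ be an $(n-1)$-space group, and let $\Delta$ be the infinite dihedral $1$-space group generated by the reflections $\delta_1=-I'$ (that is, $x\mapsto -x$) and $\delta_2=1-I'$ (that is, $x\mapsto 1-x$) of $E^1$. Let $\eta_1,\eta_2\in\mathrm{Hom}_f(\Delta,\mathrm{Aff}(M))$, and let $\eta_1(\delta_i)=(a_i+A_i)_\star$, with $a_i+A_i\in\mathrm{Aff}(E^{n-1})$ an affinity that normalizes $M$, for $i=1,2$. Let $E_i$ be the $(-1)$-eigenspace of the restriction of $A_i$ to $\mathrm{Span}(Z(M))$ for $i=1,2$. Then the surjection $\psi:\mathrm{Aff}(\Delta,M)\to\mathrm{Iso}(\Delta,M)$ has the property that $\psi([\eta_1])=\psi([\eta_2])$ if and only if there is a vector $v\in E_1\cap E_2$ such that the unordered pair $\{\eta_1(\delta_1),(v+\overline I)_\star\eta_1(\delta_2)\}$ is conjugate to the unordered pair $\{\eta_2(\delta_1),\eta_2(\delta_2)\}$ by an element of $\mathrm{Aff}(M)$.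
   Context: Conventions. $E^k$ is Euclidean $k$-space. The map $x\mapsto a+Ax$ is written $a+A$; it is an affinity of $E^k$ if $a\in E^k$, $A\in\mathrm{GL}(k,\mathbb R)$, and an isometry iff $A\in\mathrm O(k)$. $\mathrm{Aff}(E^k)$ is the group of affinities. $\overline I$ and $I'$ are the identity maps of $E^{n-1}$ and $E^1$. A $k$-space group is a discrete group of isometries of $E^k$ with compact orbit space. $Z(M)$ is the center of $M$ (it consists of translations) and, for a group $G$ of isometries of $E^k$, $\mathrm{Span}(G)$ is the linear span of $\{a: a+I\in G\}$. Affinities of orbifolds. If $M_1,M_2$ are $k$-space groups and $\phi\in\mathrm{Aff}(E^k)$ with $\phi M_1\phi^{-1}=M_2$, then $\phi_\star:E^k/M_1\to E^k/M_2$ is $\phi_\star(M_1x)=M_2\phi(x)$; maps of this form are the affinities $E^k/M_1\to E^k/M_2$. For a $k$-space group $M$, $\mathrm{Aff}(M)=\mathrm{Aff}(E^k/M)$ is the group of affinities of $E^k/M$, and $\phi_\sharp:\mathrm{Aff}(M_1)\to\mathrm{Aff}(M_2)$ is $\phi_\sharp(\alpha)=\phi_\star\alpha\phi_\star^{-1}$. The homomorphism $\Omega:\mathrm{Aff}(M)\to\mathrm{Out}(M)$ sends $\alpha=\tilde\alpha_\star$ to the class of the automorphism $\mu\mapsto\tilde\alpha\mu\tilde\alpha^{-1}$. The set $\mathrm{Aff}(\Delta,M)$. $\mathrm{Hom}_f(\Delta,\mathrm{Aff}(M))$ is the set of homomorphisms $\eta:\Delta\to\mathrm{Aff}(M)$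 such that $\Omega\eta$ has finite image. $\mathrm{Aff}(M)$ acts on it on the left by conjugation and $\mathrm{Aut}(\Delta)$ acts on the right by precomposition; $\mathrm{Inn}(\Delta)$ acts trivially on the set of $\mathrm{Aff}(M)$-orbits, and $\mathrm{Aff}(\Delta,M)=(\mathrm{Aff}(M)\backslash\mathrm{Hom}_f(\Delta,\mathrm{Aff}(M)))/\mathrm{Out}(\Delta)$. The class of $\eta$ is denoted $[\eta]$. The set $\mathrm{Iso}(\Delta,M)$. It is the set of isomorphism classes $[\Gamma,N]$ of pairs $(\Gamma,N)$, where $N$ is a normal subgroup of an $n$-space group $\Gamma$ with $N\cong M$ and $\Gamma/N\cong\Delta$; $(\Gamma_1,N_1)\cong(\Gamma_2,N_2)$ if some isomorphism $\Gamma_1\to\Gamma_2$ maps $N_1$ onto $N_2$. The map $\psi$. Given $\eta\in\mathrm{Hom}_f(\Delta,\mathrm{Aff}(M))$, there is $C\in\mathrm{GL}(n-1,\mathbb R)$ such that $CMC^{-1}$ is an $(n-1)$-space group and $C_\sharp\eta(\Delta)\subseteq\mathrm{Isom}(E^{n-1}/CMC^{-1})$. Write $E^n=E^{n-1}\times E^1$ with $E^1=(E^{n-1})^\perp$, and let $N$ be $CMC^{-1}$ extended to $E^n$ so as to act trivially on the factor $E^1$. There is an $n$-space group $\Gamma$ containing $N$ as a normal subgroup, each of whose elements acts diagonally as $\gamma=(\overline\gamma,\gamma')$ on $E^{n-1}\times E^1$, such that $N$ is the kernel of $\gamma\mapsto\gamma'$, $\{\gamma':\gamma\in\Gamma\}=\Delta$,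 and $\overline\gamma_\star=C_\sharp(\eta(\gamma'))$ for all $\gamma\in\Gamma$. Then $\psi([\eta])=[\Gamma,N]$; this gives a well-defined surjection $\psi:\mathrm{Aff}(\Delta,M)\to\mathrm{Iso}(\Delta,M)$. *)

theory Defs
  imports "HOL-Analysis.Analysis" "HOL-Algebra.Generated_Groups" "HOL-Algebra.Bij"
begin

text \<open>
  Euclidean \<open>k\<close>-space is an arbitrary type of class \<open>euclidean_space\<close> of dimension \<open>k\<close>.
  For \<open>'a :: euclidean_space\<close> of dimension \<open>n - 1\<close>, the space \<open>E\<^sup>n = E\<^sup>n\<^sup>-\<^sup>1 \<times> E\<^sup>1\<close> is the
  Euclidean space \<open>'a \<times> real\<close>. Types of this class have positive dimension, so that
  \<open>n \<ge> 2\<close> holds throughout.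
\<close>

section \<open>Groups of maps\<close>

text \<open>Groups of transformations of \<open>E\<^sup>k\<close> are subgroups of the group of all bijections of \<open>E\<^sup>k\<close>.\<close>

abbreviation Maps :: "('a \<Rightarrow> 'a) monoid"
  where "Maps \<equiv> BijGroup UNIV"

abbreviation grp :: "('a \<Rightarrow> 'a) set \<Rightarrow> ('a \<Rightarrow> 'a) monoid"
  where "grp G \<equiv> Maps\<lparr>carrier := G\<rparr>"

definition conj_by :: "('g, 'm) monoid_scheme \<Rightarrow> 'g \<Rightarrow> 'g \<Rightarrow> 'g"
  where "conj_by G g x = g \<otimes>\<^bsub>G\<^esub> x \<otimes>\<^bsub>G\<^esub> inv\<^bsub>G\<^esub> g"

definition center :: "('g, 'm) monoid_scheme \<Rightarrow> 'g set"
  where "center G = {z \<in> carrier G. \<forall>x\<in>carrier G. z \<otimes>\<^bsub>G\<^esub> x = x \<otimes>\<^bsub>G\<^esub> z}"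

definition Inn :: "('g, 'm) monoid_scheme \<Rightarrow> ('g \<Rightarrow> 'g) set"
  where "Inn G = {restrict (conj_by G g) (carrier G) | g. g \<in> carrier G}"

definition Out :: "('g, 'm) monoid_scheme \<Rightarrow> ('g \<Rightarrow> 'g) set monoid"
  where "Out G = AutoGroup G Mod Inn G"

section \<open>Affinities, isometries and space groups\<close>

definition affinities :: "('a::euclidean_space \<Rightarrow> 'a) set"
  where "affinities = {(\<lambda>x. a + A x) | a A. linear A \<and> bij A}"

definition isometries :: "('a::euclidean_space \<Rightarrow> 'a) set"
  where "isometries = {(\<lambda>x. a + A x) | a A. orthogonal_transformation A}"

definition orbit :: "('a \<Rightarrow> 'a) set \<Rightarrow> 'a \<Rightarrow> 'a set"
  where "orbit G x = (\<lambda>g. g x) ` G"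

definition orbit_space :: "('a \<Rightarrow> 'a) set \<Rightarrow> 'a set set"
  where "orbit_space G = range (orbit G)"

text \<open>The quotient topology on the orbit space.\<close>

definition orbit_topology :: "('a::topological_space \<Rightarrow> 'a) set \<Rightarrow> 'a set topology"
  where "orbit_topology G =
    topology (\<lambda>U. U \<subseteq> orbit_space G \<and> open {x. orbit G x \<in> U})"

text \<open>
  In the following definition, \<open>discrete\<close> refers to the topology of the function type, which is
  that of pointwise convergence; on the group of isometries of \<open>E\<^sup>k\<close> it induces the usual
  (compact-open) topology.
\<close>

definition space_group :: "('a::euclidean_space \<Rightarrow> 'a) set \<Rightarrow> bool"
  where "space_group G \<longleftrightarrow>
    subgroup G Maps \<and> G \<subseteq> isometries \<and> discrete G \<and> compact_space (orbit_topology G)"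

definition Span :: "('a::euclidean_space \<Rightarrow> 'a) set \<Rightarrow> 'a set"
  where "Span G = span {a. (\<lambda>x. a + x) \<in> G}"

definition eigenspace_on :: "'a::real_vector set \<Rightarrow> ('a \<Rightarrow> 'a) \<Rightarrow> real \<Rightarrow> 'a set"
  where "eigenspace_on V A c = {v \<in> V. A v = c *\<^sub>R v}"

section \<open>Affinities of orbifolds\<close>

text \<open>
  Here and below, \<open>the_elem\<close> picks the common value that an expression takes on all
  representatives of a class.
\<close>

definition star ::
  "('a \<Rightarrow> 'a) set \<Rightarrow> ('a \<Rightarrow> 'a) set \<Rightarrow> ('a \<Rightarrow> 'a) \<Rightarrow> 'a set \<Rightarrow> 'a set"
  where "star M\<^sub>1 M\<^sub>2 \<phi> =
    (\<lambda>X\<in>orbit_space M\<^sub>1. the_elem ((\<lambda>x. orbit M\<^sub>2 (\<phi> x)) ` X))"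

definition affine_normalizer :: "('a::euclidean_space \<Rightarrow> 'a) set \<Rightarrow> ('a \<Rightarrow> 'a) set"
  where "affine_normalizer M = {\<phi> \<in> affinities. conj_by Maps \<phi> ` M = M}"

definition Aff :: "('a::euclidean_space \<Rightarrow> 'a) set \<Rightarrow> ('a set \<Rightarrow> 'a set) monoid"
  where "Aff M = (BijGroup (orbit_space M))\<lparr>carrier := star M M ` affine_normalizer M\<rparr>"

text \<open>The orbit space carries the metric given by the distance between orbits.\<close>

definition Isom :: "('a::euclidean_space \<Rightarrow> 'a) set \<Rightarrow> ('a set \<Rightarrow> 'a set) set"
  where "Isom M = {\<alpha> \<in> Bij (orbit_space M).
    \<forall>X\<in>orbit_space M. \<forall>Y\<in>orbit_space M. setdist (\<alpha> X) (\<alpha> Y) = setdist X Y}"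

definition sharp ::
  "('a \<Rightarrow> 'a) set \<Rightarrow> ('a \<Rightarrow> 'a) set \<Rightarrow> ('a \<Rightarrow> 'a) \<Rightarrow>
    ('a set \<Rightarrow> 'a set) \<Rightarrow> 'a set \<Rightarrow> 'a set"
  where "sharp M\<^sub>1 M\<^sub>2 \<phi> \<alpha> =
    (\<lambda>Y\<in>orbit_space M\<^sub>2.
      star M\<^sub>1 M\<^sub>2 \<phi> (\<alpha> (inv_into (orbit_space M\<^sub>1) (star M\<^sub>1 M\<^sub>2 \<phi>) Y)))"

definition Omega ::
  "('a::euclidean_space \<Rightarrow> 'a) set \<Rightarrow> ('a set \<Rightarrow> 'a set) \<Rightarrow> (('a \<Rightarrow> 'a) \<Rightarrow> ('a \<Rightarrow> 'a)) set"
  where "Omega M \<alpha> =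
    the_elem ((\<lambda>\<phi>. Inn (grp M) #>\<^bsub>AutoGroup (grp M)\<^esub> restrict (conj_by Maps \<phi>) M) `
      {\<phi> \<in> affine_normalizer M. star M M \<phi> = \<alpha>})"

section \<open>The set \<open>Aff(\<Delta>, M)\<close>\<close>

text \<open>
  A homomorphism is represented by a function that is \<open>undefined\<close> outside \<open>\<Delta>\<close>, so that distinct
  elements of \<open>Hom_f \<Delta> M\<close> are distinct homomorphisms.
\<close>

definition Hom_f ::
  "(real \<Rightarrow> real) set \<Rightarrow> ('a::euclidean_space \<Rightarrow> 'a) set \<Rightarrow>
    ((real \<Rightarrow> real) \<Rightarrow> ('a set \<Rightarrow> 'a set)) set"
  where "Hom_f \<Delta> M =
    {\<eta> \<in> hom (grp \<Delta>) (Aff M) \<inter> extensional \<Delta>. finite ((\<lambda>\<delta>. Omega M (\<eta> \<delta>)) ` \<Delta>)}"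

definition Aff_orbit ::
  "(real \<Rightarrow> real) set \<Rightarrow> ('a::euclidean_space \<Rightarrow> 'a) set \<Rightarrow>
    ((real \<Rightarrow> real) \<Rightarrow> ('a set \<Rightarrow> 'a set)) \<Rightarrow> ((real \<Rightarrow> real) \<Rightarrow> ('a set \<Rightarrow> 'a set)) set"
  where "Aff_orbit \<Delta> M \<eta> = {(\<lambda>\<delta>\<in>\<Delta>. conj_by (Aff M) \<alpha> (\<eta> \<delta>)) | \<alpha>. \<alpha> \<in> carrier (Aff M)}"

text \<open>The right action of \<open>Out(\<Delta>)\<close> on the set of \<open>Aff(M)\<close>-orbits, induced by precomposition.\<close>

definition Out_act ::
  "(real \<Rightarrow> real) set \<Rightarrow> ((real \<Rightarrow> real) \<Rightarrow> 'b) set \<Rightarrow>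
    ((real \<Rightarrow> real) \<Rightarrow> (real \<Rightarrow> real)) set \<Rightarrow> ((real \<Rightarrow> real) \<Rightarrow> 'b) set"
  where "Out_act \<Delta> H c = the_elem ((\<lambda>\<beta>. (\<lambda>\<eta>. compose \<Delta> \<eta> \<beta>) ` H) ` c)"

definition Aff_class ::
  "(real \<Rightarrow> real) set \<Rightarrow> ('a::euclidean_space \<Rightarrow> 'a) set \<Rightarrow>
    ((real \<Rightarrow> real) \<Rightarrow> ('a set \<Rightarrow> 'a set)) \<Rightarrow> ((real \<Rightarrow> real) \<Rightarrow> ('a set \<Rightarrow> 'a set)) set set"
  where "Aff_class \<Delta> M \<eta> = Out_act \<Delta> (Aff_orbit \<Delta> M \<eta>) ` carrier (Out (grp \<Delta>))"

section \<open>The set \<open>Iso(\<Delta>, M)\<close>\<close>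

type_synonym 'a maps_pair = "('a \<times> real \<Rightarrow> 'a \<times> real) set \<times> ('a \<times> real \<Rightarrow> 'a \<times> real) set"

definition Iso_pairs ::
  "(real \<Rightarrow> real) set \<Rightarrow> ('a::euclidean_space \<Rightarrow> 'a) set \<Rightarrow> 'a maps_pair set"
  where "Iso_pairs \<Delta> M =
    {(\<Gamma>, N). space_group \<Gamma> \<and> N \<lhd> grp \<Gamma> \<and> grp N \<cong> grp M \<and> grp \<Gamma> Mod N \<cong> grp \<Delta>}"

definition Iso_rel ::
  "(real \<Rightarrow> real) set \<Rightarrow> ('a::euclidean_space \<Rightarrow> 'a) set \<Rightarrow> ('a maps_pair \<times> 'a maps_pair) set"
  where "Iso_rel \<Delta> M =
    {((\<Gamma>\<^sub>1, N\<^sub>1), (\<Gamma>\<^sub>2, N\<^sub>2)). (\<Gamma>\<^sub>1, N\<^sub>1) \<in> Iso_pairs \<Delta> M \<and> (\<Gamma>\<^sub>2, N\<^sub>2) \<in> Iso_pairs \<Delta> M \<and>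
      (\<exists>f \<in> iso (grp \<Gamma>\<^sub>1) (grp \<Gamma>\<^sub>2). f ` N\<^sub>1 = N\<^sub>2)}"

definition Iso_class ::
  "(real \<Rightarrow> real) set \<Rightarrow> ('a::euclidean_space \<Rightarrow> 'a) set \<Rightarrow> 'a maps_pair \<Rightarrow> 'a maps_pair set"
  where "Iso_class \<Delta> M p = Iso_rel \<Delta> M `` {p}"

section \<open>The map \<open>\<psi>\<close>\<close>

text \<open>The two components of a map that acts diagonally on \<open>E\<^sup>n\<^sup>-\<^sup>1 \<times> E\<^sup>1\<close>.\<close>

definition fst_part :: "('a \<times> real \<Rightarrow> 'a \<times> real) \<Rightarrow> 'a \<Rightarrow> 'a"
  where "fst_part \<gamma> x = fst (\<gamma> (x, 0))"

definition snd_part :: "('a::zero \<times> real \<Rightarrow> 'a \<times> real) \<Rightarrow> real \<Rightarrow> real"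
  where "snd_part \<gamma> t = snd (\<gamma> (0, t))"

definition realizes ::
  "(real \<Rightarrow> real) set \<Rightarrow> ('a::euclidean_space \<Rightarrow> 'a) set \<Rightarrow>
    ((real \<Rightarrow> real) \<Rightarrow> ('a set \<Rightarrow> 'a set)) \<Rightarrow> ('a \<Rightarrow> 'a) \<Rightarrow> 'a maps_pair \<Rightarrow> bool"
  where "realizes \<Delta> M \<eta> C = (\<lambda>(\<Gamma>, N).
    let M' = conj_by Maps C ` M in
      linear C \<and> bij C \<and> space_group M' \<and> (\<lambda>\<delta>. sharp M M' C (\<eta> \<delta>)) ` \<Delta> \<subseteq> Isom M' \<and>
      N = (\<lambda>\<nu>. map_prod \<nu> id) ` M' \<and>
      space_group \<Gamma> \<and> N \<lhd> grp \<Gamma> \<and>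
      (\<forall>\<gamma>\<in>\<Gamma>. \<gamma> = map_prod (fst_part \<gamma>) (snd_part \<gamma>)) \<and>
      N = {\<gamma> \<in> \<Gamma>. snd_part \<gamma> = id} \<and>
      snd_part ` \<Gamma> = \<Delta> \<and>
      (\<forall>\<gamma>\<in>\<Gamma>. star M' M' (fst_part \<gamma>) = sharp M M' C (\<eta> (snd_part \<gamma>))))"

definition psi ::
  "(real \<Rightarrow> real) set \<Rightarrow> ('a::euclidean_space \<Rightarrow> 'a) set \<Rightarrow>
    ((real \<Rightarrow> real) \<Rightarrow> ('a set \<Rightarrow> 'a set)) set set \<Rightarrow> 'a maps_pair set"
  where "psi \<Delta> M c =
    the_elem {Iso_class \<Delta> M p | \<eta> C p.
      \<eta> \<in> Hom_f \<Delta> M \<and> Aff_class \<Delta> M \<eta> = c \<and> realizes \<Delta> M \<eta> C p}"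

section \<open>The infinite dihedral group\<close>

definition \<delta>\<^sub>1 :: "real \<Rightarrow> real"
  where "\<delta>\<^sub>1 = (\<lambda>x. - x)"

definition \<delta>\<^sub>2 :: "real \<Rightarrow> real"
  where "\<delta>\<^sub>2 = (\<lambda>x. 1 - x)"

definition Dihedral :: "(real \<Rightarrow> real) set"
  where "Dihedral = generate Maps {\<delta>\<^sub>1, \<delta>\<^sub>2}"

section \<open>Basic facts\<close>

lemma openin_orbit_topology:
  "openin (orbit_topology G) U \<longleftrightarrow> U \<subseteq> orbit_space G \<and> open {x. orbit G x \<in> U}"
proof -
  have "istopology (\<lambda>U. U \<subseteq> orbit_space G \<and> open {x. orbit G x \<in> U})"
    unfolding istopology_def
  proof (intro conjI allI impI)
    fix S T
    assume "S \<subseteq> orbit_space G \<and> open {x. orbit G x \<in> S}"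
      and "T \<subseteq> orbit_space G \<and> open {x. orbit G x \<in> T}"
    then show "S \<inter> T \<subseteq> orbit_space G" and "open {x. orbit G x \<in> S \<inter> T}"
      by (auto simp: Collect_conj_eq)
  next
    fix K
    assume K: "\<forall>U\<in>K. U \<subseteq> orbit_space G \<and> open {x. orbit G x \<in> U}"
    then show "\<Union>K \<subseteq> orbit_space G" by blast
    have "{x. orbit G x \<in> \<Union>K} = (\<Union>U\<in>K. {x. orbit G x \<in> U})" by blast
    then show "open {x. orbit G x \<in> \<Union>K}" using K by auto
  qed
  then show ?thesis by (simp add: orbit_topology_def topology_inverse')
qed

lemma quotient_map_orbit: "quotient_map euclidean (orbit_topology G) (orbit G)"
proof -
  have "openin (orbit_topology G) (orbit_space G)"
    by (simp add: openin_orbit_topology orbit_space_def)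
  then have "topspace (orbit_topology G) = orbit_space G"
    by (metis openin_orbit_topology openin_subset openin_topspace subset_antisym)
  then show ?thesis
    by (simp add: quotient_map_def openin_orbit_topology orbit_space_def)
qed

lemma carrier_Maps [simp]: "carrier Maps = {f. bij f}"
  by (simp add: BijGroup_def Bij_def)

lemma mult_Maps: "bij f \<Longrightarrow> bij g \<Longrightarrow> f \<otimes>\<^bsub>Maps\<^esub> g = f \<circ> g"
  by (simp add: BijGroup_def Bij_def compose_def fun_eq_iff)

lemma inv_Maps: "bij f \<Longrightarrow> inv\<^bsub>Maps\<^esub> f = inv_into UNIV f"
  by (simp add: inv_BijGroup Bij_def fun_eq_iff)

lemma conj_by_Maps: "bij \<phi> \<Longrightarrow> bij f \<Longrightarrow> conj_by Maps \<phi> f = \<phi> \<circ> f \<circ> inv_into UNIV \<phi>"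
  by (simp add: conj_by_def mult_Maps inv_Maps bij_comp bij_imp_bij_inv)

lemma orbit_eq:
  assumes G: "subgroup G Maps" and g: "g \<in> G"
  shows "orbit G (g x) = orbit G x"
proof -
  have bij: "bij h" if "h \<in> G" for h
    using subgroup.subset[OF G] that by auto
  have i: "inv_into UNIV g \<in> G"
    using subgroup.m_inv_closed[OF G g] by (simp add: inv_Maps bij g)
  have "orbit G (h y) \<subseteq> orbit G y" if h: "h \<in> G" for h y
  proof
    fix z assume "z \<in> orbit G (h y)"
    then obtain f where f: "f \<in> G" and z: "z = f (h y)" unfolding orbit_def by blast
    have "f \<circ> h \<in> G"
      using subgroup.m_closed[OF G f h] by (simp add: mult_Maps bij f h)
    then show "z \<in> orbit G y" unfolding orbit_def z by (metis comp_apply imageI)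
  qed
  from this[OF g, of x] this[OF i, of "g x"] show ?thesis
    by (simp add: bij[OF g] bij_is_inj)
qed

lemma star_orbit:
  assumes M1: "subgroup M\<^sub>1 Maps" and M2: "subgroup M\<^sub>2 Maps"
    and \<phi>: "bij \<phi>" and conj: "conj_by Maps \<phi> ` M\<^sub>1 = M\<^sub>2"
  shows "star M\<^sub>1 M\<^sub>2 \<phi> (orbit M\<^sub>1 x) = orbit M\<^sub>2 (\<phi> x)"
proof -
  have "orbit M\<^sub>2 (\<phi> (m x)) = orbit M\<^sub>2 (\<phi> x)" if m: "m \<in> M\<^sub>1" for m
  proof -
    have "bij m" using subgroup.subset[OF M1] m by auto
    then have "conj_by Maps \<phi> m (\<phi> x) = \<phi> (m x)"
      by (simp add: conj_by_Maps \<phi> bij_is_inj)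
    moreover have "conj_by Maps \<phi> m \<in> M\<^sub>2" using conj m by blast
    ultimately show ?thesis using orbit_eq[OF M2] by metis
  qed
  moreover have "M\<^sub>1 \<noteq> {}" using subgroup.one_closed[OF M1] by blast
  ultimately have "(\<lambda>y. orbit M\<^sub>2 (\<phi> y)) ` orbit M\<^sub>1 x = {orbit M\<^sub>2 (\<phi> x)}"
    unfolding orbit_def[of M\<^sub>1] by (auto simp: image_image)
  then show ?thesis by (simp add: star_def orbit_space_def)
qed

end

theory Submission
  imports Defs "HOL-Algebra.Multiplicative_Group"
begin

text \<open>
  The pair that realizes \<open>\<eta>\<close> is conjugate, by a linear change of coordinates on \<open>E\<^sup>n\<^sup>-\<^sup>1\<close>, to the
  group of all \<open>\<phi> \<times> \<delta>\<close> with \<open>\<phi>\<^sub>\<star> = \<eta> \<delta>\<close>, together with its subgroup \<open>M \<times> 1\<close>. So two classes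
  have the same image iff there is an isomorphism between these groups of lifts that preserves \<open>M \<times> 1\<close>.

  Given \<open>v \<in> E\<^sub>1 \<inter> E\<^sub>2\<close>, conjugation by the shear \<open>(x, t) \<mapsto> (x + t v, t)\<close> fixes the lifts of \<open>\<delta>\<^sub>1\<close> and
  multiplies those of \<open>\<delta>\<^sub>2\<close> by the translation by \<open>v\<close>; this gives the isomorphism.

  Conversely, an isomorphism restricts on \<open>M\<close> to conjugation by an affinity \<open>\<alpha>\<close> (Bieberbach), and
  after composition with an inner automorphism it preserves \<open>{\<delta>\<^sub>1, \<delta>\<^sub>2}\<close>. Since affinities that
  centralize \<open>M\<close> are translations along \<open>Span (Z(M))\<close>, it sends a lift \<open>\<phi>\<^sub>i\<close> of \<open>\<eta>\<^sub>1 \<delta>\<^sub>i\<close> to the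
  conjugate by \<open>\<alpha>\<close> of \<open>u\<^sub>i + \<phi>\<^sub>i\<close>, and \<open>\<phi>\<^sub>i\<^sup>2 \<in> M\<close> forces \<open>u\<^sub>i \<in> E\<^sub>i\<close>. Replacing \<open>\<alpha>\<close> by \<open>\<alpha> - w\<close>
  changes \<open>u\<^sub>i\<close> to \<open>w - A\<^sub>i w + u\<^sub>i\<close>. For an invariant scalar product the orthogonal complement of
  \<open>(I - A\<^sub>2) (Fix A\<^sub>1)\<close> in \<open>E\<^sub>2\<close> is \<open>E\<^sub>1 \<inter> E\<^sub>2\<close>, so \<open>w\<close> can be chosen such that \<open>u\<^sub>1\<close> becomes \<open>0\<close> and
  \<open>u\<^sub>2\<close> becomes an element of \<open>E\<^sub>1 \<inter> E\<^sub>2\<close>.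
\<close>

section \<open>Groups of bijections and isometries\<close>

text \<open>The value of \<open>psi\<close> is defined through a choice of \<open>C\<close>, which
  must be eliminated before classes can be compared. This is possible because an affinity that maps
  every point into its own M-orbit lies in M: the conditions in \<open>realizes\<close> then
  determine the pair once \<open>C\<close> is given, and conjugating back leaves a pair that no
  longer mentions \<open>C\<close>. That pair consists of affinities rather than isometries, which
  does no harm to isomorphisms of abstract groups. The finiteness condition in \<open>Hom_f\<close>
  provides the invariant scalar product, used both to find some \<open>C\<close> and to split off
  the common eigenvectors. An isomorphism of pairs is not assumed to come from a map of E^n.
  Bieberbach's second theorem is therefore applied to its restriction to M, and its effect on the
  second factor is read off from \<Delta>: lifts of reflections go to lifts of reflections, and
  surjectivity forces the two image mirrors to be adjacent. The first theorem makes averages over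
  the linear parts of M possible and identifies Span(Z(M)) with their common fixed space.\<close>

definition lin :: "('a::real_vector \<Rightarrow> 'a) \<Rightarrow> 'a \<Rightarrow> 'a"
  where "lin \<phi> = (\<lambda>x. \<phi> x - \<phi> 0)"

abbreviation finv :: "('b \<Rightarrow> 'b) \<Rightarrow> 'b \<Rightarrow> 'b"
  where "finv \<equiv> inv_into UNIV"

text \<open>The condition \<open>subgroup G Maps\<close>, spelled out with plain composition. The
  product of \<open>Maps\<close> reduces to \<open>\<circ>\<close> for bijections only, so
  calculating in the record would leave side conditions at every step.\<close>

definition bij_group :: "('b \<Rightarrow> 'b) set \<Rightarrow> bool"
  where "bij_group G \<longleftrightarrow> (\<forall>g\<in>G. bij g) \<and> id \<in> G \<and> (\<forall>g\<in>G. \<forall>h\<in>G. g \<circ> h \<in> G) \<and> (\<forall>g\<in>G. finv g \<in> G)"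

lemma one_Maps: "\<one>\<^bsub>Maps\<^esub> = id"
  by (simp add: BijGroup_def fun_eq_iff)

lemma subgroup_Maps_iff: "subgroup G Maps \<longleftrightarrow> bij_group G"
proof
  assume G: "subgroup G Maps"
  then have b: "bij g" if "g \<in> G" for g
    using subgroup.subset[OF G] that by auto
  show "bij_group G"
    unfolding bij_group_def
    using b subgroup.one_closed[OF G] subgroup.m_closed[OF G] subgroup.m_inv_closed[OF G]
    by (simp add: one_Maps mult_Maps inv_Maps)
next
  assume "bij_group G"
  then show "subgroup G Maps"
    unfolding bij_group_def
    by (intro subgroup.intro) (auto simp: one_Maps mult_Maps inv_Maps)
qed

lemma bij_groupD:
  assumes "bij_group G"
  shows "g \<in> G \<Longrightarrow> bij g" "id \<in> G" "g \<in> G \<Longrightarrow> h \<in> G \<Longrightarrow> g \<circ> h \<in> G" "g \<in> G \<Longrightarrow> finv g \<in> G"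
  using assms by (auto simp: bij_group_def)

lemma group_grp: "bij_group G \<Longrightarrow> group (grp G)"
  by (simp add: group.subgroup_imp_group group_BijGroup subgroup_Maps_iff)

lemma grp_simps [simp]: "carrier (grp G) = G" "\<one>\<^bsub>grp G\<^esub> = id"
  by (simp_all add: one_Maps[symmetric])

lemma mult_grp: "bij g \<Longrightarrow> bij h \<Longrightarrow> g \<otimes>\<^bsub>grp G\<^esub> h = g \<circ> h"
  using mult_Maps[of g h] by simp

lemma inv_grp: "bij_group G \<Longrightarrow> g \<in> G \<Longrightarrow> inv\<^bsub>grp G\<^esub> g = finv g"
  using group.m_inv_consistent[OF group_BijGroup, of G UNIV g]
  by (simp add: subgroup_Maps_iff inv_Maps bij_groupD)

lemma conj_by_grp: "bij_group G \<Longrightarrow> g \<in> G \<Longrightarrow> h \<in> G \<Longrightarrow> conj_by (grp G) g h = g \<circ> h \<circ> finv g"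
  by (simp add: conj_by_def mult_Maps inv_grp bij_groupD(1) bij_comp bij_imp_bij_inv)

lemma finv_comp: "bij g \<Longrightarrow> finv g \<circ> g = id" "bij g \<Longrightarrow> g \<circ> finv g = id"
  by (auto simp: fun_eq_iff bij_is_inj bij_is_surj surj_f_inv_f)

lemma finv_app [simp]: "bij g \<Longrightarrow> finv g (g x) = x" "bij g \<Longrightarrow> g (finv g x) = x"
  by (auto simp: bij_is_inj bij_is_surj surj_f_inv_f)

lemma bij_finv [simp]: "bij g \<Longrightarrow> bij (finv g)"
  by (rule bij_imp_bij_inv)

lemma finv_finv [simp]: "bij g \<Longrightarrow> finv (finv g) = g"
  by (rule inv_inv_eq)

lemma finv_comp_dist: "bij g \<Longrightarrow> bij h \<Longrightarrow> finv (g \<circ> h) = finv h \<circ> finv g"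
  by (rule o_inv_distrib)

lemma finv_eqI: "(\<And>x. g (h x) = x) \<Longrightarrow> (\<And>x. h (g x) = x) \<Longrightarrow> finv g = h"
  by (rule inv_equality) auto

lemma isometries_iff: "f \<in> isometries \<longleftrightarrow> orthogonal_transformation (lin f)"
proof
  assume "f \<in> isometries"
  then obtain a A where f: "f = (\<lambda>x. a + A x)" and A: "orthogonal_transformation A"
    unfolding isometries_def by blast
  have "lin f = A"
    using orthogonal_transformation_linear[OF A] by (simp add: lin_def f fun_eq_iff linear_0)
  then show "orthogonal_transformation (lin f)" using A by simp
next
  assume "orthogonal_transformation (lin f)"
  moreover have "f = (\<lambda>x. f 0 + lin f x)" by (simp add: lin_def)
  ultimately show "f \<in> isometries" unfolding isometries_def by blast
qed

lemma isometries_dist: "f \<in> isometries \<longleftrightarrow> (\<forall>x y. dist (f x) (f y) = dist x y)"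
proof
  assume "f \<in> isometries"
  then have *: "orthogonal_transformation (lin f)" by (simp add: isometries_iff)
  have "dist (f x) (f y) = dist x y" for x y
    using * unfolding orthogonal_transformation_isometry by (simp add: lin_def dist_norm)
  then show "\<forall>x y. dist (f x) (f y) = dist x y" by blast
next
  assume "\<forall>x y. dist (f x) (f y) = dist x y"
  then show "f \<in> isometries"
    unfolding isometries_iff orthogonal_transformation_isometry
    by (auto simp: lin_def dist_norm)
qed

lemma isometries_bij: "f \<in> isometries \<Longrightarrow> bij f"
proof -
  assume "f \<in> isometries"
  then have "bij (lin f)" unfolding isometries_iff by (rule orthogonal_transformation_bij)
  then have "bij ((+) (f 0) \<circ> lin f)" by (intro bij_comp) simp_all
  moreover have "(+) (f 0) \<circ> lin f = f" by (simp add: lin_def fun_eq_iff)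
  ultimately show "bij f" by simp
qed

lemma affinities_iff: "f \<in> affinities \<longleftrightarrow> linear (lin f) \<and> bij f"
proof
  assume "f \<in> affinities"
  then obtain a A where f: "f = (\<lambda>x. a + A x)" and A: "linear A" "bij A"
    unfolding affinities_def by blast
  have "lin f = A"
    using A by (simp add: lin_def f fun_eq_iff linear_0)
  moreover have "bij ((+) a \<circ> A)" using A by (intro bij_comp) simp_all
  moreover have "(+) a \<circ> A = f" by (simp add: f fun_eq_iff)
  ultimately show "linear (lin f) \<and> bij f" using A by simp
next
  assume *: "linear (lin f) \<and> bij f"
  have "bij ((+) (- f 0) \<circ> f)" using * by (intro bij_comp) simp_all
  moreover have "(+) (- f 0) \<circ> f = lin f" by (simp add: lin_def fun_eq_iff)
  moreover have "f = (\<lambda>x. f 0 + lin f x)" by (simp add: lin_def)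
  ultimately show "f \<in> affinities" using * unfolding affinities_def by force
qed

lemma affinityD:
  assumes "f \<in> affinities"
  shows "linear (lin f)" "bij f" "f (x + y) = f x + lin f y"
proof -
  show "linear (lin f)" "bij f" using assms by (auto simp: affinities_iff)
  then have "lin f (x + y) = lin f x + lin f y" by (simp add: linear_add)
  then show "f (x + y) = f x + lin f y" by (simp add: lin_def algebra_simps)
qed

lemma isometries_affinities: "f \<in> isometries \<Longrightarrow> f \<in> affinities"
  by (simp add: affinities_iff isometries_bij isometries_iff orthogonal_transformation_linear)

lemma lin_comp: "f \<in> affinities \<Longrightarrow> lin (f \<circ> g) = lin f \<circ> lin g"
proof
  fix x
  assume f: "f \<in> affinities"
  have "f (g 0 + lin g x) = f (g 0) + lin f (lin g x)" using f by (rule affinityD(3))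
  then show "lin (f \<circ> g) x = (lin f \<circ> lin g) x"
    by (simp add: lin_def[of g] lin_def[of "f \<circ> g"])
qed

lemma affinities_comp: "f \<in> affinities \<Longrightarrow> g \<in> affinities \<Longrightarrow> f \<circ> g \<in> affinities"
  by (simp add: affinities_iff lin_comp linear_compose bij_comp)

lemma lin_trans [simp]: "lin (\<lambda>x. a + x) = (\<lambda>x. x)"
  by (simp add: lin_def)

lemma lin_id [simp]: "lin id = id"
  by (simp add: lin_def fun_eq_iff)

lemma bij_lin: "f \<in> affinities \<Longrightarrow> bij (lin f)"
proof -
  assume *: "f \<in> affinities"
  have "bij ((+) (- f 0) \<circ> f)" using affinityD[OF *] by (intro bij_comp) simp_all
  moreover have "(+) (- f 0) \<circ> f = lin f" by (simp add: lin_def fun_eq_iff)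
  ultimately show ?thesis by simp
qed

lemma lin_finv: "f \<in> affinities \<Longrightarrow> lin (finv f) = finv (lin f)"
proof -
  assume f: "f \<in> affinities"
  have "lin f \<circ> lin (finv f) = id"
    using lin_comp[OF f, of "finv f"] affinityD(2)[OF f] by (simp add: finv_comp)
  then have 1: "lin f (lin (finv f) x) = x" for x by (simp add: fun_eq_iff)
  have "lin (finv f) (lin f x) = x" for x
    using 1[of "lin f x"] bij_is_inj[OF bij_lin[OF f]] by (auto dest: injD)
  then show ?thesis using 1 by (metis finv_eqI[of "lin f" "lin (finv f)"])
qed

lemma affinities_finv: "f \<in> affinities \<Longrightarrow> finv f \<in> affinities"
  unfolding affinities_iff[of "finv f"]
  by (simp add: lin_finv affinityD inj_linear_imp_inv_linear bij_is_inj[OF bij_lin])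

lemma shift_affinity: "(\<lambda>x. a + x) \<in> affinities"
proof -
  have "bij ((+) a)" by simp
  then show ?thesis using linear_id by (simp add: affinities_iff id_def)
qed

lemma isometries_finv: "f \<in> isometries \<Longrightarrow> finv f \<in> isometries"
proof -
  assume f: "f \<in> isometries"
  have "dist (finv f x) (finv f y) = dist (f (finv f x)) (f (finv f y))" for x y
    using f unfolding isometries_dist by simp
  then show ?thesis using isometries_bij[OF f] by (simp add: isometries_dist)
qed

section \<open>Space groups\<close>

lemma finite_pos_lower_bound:
  fixes f :: "'b \<Rightarrow> real"
  assumes "finite X" "\<And>x. x \<in> X \<Longrightarrow> f x > 0"
  obtains e where "e > 0" "\<And>x. x \<in> X \<Longrightarrow> e \<le> f x"
proof
  \<comment> \<open>The inserted 1 keeps the set nonempty when \<open>X\<close> is empty.\<close>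
  show "Min (insert 1 (f ` X)) > 0" using assms by (subst Min_gr_iff) auto
  show "Min (insert 1 (f ` X)) \<le> f x" if "x \<in> X" for x
    using assms that by (intro Min_le) auto
qed

text \<open>A basic open set for pointwise convergence restricts finitely many values only, and
  finitely many radii have a positive lower bound.\<close>

lemma discrete_fun_iff:
  fixes G :: "('b \<Rightarrow> 'c::metric_space) set"
  shows "discrete G \<longleftrightarrow>
    (\<forall>g\<in>G. \<exists>X e. finite X \<and> e > 0 \<and> (\<forall>h\<in>G. (\<forall>x\<in>X. dist (h x) (g x) < e) \<longrightarrow> h = g))"
proof -
  have "g isolated_in G \<longleftrightarrow> (\<exists>X e. finite X \<and> e > 0 \<and> (\<forall>h\<in>G. (\<forall>x\<in>X. dist (h x) (g x) < e) \<longrightarrow> h = g))"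
    (is "_ \<longleftrightarrow> ?R") if g: "g \<in> G" for g
  proof
    assume "g isolated_in G"
    then obtain T where T: "open T" "T \<inter> G = {g}" unfolding isolated_in_def by blast
    then obtain Y where Y: "g \<in> (\<Pi>\<^sub>E i\<in>UNIV. Y i)" "\<And>i. open (Y i)"
      "finite {i. Y i \<noteq> UNIV}" "(\<Pi>\<^sub>E i\<in>UNIV. Y i) \<subseteq> T"
      using product_topology_open_contains_basis[of "\<lambda>_. euclidean" UNIV T g]
      by (auto simp: open_fun_def)
    have "\<exists>e>0. ball (g i) e \<subseteq> Y i" for i
    proof -
      have "g i \<in> Y i" using Y(1) by (auto simp: PiE_iff)
      then show ?thesis using openE[OF Y(2)[of i]] by metis
    qed
    then obtain d where d: "\<And>i. d i > 0" "\<And>i. ball (g i) (d i) \<subseteq> Y i" by metis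
    obtain e where e: "e > 0" "\<And>i. i \<in> {i. Y i \<noteq> UNIV} \<Longrightarrow> e \<le> d i"
      using finite_pos_lower_bound[OF Y(3), of d] d by metis
    have "h = g" if h: "h \<in> G" "\<forall>x\<in>{i. Y i \<noteq> UNIV}. dist (h x) (g x) < e" for h
    proof -
      have "h i \<in> Y i" for i
      proof (cases "Y i = UNIV")
        case False
        then have "h i \<in> ball (g i) (d i)" using h(2) e(2)[of i] by (auto simp: dist_commute)
        then show ?thesis using d(2) by blast
      qed simp
      then have "h \<in> T" using Y(4) by (auto simp: PiE_iff)
      then show ?thesis using h T by blast
    qed
    then show ?R using Y(3) e(1) by blast
  next
    assume ?R
    then obtain X e where X: "finite X" "e > 0" "\<And>h. h \<in> G \<Longrightarrow> \<forall>x\<in>X. dist (h x) (g x) < e \<Longrightarrow> h = g"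
      by blast
    let ?Y = "\<lambda>i. if i \<in> X then ball (g i) e else UNIV"
    have "open (Pi\<^sub>E UNIV ?Y)"
    proof (rule open_PiE)
      show "finite {i. ?Y i \<noteq> UNIV}" by (rule finite_subset[OF _ X(1)]) auto
    qed auto
    moreover have "Pi\<^sub>E UNIV ?Y \<inter> G = {g}"
    proof -
      have "h = g" if "h \<in> Pi\<^sub>E UNIV ?Y" "h \<in> G" for h
      proof (rule X(3))
        show "\<forall>x\<in>X. dist (h x) (g x) < e"
        proof
          fix x assume "x \<in> X"
          then have "h x \<in> ball (g x) e" using that(1) by (auto simp: PiE_iff dest!: spec[of _ x])
          then show "dist (h x) (g x) < e" by (simp add: dist_commute)
        qed
      qed fact
      moreover have "g \<in> Pi\<^sub>E UNIV ?Y" using X(2) by (auto simp: PiE_iff)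
      ultimately show ?thesis using g by blast
    qed
    ultimately show "g isolated_in G" using g by (auto simp: isolated_in_def)
  qed
  then show ?thesis by (auto simp: discrete_def)
qed

text \<open>Total boundedness, phrased as a finite colouring so that the pigeonhole principle applies.\<close>

lemma finite_colouring:
  fixes X :: "'b set" and r :: real
  assumes X: "finite X" and e: "e > 0"
  shows "\<exists>K (c :: ('b \<Rightarrow> 'a::euclidean_space) \<Rightarrow> 'b \<Rightarrow> 'a). finite K \<and>
    (\<forall>f. (\<forall>x\<in>X. norm (f x) \<le> r) \<longrightarrow> c f \<in> K) \<and>
    (\<forall>f g. (\<forall>x\<in>X. norm (f x) \<le> r) \<longrightarrow> (\<forall>x\<in>X. norm (g x) \<le> r) \<longrightarrow> c f = c g \<longrightarrow>
      (\<forall>x\<in>X. dist (f x) (g x) < e))"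
proof -
  have "compact (cball (0::'a) r)" by simp
  then obtain k where k: "finite k" "cball (0::'a) r \<subseteq> (\<Union>y\<in>k. ball y (e/2))"
    using e unfolding compact_eq_totally_bounded by (metis half_gt_zero)
  define p where "p y = (SOME z. z \<in> k \<and> y \<in> ball z (e/2))" for y
  have p: "p y \<in> k \<and> y \<in> ball (p y) (e/2)" if "norm y \<le> r" for y
  proof -
    have "y \<in> cball 0 r" using that by simp
    then have "\<exists>z. z \<in> k \<and> y \<in> ball z (e/2)" using k(2) by blast
    then show ?thesis unfolding p_def by (rule someI_ex)
  qed
  define c where "c f = restrict (p \<circ> f) X" for f
  have "dist (f x) (g x) < e"
    if "\<forall>x\<in>X. norm (f x) \<le> r" "\<forall>x\<in>X. norm (g x) \<le> r" "c f = c g" "x \<in> X" for f g x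
  proof -
    have "p (f x) = p (g x)" using fun_cong[OF that(3), of x] that(4) by (simp add: c_def)
    then have "dist (p (f x)) (f x) < e/2" "dist (p (f x)) (g x) < e/2"
      using p that by (force simp: mem_ball)+
    then show ?thesis by (rule dist_triangle_half_r)
  qed
  moreover have "c f \<in> X \<rightarrow>\<^sub>E k" if "\<forall>x\<in>X. norm (f x) \<le> r" for f
    using p that by (auto simp: c_def)
  moreover have "finite (X \<rightarrow>\<^sub>E k)" using X k(1) by (rule finite_PiE)
  ultimately show ?thesis by (intro exI[of _ "X \<rightarrow>\<^sub>E k"] exI[of _ c]) blast
qed

lemma affinity_continuous: "f \<in> affinities \<Longrightarrow> continuous_on S f"
proof -
  assume "f \<in> affinities"
  then have "continuous_on S (\<lambda>x. f 0 + lin f x)"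
    by (intro continuous_intros linear_continuous_on) (simp add: affinityD linear_linear)
  then show ?thesis by (simp add: lin_def)
qed

lemma isometries_lin_norm: "f \<in> isometries \<Longrightarrow> norm (lin f x) = norm x"
  by (simp add: isometries_iff orthogonal_transformation_norm)

lemma isometries_norm: "f \<in> isometries \<Longrightarrow> norm (f x) \<le> norm (f 0) + norm x"
  using norm_triangle_ineq[of "f 0" "lin f x"] isometries_lin_norm[of f x] by (simp add: lin_def)

lemma isometries_norm0: "f \<in> isometries \<Longrightarrow> norm (f 0) \<le> norm (f x) + norm x"
  using norm_triangle_ineq4[of "f x" "lin f x"] isometries_lin_norm[of f x] by (simp add: lin_def)

lemma space_groupD:
  assumes "space_group G"
  shows "bij_group G" "g \<in> G \<Longrightarrow> g \<in> isometries" "g \<in> G \<Longrightarrow> g \<in> affinities" "g \<in> G \<Longrightarrow> bij g"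
    "id \<in> G" "g \<in> G \<Longrightarrow> h \<in> G \<Longrightarrow> g \<circ> h \<in> G" "g \<in> G \<Longrightarrow> finv g \<in> G"
proof -
  show *: "bij_group G" "g \<in> G \<Longrightarrow> g \<in> isometries"
    using assms by (auto simp: space_group_def subgroup_Maps_iff)
  show "g \<in> G \<Longrightarrow> g \<in> affinities" using * isometries_affinities by blast
qed (use assms bij_groupD[of G] in \<open>auto simp: space_group_def subgroup_Maps_iff\<close>)

text \<open>A bound on \<open>g 0\<close> bounds an isometry on the finite test set
  \<open>X\<close>, so finitely many colours occur. Elements g, h of the same colour are close on
  \<open>X\<close>; then h^-1 g is close to the identity there and equals it by
  discreteness.\<close>

lemma space_group_finite_ball:
  fixes G :: "('a::euclidean_space \<Rightarrow> 'a) set"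
  assumes G: "space_group G"
  shows "finite {g \<in> G. norm (g 0) \<le> R}" (is "finite ?S")
proof -
  have "discrete G" using G by (simp add: space_group_def)
  then obtain X e where X: "finite X" "e > 0" "\<And>h. h \<in> G \<Longrightarrow> \<forall>x\<in>X. dist (h x) (id x) < e \<Longrightarrow> h = id"
    using space_groupD(5)[OF G] unfolding discrete_fun_iff by metis
  obtain B where B: "\<And>x. x \<in> X \<Longrightarrow> norm x \<le> B"
    using finite_imp_bounded[OF X(1)] by (auto simp: bounded_iff)
  obtain K and c :: "('a \<Rightarrow> 'a) \<Rightarrow> 'a \<Rightarrow> 'a"
    where K: "finite K" and c1: "\<forall>f. (\<forall>x\<in>X. norm (f x) \<le> R + B) \<longrightarrow> c f \<in> K"
    and c2: "\<forall>f g. (\<forall>x\<in>X. norm (f x) \<le> R + B) \<longrightarrow> (\<forall>x\<in>X. norm (g x) \<le> R + B) \<longrightarrow>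
      c f = c g \<longrightarrow> (\<forall>x\<in>X. dist (f x) (g x) < e)"
    using finite_colouring[OF X(1,2), of "R + B"] by (elim exE conjE) (rule that; assumption)
  have bd: "norm (g x) \<le> R + B" if "g \<in> ?S" "x \<in> X" for g x
    using isometries_norm[of g x] space_groupD(2)[OF G, of g] that B[of x] by force
  have "inj_on c ?S"
  proof (rule inj_onI)
    fix g h assume g: "g \<in> ?S" and h: "h \<in> ?S" and eq: "c g = c h"
    have gh: "finv h \<circ> g \<in> G" using g h space_groupD[OF G] by auto
    have "finv h \<circ> g = id"
    proof (rule X(3)[OF gh], rule ballI)
      fix x assume x: "x \<in> X"
      have "dist (g x) (h x) < e" using c2 bd g h eq x by blast
      moreover have "dist (finv h (g x)) (finv h (h x)) = dist (g x) (h x)"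
        using isometries_finv[of h] space_groupD(2)[OF G, of h] h unfolding isometries_dist by auto
      ultimately show "dist ((finv h \<circ> g) x) (id x) < e"
        using space_groupD(4)[OF G, of h] h by simp
    qed
    then have "h (finv h (g x)) = h x" for x by (metis comp_apply id_apply)
    then show "g = h" using space_groupD(4)[OF G, of h] h by auto
  qed
  moreover have "c ` ?S \<subseteq> K" using c1 bd by blast
  ultimately show ?thesis using K finite_imageD finite_subset by blast
qed

lemma topspace_orbit_topology: "topspace (orbit_topology G) = orbit_space G"
  using quotient_map_orbit[of G] by (simp add: quotient_map_def orbit_space_def)

text \<open>The orbits that meet the open ball of radius n form an open set of the quotient. These
  sets increase with n and cover it, so compactness leaves one radius.\<close>

lemma space_group_cobounded:
  fixes G :: "('a::euclidean_space \<Rightarrow> 'a) set"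
  assumes G: "space_group G"
  obtains R where "R > 0" "\<And>x. \<exists>g\<in>G. norm (g x) \<le> R"
proof -
  define U where "U n = {orbit G x |x. norm x < real n}" for n :: nat
  have orb: "orbit G x \<in> U n \<longleftrightarrow> (\<exists>g\<in>G. norm (g x) < n)" for x n
  proof
    assume "orbit G x \<in> U n"
    then obtain y where y: "orbit G x = orbit G y" "norm y < n" by (auto simp: U_def)
    moreover have "y \<in> orbit G y" using space_groupD(5)[OF G] unfolding orbit_def by (metis id_apply image_eqI)
    ultimately have "y \<in> orbit G x" by simp
    then show "\<exists>g\<in>G. norm (g x) < n" using y(2) unfolding orbit_def by blast
  next
    assume "\<exists>g\<in>G. norm (g x) < n"
    then show "orbit G x \<in> U n"
      using orbit_eq[of G] G unfolding U_def space_group_def by (metis (mono_tags, lifting) mem_Collect_eq)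
  qed
  have "openin (orbit_topology G) (U n)" for n
    unfolding openin_orbit_topology
  proof
    show "U n \<subseteq> orbit_space G" by (auto simp: U_def orbit_space_def)
    have "{x. orbit G x \<in> U n} = (\<Union>g\<in>G. {x. norm (g x) < n})" using orb by auto
    moreover have "open {x. norm (g x) < n}" if "g \<in> G" for g
      using affinity_continuous[OF space_groupD(3)[OF G that], of UNIV]
      by (intro open_Collect_less continuous_intros) auto
    ultimately show "open {x. orbit G x \<in> U n}" by auto
  qed
  moreover have "topspace (orbit_topology G) \<subseteq> \<Union>(range U)"
  proof
    fix X assume "X \<in> topspace (orbit_topology G)"
    then obtain x where x: "X = orbit G x" by (auto simp: topspace_orbit_topology orbit_space_def)
    obtain n where "norm x < real n" using reals_Archimedean2 by blast
    then show "X \<in> \<Union>(range U)" unfolding x U_def by blast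
  qed
  moreover have "compact_space (orbit_topology G)" using G by (simp add: space_group_def)
  ultimately obtain F where F: "finite F" "F \<subseteq> range U" "topspace (orbit_topology G) \<subseteq> \<Union>F"
    unfolding compact_space_alt by (metis (no_types, lifting) imageE)
  then obtain I where I: "finite I" "F = U ` I" by (meson finite_subset_image)
  obtain m where m: "\<And>i. i \<in> I \<Longrightarrow> i \<le> m" using I(1) finite_nat_set_iff_bounded_le by auto
  show thesis
  proof (rule that[of "real m + 1"])
    fix x
    have "orbit G x \<in> \<Union>F" using F(3) by (auto simp: topspace_orbit_topology orbit_space_def)
    then obtain i where i: "i \<in> I" "orbit G x \<in> U i" using I by blast
    then obtain g where "g \<in> G" "norm (g x) < i" using orb by blast
    then show "\<exists>g\<in>G. norm (g x) \<le> real m + 1" using m[OF i(1)] by force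
  qed simp
qed

text \<open>Since \<open>K\<close> meets every orbit, the orbit space is the continuous image of a
  compact set.\<close>

lemma space_groupI:
  fixes G :: "('a::euclidean_space \<Rightarrow> 'a) set"
  assumes "bij_group G" "\<And>g. g \<in> G \<Longrightarrow> g \<in> isometries"
    "\<And>g. g \<in> G \<Longrightarrow> \<exists>X e. finite X \<and> e > 0 \<and> (\<forall>h\<in>G. (\<forall>x\<in>X. dist (h x) (g x) < e) \<longrightarrow> h = g)"
    and K: "compact K" "\<And>x. \<exists>g\<in>G. g x \<in> K"
  shows "space_group G"
  unfolding space_group_def subgroup_Maps_iff discrete_fun_iff
proof (intro conjI)
  have "continuous_map euclidean (orbit_topology G) (orbit G)"
    by (rule quotient_imp_continuous_map[OF quotient_map_orbit])
  then have "compactin (orbit_topology G) (orbit G ` K)"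
    using K(1) by (intro image_compactin[of euclidean]) (simp_all add: compactin_euclidean_iff)
  moreover have "orbit G ` K = topspace (orbit_topology G)"
  proof -
    have "orbit G x \<in> orbit G ` K" for x
    proof -
      obtain g where "g \<in> G" "g x \<in> K" using K(2) by blast
      then show ?thesis using orbit_eq[of G g x] assms(1) unfolding subgroup_Maps_iff by blast
    qed
    then show ?thesis by (auto simp: topspace_orbit_topology orbit_space_def)
  qed
  ultimately show "compact_space (orbit_topology G)" by (simp add: compact_space_def)
qed (use assms in auto)

section \<open>Affinities that centralize a space group or preserve its orbits\<close>

lemma bounded_linear_range_zero:
  fixes f :: "'a::euclidean_space \<Rightarrow> 'a"
  assumes f: "linear f" and B: "\<And>x. norm (f x) \<le> B"
  shows "f x = 0"
proof (rule ccontr)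
  assume n: "f x \<noteq> 0"
  obtain k :: nat where k: "B < real k * norm (f x)" using n reals_Archimedean3[of "norm (f x)"] by auto
  have "norm (f (real k *\<^sub>R x)) = real k * norm (f x)" by (simp add: linear_scale[OF f])
  then show False using B[of "real k *\<^sub>R x"] k by linarith
qed

text \<open>The displacement of \<open>\<phi>\<close> is constant on orbits, hence bounded.\<close>

lemma centralizer_translation:
  fixes G :: "('a::euclidean_space \<Rightarrow> 'a) set"
  assumes G: "space_group G" and \<phi>: "\<phi> \<in> affinities"
    and com: "\<And>g. g \<in> G \<Longrightarrow> \<phi> \<circ> g = g \<circ> \<phi>"
  shows "lin \<phi> = id"
proof -
  obtain R where R: "\<And>x. \<exists>g\<in>G. norm (g x) \<le> R" using space_group_cobounded[OF G] by metis
  have "continuous_on (cball 0 R) (\<lambda>x. \<phi> x - x)"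
    using affinity_continuous[OF \<phi>] by (intro continuous_intros)
  then have "bounded ((\<lambda>x. \<phi> x - x) ` cball 0 R)"
    by (intro compact_imp_bounded compact_continuous_image) auto
  then obtain B where B: "\<And>x. norm x \<le> R \<Longrightarrow> norm (\<phi> x - x) \<le> B"
    unfolding bounded_iff by force
  have disp: "norm (\<phi> x - x) \<le> B" for x
  proof -
    obtain g where g: "g \<in> G" "norm (g x) \<le> R" using R by blast
    have "dist (\<phi> x) x = dist (g (\<phi> x)) (g x)"
      using space_groupD(2)[OF G g(1)] by (simp add: isometries_dist)
    also have "g (\<phi> x) = \<phi> (g x)" using fun_cong[OF com[OF g(1)], of x] by simp
    finally show ?thesis using B[OF g(2)] by (simp add: dist_norm)
  qed
  have "lin \<phi> x - x = 0" for x
  proof (rule bounded_linear_range_zero[of "\<lambda>x. lin \<phi> x - x" "B + norm (\<phi> 0)"])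
    show "linear (\<lambda>x. lin \<phi> x - x)" by (intro linear_compose_sub affinityD \<phi> linear_ident)
    show "norm (lin \<phi> x - x) \<le> B + norm (\<phi> 0)" for x
      using norm_triangle_ineq4[of "\<phi> x - x" "\<phi> 0"] disp[of x] by (simp add: lin_def algebra_simps)
  qed
  then show ?thesis by (simp add: fun_eq_iff)
qed

text \<open>With equal linear parts the two maps differ by a nonzero constant. Otherwise the
  coincidence set lies in a hyperplane, whose normal \<open>w\<close> is the adjoint of the
  difference of linear parts applied to one of its nonzero values.\<close>

lemma negligible_affine_coincidence:
  fixes f g :: "'a::euclidean_space \<Rightarrow> 'a"
  assumes f: "f \<in> affinities" and g: "g \<in> affinities" and ne: "f \<noteq> g"
  shows "negligible {x. f x = g x}"
proof (cases "lin f = lin g")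
  case True
  then have "{x. f x = g x} = {}"
  proof -
    have "f = g" if "f x = g x" for x
    proof
      fix y
      have "f y = f x + (lin f y - lin f x)" by (simp add: lin_def)
      also have "\<dots> = g y" using True that by (simp add: lin_def[of g])
      finally show "f y = g y" .
    qed
    then show ?thesis using ne by blast
  qed
  then show ?thesis by simp
next
  case False
  then obtain y where y: "lin f y - lin g y \<noteq> 0" by fastforce
  define b where "b = lin f y - lin g y"
  have L: "linear (\<lambda>x. lin f x - lin g x)" by (intro linear_compose_sub affinityD f g)
  define w where "w = adjoint (\<lambda>x. lin f x - lin g x) b"
  have w: "x \<bullet> w = (lin f x - lin g x) \<bullet> b" for x unfolding w_def by (rule adjoint_works[OF L])
  have "y \<bullet> w \<noteq> 0" using y by (simp add: w b_def)
  then have "w \<noteq> 0" by auto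
  then have "negligible {x. w \<bullet> x = (g 0 - f 0) \<bullet> b}" by (intro negligible_hyperplane) simp
  moreover have "{x. f x = g x} \<subseteq> {x. w \<bullet> x = (g 0 - f 0) \<bullet> b}"
  proof clarify
    fix x assume "f x = g x"
    then have "lin f x - lin g x = g 0 - f 0" by (simp add: lin_def)
    then show "w \<bullet> x = (g 0 - f 0) \<bullet> b" using w[of x] by (simp add: inner_commute)
  qed
  ultimately show ?thesis by (rule negligible_subset)
qed

text \<open>Near the origin only finitely many elements of \<open>G\<close> can agree with \<open>\<phi>\<close> at a point, and
  finitely many proper affine subspaces do not fill a ball.\<close>

lemma orbit_preserving_affinity:
  fixes G :: "('a::euclidean_space \<Rightarrow> 'a) set"
  assumes G: "space_group G" and \<phi>: "\<phi> \<in> affinities"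
    and orb: "\<And>x. \<phi> x \<in> orbit G x"
  shows "\<phi> \<in> G"
proof (rule ccontr)
  assume n: "\<phi> \<notin> G"
  have "bounded (\<phi> ` cball 0 1)"
    by (intro compact_imp_bounded compact_continuous_image affinity_continuous \<phi>) auto
  then obtain B where B: "\<And>x. norm x \<le> 1 \<Longrightarrow> norm (\<phi> x) \<le> B"
    unfolding bounded_iff by force
  have "ball 0 1 \<subseteq> (\<Union>g\<in>{g \<in> G. norm (g 0) \<le> B + 1}. {x. \<phi> x = g x})"
  proof
    fix x :: 'a assume x: "x \<in> ball 0 1"
    obtain g where g: "g \<in> G" "\<phi> x = g x" using orb[of x] unfolding orbit_def by blast
    have "norm (g 0) \<le> B + 1"
      using isometries_norm0[OF space_groupD(2)[OF G g(1)], of x] B[of x] x g(2) by auto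
    then show "x \<in> (\<Union>g\<in>{g \<in> G. norm (g 0) \<le> B + 1}. {x. \<phi> x = g x})" using g by blast
  qed
  moreover have "negligible (\<Union>g\<in>{g \<in> G. norm (g 0) \<le> B + 1}. {x. \<phi> x = g x})"
    using n by (intro negligible_Union finite_imageI space_group_finite_ball[OF G])
      (auto intro!: negligible_affine_coincidence \<phi> space_groupD(3)[OF G])
  ultimately have "negligible (ball (0::'a) 1)" using negligible_subset by blast
  then show False using open_not_negligible[of "ball (0::'a) 1"] by simp
qed

section \<open>Bieberbach's first theorem\<close>

text \<open>Compactness of the orthogonal group in a form suited to the pigeonhole principle. A
  linear map is controlled by its values on \<open>Basis\<close>; errors of
  \<open>e / DIM('a)\<close> there add up to \<open>e\<close> in operator norm.\<close>

lemma rotation_colouring: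
  assumes e: "e > (0::real)"
  shows "\<exists>K (c :: ('a::euclidean_space \<Rightarrow> 'a) \<Rightarrow> 'a \<Rightarrow> 'a). finite K \<and>
    (\<forall>A. orthogonal_transformation A \<longrightarrow> c A \<in> K) \<and>
    (\<forall>A B x. orthogonal_transformation A \<longrightarrow> orthogonal_transformation B \<longrightarrow> c A = c B \<longrightarrow>
      norm (A x - B x) \<le> e * norm x)"
proof -
  let ?d = "real DIM('a)"
  have d: "?d > 0" by simp
  then have e': "e / ?d > 0" using e by simp
  obtain K and c :: "('a \<Rightarrow> 'a) \<Rightarrow> 'a \<Rightarrow> 'a"
    where K: "finite K" and c1: "\<forall>f. (\<forall>x\<in>(Basis::'a set). norm (f x) \<le> 1) \<longrightarrow> c f \<in> K"
    and c2: "\<forall>f g. (\<forall>x\<in>(Basis::'a set). norm (f x) \<le> 1) \<longrightarrow>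
      (\<forall>x\<in>(Basis::'a set). norm (g x) \<le> 1) \<longrightarrow>
      c f = c g \<longrightarrow> (\<forall>x\<in>(Basis::'a set). dist (f x) (g x) < e / ?d)"
    using finite_colouring[OF finite_Basis e', of 1] by (elim exE conjE) (rule that; assumption)
  have c1': "c A \<in> K" if "orthogonal_transformation A" for A
    using c1 that by (simp add: orthogonal_transformation_norm)
  have "norm (A x - B x) \<le> e * norm x"
    if A: "orthogonal_transformation A" and B: "orthogonal_transformation B" and eq: "c A = c B"
    for A B :: "'a \<Rightarrow> 'a" and x :: 'a
  proof -
    have L: "linear (\<lambda>x. A x - B x)"
      by (intro linear_compose_sub orthogonal_transformation_linear A B)
    have *: "norm (A b - B b) \<le> e / ?d" if "b \<in> Basis" for b
      using c2[rule_format, of A B b] A B eq that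
      by (simp add: orthogonal_transformation_norm dist_norm)
    have "A x - B x = (\<Sum>b\<in>Basis. (x \<bullet> b) *\<^sub>R (A b - B b))"
      using linear_sum[OF L, of "\<lambda>b. (x \<bullet> b) *\<^sub>R b" Basis]
      by (simp add: euclidean_representation linear_scale[OF L])
    also have "norm \<dots> \<le> (\<Sum>b\<in>Basis. norm ((x \<bullet> b) *\<^sub>R (A b - B b)))" by (rule norm_sum)
    also have "\<dots> \<le> (\<Sum>b\<in>(Basis::'a set). norm x * (e / ?d))"
      unfolding norm_scaleR real_norm_def using *
      by (intro sum_mono mult_mono Basis_le_norm) auto
    also have "\<dots> = e * norm x" using d by simp
    finally show ?thesis .
  qed
  then show ?thesis using K c1' by (intro exI[of _ K] exI[of _ c]) blast
qed

text \<open>Some \<open>h k\<close> carries the origin to within \<open>R\<close> of k u. Infinitely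
  many of the \<open>h k\<close> have almost the same rotation; dividing one with large index
  \<open>j\<close> by a fixed one cancels the rotation and disturbs the translation part by a
  bounded amount only.\<close>

lemma space_group_directions:
  fixes G :: "('a::euclidean_space \<Rightarrow> 'a) set"
  assumes G: "space_group G" and u: "norm u = 1" and e: "e > (0::real)"
  obtains g s where "g \<in> G" "s > 0" "norm (g 0 - s *\<^sub>R u) \<le> e * s" "\<And>x. norm (lin g x - x) \<le> e * norm x"
proof -
  obtain R where R: "\<And>x. \<exists>g\<in>G. norm (g x) \<le> R" using space_group_cobounded[OF G] by metis
  have "\<exists>g\<in>G. norm (g 0 - real k *\<^sub>R u) \<le> R" for k
  proof -
    obtain g where g: "g \<in> G" "norm (g (real k *\<^sub>R u)) \<le> R" using R by blast
    have "dist (finv g 0) (finv g (g (real k *\<^sub>R u))) = dist 0 (g (real k *\<^sub>R u))"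
      using isometries_finv[OF space_groupD(2)[OF G g(1)]] by (simp add: isometries_dist)
    then have "norm (finv g 0 - real k *\<^sub>R u) \<le> R"
      using g(2) space_groupD(4)[OF G g(1)] by (simp add: dist_norm)
    then show ?thesis using space_groupD(7)[OF G g(1)] by blast
  qed
  then obtain h where h: "\<And>k. h k \<in> G" "\<And>k. norm (h k 0 - real k *\<^sub>R u) \<le> R" by metis
  have hO: "orthogonal_transformation (lin (h k))" for k
    using space_groupD(2)[OF G h(1)] by (simp add: isometries_iff)
  obtain K and c :: "('a \<Rightarrow> 'a) \<Rightarrow> 'a \<Rightarrow> 'a" where K: "finite K"
    and c1: "\<forall>A. orthogonal_transformation A \<longrightarrow> c A \<in> K"
    and c2: "\<forall>A B x. orthogonal_transformation A \<longrightarrow> orthogonal_transformation B \<longrightarrow> c A = c B \<longrightarrow>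
      norm (A x - B x) \<le> e * norm x"
    using rotation_colouring[OF e] by (elim exE conjE) (rule that; assumption)
  have "finite (range (\<lambda>k. c (lin (h k))))" using K c1 hO by (meson finite_subset image_subsetI)
  then obtain i where inf: "infinite {k. c (lin (h k)) = c (lin (h i))}"
    using pigeonhole_infinite[of UNIV "\<lambda>k. c (lin (h k))"] by auto
  \<comment> \<open>\<open>C\<close> bounds the translation error independently of \<open>j\<close>,
    so it drops below \<open>e * j\<close> as soon as \<open>j > C / e\<close>.\<close>
  define C where "C = norm (h i 0) + R"
  obtain k0 :: nat where k0: "C / e < k0" using reals_Archimedean2 by blast
  obtain j where j: "c (lin (h j)) = c (lin (h i))" "j > k0"
    using inf unfolding infinite_nat_iff_unbounded by blast
  have fi: "finv (h i) \<in> G" using h(1) G space_groupD(7) by blast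
  define g where "g = h j \<circ> finv (h i)"
  have gG: "g \<in> G" unfolding g_def by (rule space_groupD(6)[OF G h(1) fi])
  show thesis
  proof (rule that[OF gG, of "real j"])
    have "C / e < real j" using k0 j(2) by linarith
    then have j0: "C < e * j" using e by (simp add: field_simps)
    have "real j > 0" using j(2) by simp
    then show "real j > 0" by simp
    have g0: "g 0 - real j *\<^sub>R u = (h j 0 - real j *\<^sub>R u) + lin (h j) (finv (h i) 0)"
      by (simp add: g_def lin_def)
    have "norm (g 0 - real j *\<^sub>R u) \<le> R + norm (finv (h i) 0)"
      using norm_triangle_ineq[of "h j 0 - real j *\<^sub>R u" "lin (h j) (finv (h i) 0)"] h(2)[of j]
        isometries_lin_norm[OF space_groupD(2)[OF G h(1)], of j "finv (h i) 0"]
      unfolding g0 by linarith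
    moreover have "norm (finv (h i) 0) = norm (h i 0)"
    proof -
      have "dist (h i (finv (h i) 0)) (h i 0) = dist (finv (h i) 0) 0"
        using space_groupD(2)[OF G h(1)] by (simp add: isometries_dist)
      then show ?thesis using space_groupD(4)[OF G h(1)] by simp
    qed
    ultimately show "norm (g 0 - real j *\<^sub>R u) \<le> e * real j" using j0 by (simp add: C_def)
    fix x
    define y where "y = lin (finv (h i)) x"
    have x: "lin (h i) y = x"
      using lin_finv[OF space_groupD(3)[OF G h(1)], of i] bij_lin[OF space_groupD(3)[OF G h(1)]]
      by (simp add: y_def)
    then have ny: "norm y = norm x" using isometries_lin_norm[OF space_groupD(2)[OF G h(1)]] by metis
    have "lin g x = lin (h j) y"
      by (simp add: g_def y_def lin_comp[OF space_groupD(3)[OF G h(1)]])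
    then show "norm (lin g x - x) \<le> e * norm x"
      using c2[rule_format, OF hO hO j(1), of y] by (simp add: x ny)
  qed
qed

lemma orthogonal_norm_le:
  assumes "orthogonal y z"
  shows "norm y \<le> norm (y + z)" "norm z \<le> norm (y + z)"
proof -
  have *: "(norm (y + z))\<^sup>2 = (norm y)\<^sup>2 + (norm z)\<^sup>2" by (rule norm_add_Pythagorean[OF assms])
  show "norm y \<le> norm (y + z)" "norm z \<le> norm (y + z)"
    by (rule power2_le_imp_le; simp add: *)+
qed

text \<open>\<open>E\<close> is the subspace on which \<open>A\<close> rotates by its largest angle.\<close>

lemma max_rotation_decomposition:
  fixes A :: "'a::euclidean_space \<Rightarrow> 'a"
  assumes A: "orthogonal_transformation A" and ne: "A \<noteq> id"
  obtains E F m m' u where "subspace E" "subspace F" "\<And>x y. x \<in> E \<Longrightarrow> y \<in> F \<Longrightarrow> orthogonal x y"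
    "\<And>x. \<exists>y\<in>E. \<exists>z\<in>F. x = y + z" "\<And>x. x \<in> E \<Longrightarrow> A x \<in> E" "\<And>x. x \<in> F \<Longrightarrow> A x \<in> F"
    "\<And>x. x \<in> E \<Longrightarrow> norm (A x - x) = m * norm x" "\<And>x. x \<in> F \<Longrightarrow> norm (A x - x) \<le> m' * norm x"
    "\<And>x. norm (A x - x) \<le> m * norm x" "0 \<le> m'" "m' < m" "u \<in> E" "norm u = 1"
proof -
  have L: "linear A" using A by (rule orthogonal_transformation_linear)
  have bA: "bij A" using A by (rule orthogonal_transformation_bij)
  define A' where "A' = finv A"
  have A'O: "orthogonal_transformation A'"
    unfolding A'_def by (rule orthogonal_transformation_inv[OF A])
  have L': "linear A'" using A'O by (rule orthogonal_transformation_linear)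
  have AA': "A (A' x) = x" "A' (A x) = x" for x using bA by (simp_all add: A'_def)
  have inn: "A x \<bullet> A y = x \<bullet> y" for x y using A by (simp add: orthogonal_transformation_def)
  have adj: "A x \<bullet> y = x \<bullet> A' y" for x y using inn[of x "A' y"] by (simp add: AA')
  let ?f = "\<lambda>x. norm (A x - x)"
  have cont: "continuous_on S ?f" for S
    by (intro continuous_intros linear_continuous_on linear_linear[THEN iffD2] L)
  have scal: "?f (c *\<^sub>R x) = \<bar>c\<bar> * ?f x" for c x
    by (simp add: linear_scale[OF L] scaleR_diff_right[symmetric])
  have bound: "?f x \<le> k * norm x"
    if "subspace F" "\<And>x. x \<in> F \<Longrightarrow> norm x = 1 \<Longrightarrow> ?f x \<le> k" "x \<in> F" for F k x
  proof (cases "x = 0")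
    case True
    then show ?thesis using linear_0[OF L] by simp
  next
    case False
    have "?f ((1 / norm x) *\<^sub>R x) \<le> k"
      using that False by (intro that(2)) (auto intro: subspace_scale)
    then show ?thesis using False by (simp add: scal field_simps)
  qed
  have "sphere (0::'a) 1 \<noteq> {}" by simp
  then obtain u where u: "norm u = 1" "\<And>x. norm x = 1 \<Longrightarrow> ?f x \<le> ?f u"
    using continuous_attains_sup[OF compact_sphere[of "0::'a" 1] _ cont] by auto
  define m where "m = ?f u"
  have m: "?f x \<le> m * norm x" for x using bound[of UNIV m x] u by (simp add: m_def)
  obtain x0 where "A x0 \<noteq> x0" using ne by (auto simp: fun_eq_iff)
  then have "0 < m * norm x0" using m[of x0] by (smt (verit) zero_less_norm_iff right_minus_eq)
  then have mpos: "m > 0" by (metis norm_ge_zero zero_less_mult_pos2 mult_zero_right order_less_le)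
  \<comment> \<open>As \<open>A\<close> is orthogonal, 2 I - A - A^-1 is the product of A - I with
    its adjoint. So \<open>T\<close> is positive semidefinite, with x . T x = m^2 |x|^2 - |A x -
    x|^2, and its kernel consists of the vectors for which the bound \<open>m\<close> is
    attained.\<close>
  define T where "T x = m\<^sup>2 *\<^sub>R x - (2 *\<^sub>R x - A x - A' x)" for x
  have T: "linear T"
    unfolding T_def
    by (intro linear_compose_sub linear_ident linear_scale_self L L')
  have q: "(?f x)\<^sup>2 = 2 * (x \<bullet> x) - 2 * (A x \<bullet> x)" for x
    unfolding power2_norm_eq_inner using inn[of x x]
    by (simp add: inner_diff_left inner_diff_right inner_commute)
  have xT: "x \<bullet> T x = m\<^sup>2 * (norm x)\<^sup>2 - (?f x)\<^sup>2" for x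
    unfolding q using adj[of x x]
    by (simp add: T_def inner_diff_right power2_norm_eq_inner inner_commute)
  have Tpos: "x \<bullet> T x \<ge> 0" for x
    using power_mono[OF m[of x], of 2] by (simp add: xT power_mult_distrib)
  have Tsym: "x \<bullet> T y = T x \<bullet> y" for x y
    using adj[of x y] adj[of y x]
    by (simp add: T_def inner_diff_right inner_diff_left inner_commute)
  \<comment> \<open>A zero of the quadratic form is a minimum, whereas moving from \<open>x\<close>
    along - T x would make the form negative. The choice \<open>t = p / (c + 1)\<close> keeps the
    quadratic term at most half of the linear one.\<close>
  have T0: "T x = 0" if "x \<bullet> T x = 0" for x
  proof (rule ccontr)
    assume n: "T x \<noteq> 0"
    define p where "p = T x \<bullet> T x"
    define c where "c = T x \<bullet> T (T x)"
    have p: "p > 0" using n by (simp add: p_def)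
    have c: "c \<ge> 0" using Tpos by (simp add: c_def)
    define t where "t = p / (c + 1)"
    have "(x - t *\<^sub>R T x) \<bullet> T (x - t *\<^sub>R T x) = - 2 * t * p + t\<^sup>2 * c"
      using that Tsym[of x "T x"]
      by (simp add: linear_diff[OF T] linear_scale[OF T] inner_diff_left inner_diff_right p_def c_def
          power2_eq_square algebra_simps)
    then have "0 \<le> - 2 * t * p + t\<^sup>2 * c" using Tpos by metis
    moreover have "t * c \<le> p" using c p by (simp add: t_def field_simps)
    moreover have t: "t > 0" using c p by (simp add: t_def)
    ultimately have "0 \<le> - 2 * t * p + t * p"
      by (smt (verit) mult.assoc mult_left_mono power2_eq_square)
    then show False using mult_pos_pos[OF t p] by (simp add: mult.commute)
  qed
  define E where "E = {x. T x = 0}"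
  define F where "F = {y. \<forall>x\<in>E. orthogonal x y}"
  have E: "x \<in> E \<longleftrightarrow> ?f x = m * norm x" for x
  proof -
    have "x \<in> E \<longleftrightarrow> x \<bullet> T x = 0" using T0 by (auto simp: E_def)
    also have "\<dots> \<longleftrightarrow> (?f x)\<^sup>2 = (m * norm x)\<^sup>2" unfolding xT by (auto simp: power_mult_distrib)
    also have "\<dots> \<longleftrightarrow> ?f x = m * norm x" using mpos by (intro power2_eq_iff_nonneg) auto
    finally show ?thesis .
  qed
  have sE: "subspace E" unfolding E_def 
    by (rule subspaceI) (simp_all add: linear_0[OF T] linear_add[OF T] linear_scale[OF T])
  have sF: "subspace F" unfolding F_def by (rule subspace_orthogonal_to_vectors)
  have TA: "T (A x) = A (T x)" "T (A' x) = A' (T x)" for x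
    by (simp_all add: T_def linear_diff[OF L] linear_scale[OF L] linear_diff[OF L'] linear_scale[OF L'] AA')
  have EA: "A x \<in> E" "A' x \<in> E" if "x \<in> E" for x
    using that linear_0[OF L] linear_0[OF L'] by (simp_all add: E_def TA)
  have FA: "A y \<in> F" if "y \<in> F" for y
    using that EA(2) by (auto simp: F_def orthogonal_def) (metis adj inner_commute)
  obtain m' where m': "0 \<le> m'" "m' < m" "\<And>x. x \<in> F \<Longrightarrow> norm x = 1 \<Longrightarrow> ?f x \<le> m'"
  \<comment> \<open>Without unit vectors \<open>F\<close> is zero and \<open>m' = 0\<close> serves.
    Otherwise \<open>m'\<close> is a maximum attained at some \<open>w\<close> outside
    \<open>E\<close>, hence strictly smaller than \<open>m\<close>.\<close>
  proof (cases "sphere 0 1 \<inter> F = {}")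
    case True
    have "?f x \<le> 0" if "x \<in> F" "norm x = 1" for x
    proof -
      have "x \<in> sphere 0 1 \<inter> F" using that by simp
      then show ?thesis using True by blast
    qed
    then show ?thesis using that[of 0] mpos by blast
  next
    case False
    have "compact (sphere 0 1 \<inter> F)" by (intro compact_Int_closed closed_subspace sF) simp
    then obtain w where w: "w \<in> F" "norm w = 1" "\<And>x. x \<in> F \<Longrightarrow> norm x = 1 \<Longrightarrow> ?f x \<le> ?f w"
      using continuous_attains_sup[OF _ False cont] by auto
    have "w \<notin> E"
    proof
      assume "w \<in> E"
      then have "orthogonal w w" using w(1) by (simp add: F_def)
      then show False using w(2) by (simp add: orthogonal_self)
    qed
    then have "?f w < m" using E[of w] m[of w] w(2) by simp
    then show ?thesis using that[of "?f w"] w by simp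
  qed
  show thesis
  proof (rule that[OF sE sF _ _ EA(1) FA _ _ m m'(1,2), of u])
    show "\<And>x y. x \<in> E \<Longrightarrow> y \<in> F \<Longrightarrow> orthogonal x y" by (simp add: F_def)
    show "\<exists>y\<in>E. \<exists>z\<in>F. x = y + z" for x
      using orthogonal_subspace_decomp_exists[of E x] span_eq_iff[THEN iffD2, OF sE]
      by (auto simp: F_def orthogonal_commute) metis
    show "?f x = m * norm x" if "x \<in> E" for x using E that by simp
    show "?f x \<le> m' * norm x" if "x \<in> F" for x using bound[OF sF] m'(3) that by blast
    show "u \<in> E" using E u by (simp add: m_def)
    show "norm u = 1" by fact
  qed
qed

text \<open>Only finitely many elements of \<open>G\<close> have a translation part below a given
  bound, so minimal ones exist; this drives the descent below.\<close>

lemma space_group_min_translation: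
  fixes G :: "('a::euclidean_space \<Rightarrow> 'a) set"
  assumes G: "space_group G" and S: "S \<subseteq> G" "S \<noteq> {}"
  obtains a where "a \<in> S" "\<And>b. b \<in> S \<Longrightarrow> norm (a 0) \<le> norm (b 0)"
proof -
  obtain s where s: "s \<in> S" using S by blast
  define B where "B = {g \<in> S. norm (g 0) \<le> norm (s 0)}"
  have B: "finite B" "B \<noteq> {}"
    using finite_subset[OF _ space_group_finite_ball[OF G, of "norm (s 0)"], of B] S s
    by (auto simp: B_def)
  define a where "a = arg_min_on (\<lambda>g. norm (g 0)) B"
  have a: "a \<in> B" "\<And>b. b \<in> B \<Longrightarrow> norm (a 0) \<le> norm (b 0)"
    using arg_min_if_finite[OF B, of "\<lambda>g. norm (g 0)"] by (auto simp: a_def not_less)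
  show thesis
  proof (rule that[of a])
    show "a \<in> S" using a by (simp add: B_def)
    fix b assume b: "b \<in> S"
    show "norm (a 0) \<le> norm (b 0)"
    proof (cases "b \<in> B")
      case False
      then show ?thesis using b a(1) by (auto simp: B_def)
    qed (use a in auto)
  qed
qed

text \<open>Buser's argument: for \<open>a\<close> of small non-trivial rotation, commutators with \<open>a\<close> shrink the
  translation part of elements that move the origin mainly along \<open>E\<close>.\<close>

lemma small_rotation_trivial:
  fixes G :: "('a::euclidean_space \<Rightarrow> 'a) set"
  assumes G: "space_group G" and "g \<in> G" "\<And>x. norm (lin g x - x) \<le> norm x / 2"
  shows "lin g = id"
proof (rule ccontr)
  assume "lin g \<noteq> id"
  \<comment> \<open>The counterexamples. The shortest one, \<open>a\<close>, will be compared with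
    the element \<open>b\<close> below whenever \<open>b\<close> rotates as well.\<close>
  define S where "S = {a \<in> G. (\<forall>x. norm (lin a x - x) \<le> norm x / 2) \<and> lin a \<noteq> id}"
  have "g \<in> S" using assms \<open>lin g \<noteq> id\<close> by (simp add: S_def)
  then obtain a where a: "a \<in> S" and amin: "\<And>b. b \<in> S \<Longrightarrow> norm (a 0) \<le> norm (b 0)"
    using space_group_min_translation[OF G, of S] by (auto simp: S_def)
  define A where "A = lin a"
  have aG: "a \<in> G" and Ane: "A \<noteq> id" and Asmall: "\<And>x. norm (A x - x) \<le> norm x / 2"
    using a by (auto simp: S_def A_def)
  have AO: "orthogonal_transformation A"
    using space_groupD(2)[OF G aG] by (simp add: A_def isometries_iff)
  have LA: "linear A" using AO by (rule orthogonal_transformation_linear)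
  obtain E F m m' u where sE: "subspace E" and sF: "subspace F"
    and EF: "\<And>x y. x \<in> E \<Longrightarrow> y \<in> F \<Longrightarrow> orthogonal x y"
    and dec: "\<And>x. \<exists>y\<in>E. \<exists>z\<in>F. x = y + z" and EA: "\<And>x. x \<in> E \<Longrightarrow> A x \<in> E"
    and FA: "\<And>x. x \<in> F \<Longrightarrow> A x \<in> F"
    and mE: "\<And>x. x \<in> E \<Longrightarrow> norm (A x - x) = m * norm x"
    and mF: "\<And>x. x \<in> F \<Longrightarrow> norm (A x - x) \<le> m' * norm x"
    and m: "\<And>x. norm (A x - x) \<le> m * norm x" and m': "0 \<le> m'" "m' < m"
    and u: "u \<in> E" "norm u = 1"
    by (rule max_rotation_decomposition[OF AO Ane]) (rule that)
  have m2: "m \<le> 1/2" using mE[OF u(1)] Asmall[of u] u(2) by simp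
  \<comment> \<open>The error \<open>r\<close> below has norm at most
    \<open>6 * \<mu> * norm y\<close> and enters both components of the commutator, so the gap
    \<open>(m - m') * norm y\<close>, which is \<open>16 * \<mu> * norm y\<close>, still exceeds
    twice the error. From \<open>m \<le> 1/2\<close> also \<open>\<mu> \<le> 1/32\<close>, which
    makes the final contraction factor less than 1.\<close>
  define \<mu> where "\<mu> = (m - m') / 16"
  have \<mu>: "\<mu> > 0" "\<mu> \<le> 1/32" using m' m2 by (auto simp: \<mu>_def)
  \<comment> \<open>Unlike \<open>S\<close>, \<open>P\<close> admits pure translations, since
    \<open>space_group_directions\<close> does not promise a nontrivial rotation. What counts is
    that the translation part is nonzero and leans towards \<open>E\<close>, where A - I acts with
    the full factor \<open>m\<close>.\<close>
  define P where "P b \<longleftrightarrow> b \<in> G \<and> (\<forall>x. norm (lin b x - x) \<le> \<mu> * norm x) \<and>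
    (\<exists>y\<in>E. \<exists>z\<in>F. b 0 = y + z \<and> norm z \<le> norm y \<and> y \<noteq> 0)" for b
  obtain b0 s where b0: "b0 \<in> G" "s > 0" "norm (b0 0 - s *\<^sub>R u) \<le> \<mu> * s"
    "\<And>x. norm (lin b0 x - x) \<le> \<mu> * norm x"
    by (rule space_group_directions[OF G u(2) \<mu>(1)]) (rule that)
  have "P b0"
  proof -
    obtain y z where yz: "y \<in> E" "z \<in> F" "b0 0 = y + z" using dec by blast
    have orth: "orthogonal (y - s *\<^sub>R u) z"
      using sE u(1) yz by (intro EF) (auto intro: subspace_diff subspace_scale)
    have "b0 0 - s *\<^sub>R u = (y - s *\<^sub>R u) + z" using yz by simp
    then have "norm ((y - s *\<^sub>R u) + z) \<le> \<mu> * s" using b0(3) by metis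
    moreover have "\<mu> * s \<le> s / 2" using \<mu>(2) b0(2) by simp
    ultimately have "norm (y - s *\<^sub>R u) \<le> s / 2" "norm z \<le> s / 2"
      using orthogonal_norm_le[OF orth] by linarith+
    moreover have "norm (s *\<^sub>R u) = s" using u(2) b0(2) by simp
    ultimately have "norm y \<ge> s / 2" "norm z \<le> s / 2"
      using norm_triangle_ineq4[of y "y - s *\<^sub>R u"] by auto
    then show ?thesis using yz b0 by (force simp: P_def)
  qed
  have "\<exists>b. P b \<and> (\<forall>c. P c \<longrightarrow> norm (b 0) \<le> norm (c 0))"
  proof (rule space_group_min_translation[OF G, of "Collect P"])
    show "Collect P \<subseteq> G" by (auto simp: P_def)
    show "Collect P \<noteq> {}" using \<open>P b0\<close> by blast
  qed auto
  then obtain b where Pb: "P b" and bmin: "\<And>c. P c \<Longrightarrow> norm (b 0) \<le> norm (c 0)" by blast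
  define B where "B = lin b"
  have bG: "b \<in> G" and Bsmall: "\<And>x. norm (B x - x) \<le> \<mu> * norm x" using Pb by (auto simp: P_def B_def)
  have BO: "orthogonal_transformation B"
    using space_groupD(2)[OF G bG] by (simp add: B_def isometries_iff)
  have LB: "linear B" using BO by (rule orthogonal_transformation_linear)
  have nA: "norm (A x) = norm x" and nB: "norm (B x) = norm x" for x
    using AO BO by (simp_all add: orthogonal_transformation_norm)
  obtain y z where yz: "y \<in> E" "z \<in> F" "b 0 = y + z" "norm z \<le> norm y" "y \<noteq> 0"
    using Pb by (auto simp: P_def)
  define c where "c = a \<circ> b \<circ> finv a \<circ> finv b"
  have cG: "c \<in> G" unfolding c_def using aG bG space_groupD(6,7)[OF G] by blast
  have aff: "a \<in> affinities" "b \<in> affinities" using space_groupD(3)[OF G] aG bG by auto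
  have com: "norm (A (B w) - B (A w)) \<le> \<mu> * norm w" for w
  proof -
    \<comment> \<open>AB - BA = (A - I)(B - I) - (B - I)(A - I): the two small factors multiply, and
      with 1/2 for \<open>A\<close> the sum is again bounded by \<mu>. So commutators with
      \<open>a\<close> inherit the rotation bound of \<open>P\<close>.\<close>
    have "A (B w) - B (A w) = (A (B w - w) - (B w - w)) - (B (A w - w) - (A w - w))"
      by (simp add: linear_diff[OF LA] linear_diff[OF LB])
    then have "norm (A (B w) - B (A w)) \<le> norm (A (B w - w) - (B w - w)) + norm (B (A w - w) - (A w - w))"
      using norm_triangle_ineq4 by metis
    also have "\<dots> \<le> norm (B w - w) / 2 + \<mu> * norm (A w - w)"
      using Asmall Bsmall by (intro add_mono)
    also have "\<dots> \<le> (\<mu> * norm w) / 2 + \<mu> * (norm w / 2)"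
      using Asmall[of w] Bsmall[of w] \<mu>(1) by (intro add_mono divide_right_mono mult_left_mono) auto
    finally show ?thesis by simp
  qed
  have csmall: "norm (lin c x - x) \<le> \<mu> * norm x" for x
  proof -
    define w where "w = finv A (finv B x)"
    have x: "x = B (A w)"
      unfolding w_def using AO BO by (simp add: orthogonal_transformation_bij)
    have "lin c = A \<circ> B \<circ> finv A \<circ> finv B"
      unfolding c_def A_def B_def using aff
      by (simp add: lin_comp affinities_comp affinities_finv lin_finv)
    then have "lin c x = A (B w)" by (simp add: w_def)
    then show ?thesis using com[of w] nA nB by (simp add: x)
  qed
  \<comment> \<open>The translation part of the commutator is (A - I)(b 0) up to \<open>r\<close>,
    which collects the terms carrying a factor of size \<mu>.\<close>
  define r where "r = c 0 - (A (b 0) - b 0)"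
  have r: "norm r \<le> 3 * \<mu> * norm (b 0)"
  proof -
    define p where "p = finv a (finv b 0)"
    have "b (a p) = 0" unfolding p_def using aff by (simp add: affinityD)
    moreover have "b (a p) = b 0 + B (a 0 + A p)" by (simp add: A_def B_def lin_def)
    ultimately have "B (A p) + (b 0 + B (a 0)) = 0" by (simp add: linear_add[OF LB] algebra_simps)
    then have "B (A p) = - (b 0 + B (a 0))" unfolding eq_neg_iff_add_eq_0 .
    then have BAp: "B (A p) = - b 0 - B (a 0)" by simp
    have "c 0 = a (b p)" by (simp add: c_def p_def)
    also have "\<dots> = a 0 + A (b 0 + B p)" by (simp add: A_def B_def lin_def)
    finally have r': "r = (a 0 - B (a 0)) + (A (B p) - B (A p))"
      unfolding r_def BAp by (simp add: linear_add[OF LA] algebra_simps)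
    show ?thesis
    \<comment> \<open>If \<open>b\<close> is a translation it lies outside \<open>S\<close> and
      cannot be compared with \<open>a\<close>, but then \<open>r\<close> vanishes. Otherwise
      minimality of \<open>a\<close> gives \<open>norm (a 0) \<le> norm (b 0)\<close>.\<close>
    proof (cases "B = id")
      case True
      then show ?thesis unfolding r' using \<mu>(1) by simp
    next
      case False
      have "\<mu> * norm x \<le> norm x / 2" for x :: 'a
        using mult_right_mono[OF \<mu>(2), of "norm x"] norm_ge_zero[of x] by linarith
      then have "norm (B x - x) \<le> norm x / 2" for x using Bsmall[of x] order_trans by blast
      then have "b \<in> S" using False bG by (simp add: S_def B_def)
      then have ab: "norm (a 0) \<le> norm (b 0)" by (rule amin)
      have "norm p = norm (b 0 + B (a 0))"
        using nA[of p] nB[of "A p"] norm_minus_cancel[of "b 0 + B (a 0)"] unfolding BAp by simp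
      also have "\<dots> \<le> norm (b 0) + norm (a 0)" using norm_triangle_ineq[of "b 0" "B (a 0)"] nB by simp
      finally have p: "norm p \<le> 2 * norm (b 0)" using ab by simp
      have "norm r \<le> norm (a 0 - B (a 0)) + norm (A (B p) - B (A p))"
        unfolding r' by (rule norm_triangle_ineq)
      also have "\<dots> \<le> \<mu> * norm (a 0) + \<mu> * norm p"
        using Bsmall[of "a 0"] com[of p] by (simp add: norm_minus_commute)
      also have "\<dots> \<le> \<mu> * norm (b 0) + \<mu> * (2 * norm (b 0))"
        using ab p \<mu>(1) by (intro add_mono mult_left_mono) auto
      finally show ?thesis by simp
    qed
  qed
  have byz: "norm (b 0) \<le> 2 * norm y"
    using yz norm_triangle_ineq[of y z] by simp
  have r6: "norm r \<le> 6 * \<mu> * norm y"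
  proof -
    have "3 * \<mu> * norm (b 0) \<le> 3 * \<mu> * (2 * norm y)"
      using byz \<mu>(1) by (intro mult_left_mono) auto
    also have "\<dots> = 6 * \<mu> * norm y" by simp
    finally show ?thesis using r by simp
  qed
  obtain r1 r2 where r12: "r1 \<in> E" "r2 \<in> F" "r = r1 + r2" using dec by blast
  have r12n: "norm r1 \<le> norm r" "norm r2 \<le> norm r"
    using orthogonal_norm_le[OF EF[OF r12(1,2)]] r12(3) by auto
  define y' where "y' = A y - y + r1"
  define z' where "z' = A z - z + r2"
  have c0: "c 0 = y' + z'"
    using r_def r12(3) yz(3) by (simp add: y'_def z'_def linear_add[OF LA] algebra_simps)
  have y'E: "y' \<in> E" unfolding y'_def
    using sE EA[OF yz(1)] yz(1) r12(1) by (intro subspace_add subspace_diff)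
  have z'F: "z' \<in> F" unfolding z'_def
    using sF FA[OF yz(2)] yz(2) r12(2) by (intro subspace_add subspace_diff)
  have "norm y' \<ge> m * norm y - norm r"
    using norm_diff_ineq[of "A y - y" r1] mE[OF yz(1)] r12n(1) by (simp add: y'_def)
  moreover have "norm z' \<le> m' * norm y + norm r"
  proof -
    have "norm z' \<le> norm (A z - z) + norm r2" unfolding z'_def by (rule norm_triangle_ineq)
    also have "\<dots> \<le> m' * norm z + norm r" using mF[OF yz(2)] r12n(2) by simp
    also have "m' * norm z \<le> m' * norm y" using yz(4) m'(1) by (rule mult_left_mono)
    finally show ?thesis by simp
  qed
  moreover have "m * norm y - m' * norm y = 16 * (\<mu> * norm y)" by (simp add: \<mu>_def left_diff_distrib)
  moreover have "\<mu> * norm y > 0" using \<mu>(1) yz(5) by simp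
  ultimately have zy': "norm z' < norm y'" using r6 by simp
  \<comment> \<open>The commutator satisfies \<open>P\<close> again, while its translation part is
    at most 1/2 + 3/32 times that of \<open>b\<close>. Minimality of \<open>b\<close> forces
    \<open>b 0\<close> to vanish, against \<open>y \<noteq> 0\<close>.\<close>
  have "P c"
    unfolding P_def using cG csmall c0 y'E z'F zy' by (force intro: less_imp_le)
  then have "norm (b 0) \<le> norm (c 0)" by (rule bmin)
  also have "c 0 = (A (b 0) - b 0) + r" by (simp add: r_def)
  also have "norm \<dots> \<le> norm (b 0) / 2 + 3 * \<mu> * norm (b 0)"
    using norm_triangle_ineq Asmall[of "b 0"] r by (meson add_mono order_trans)
  also have "\<dots> \<le> norm (b 0) / 2 + 3 * (1/32) * norm (b 0)"
    using \<mu>(2) by (intro add_mono mult_right_mono) auto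
  finally have "norm (b 0) = 0" by simp
  moreover have "norm y \<le> norm (b 0)"
    using orthogonal_norm_le[OF EF[OF yz(1,2)]] yz(3) by simp
  ultimately show False using yz(5) by simp
qed

text \<open>Two elements whose rotations receive the same colour have a quotient with rotation at
  most 1/2, which is trivial by \<open>small_rotation_trivial\<close>. Hence the colours separate
  the linear parts.\<close>

lemma space_group_finite_lin:
  fixes G :: "('a::euclidean_space \<Rightarrow> 'a) set"
  assumes G: "space_group G"
  shows "finite (lin ` G)"
proof -
  obtain K and c :: "('a \<Rightarrow> 'a) \<Rightarrow> 'a \<Rightarrow> 'a" where K: "finite K"
    and c1: "\<forall>A. orthogonal_transformation A \<longrightarrow> c A \<in> K"
    and c2: "\<forall>A B x. orthogonal_transformation A \<longrightarrow> orthogonal_transformation B \<longrightarrow> c A = c B \<longrightarrow>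
      norm (A x - B x) \<le> (1/2) * norm x"
    using rotation_colouring[OF half_gt_zero[OF zero_less_one]] by (elim exE conjE) (rule that; assumption)
  have O: "orthogonal_transformation (lin g)" if "g \<in> G" for g
    using space_groupD(2)[OF G that] by (simp add: isometries_iff)
  have "inj_on c (lin ` G)"
  proof (rule inj_onI, clarify)
    fix g h assume g: "g \<in> G" and h: "h \<in> G" and eq: "c (lin g) = c (lin h)"
    have aff: "g \<in> affinities" "h \<in> affinities" using space_groupD(3)[OF G] g h by auto
    have "lin (g \<circ> finv h) = id"
    proof (rule small_rotation_trivial[OF G])
      show "g \<circ> finv h \<in> G" using g h space_groupD(6,7)[OF G] by blast
      fix x
      define y where "y = lin (finv h) x"
      have x: "lin h y = x" using lin_finv[OF aff(2)] bij_lin[OF aff(2)] by (simp add: y_def)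
      then have ny: "norm y = norm x" using isometries_lin_norm[OF space_groupD(2)[OF G h]] by metis
      have "lin (g \<circ> finv h) x = lin g y" by (simp add: y_def lin_comp[OF aff(1)])
      then show "norm (lin (g \<circ> finv h) x - x) \<le> norm x / 2"
        using c2[rule_format, OF O[OF g] O[OF h] eq, of y] by (simp add: x ny)
    qed
    then have *: "lin g (finv (lin h) x) = x" for x
      using lin_comp[OF aff(1), of "finv h"] lin_finv[OF aff(2)] by (metis comp_apply id_apply)
    have "lin g x = lin h x" for x using *[of "lin h x"] bij_lin[OF aff(2)] by simp
    then show "lin g = lin h" by blast
  qed
  moreover have "c ` lin ` G \<subseteq> K" using c1 O by blast
  ultimately show ?thesis using K finite_imageD finite_subset by blast
qed

section \<open>The translation lattice and the finite group of linear parts\<close>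

definition translation_vectors :: "('a::euclidean_space \<Rightarrow> 'a) set \<Rightarrow> 'a set"
  where "translation_vectors G = {a. (\<lambda>x. a + x) \<in> G}"

lemma lin_eq_idD: "lin g = id \<Longrightarrow> g = (\<lambda>x. g 0 + x)"
  unfolding lin_def fun_eq_iff by (metis add.commute diff_add_cancel id_apply)

text \<open>In a direction u orthogonal to all translations there would still be an element of small
  rotation whose value at 0 is within s/2 of s u. Being a translation, it would also have
  \<open>g 0\<close> orthogonal to u, hence at distance at least s from s u.\<close>

lemma space_group_translations_span:
  fixes G :: "('a::euclidean_space \<Rightarrow> 'a) set"
  assumes G: "space_group G"
  shows "span (translation_vectors G) = UNIV"
proof (rule ccontr)
  assume "span (translation_vectors G) \<noteq> UNIV"
  then obtain a where a: "a \<noteq> 0" "\<And>x. x \<in> span (translation_vectors G) \<Longrightarrow> orthogonal a x"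
    using orthogonal_to_subspace_exists_gen[of "translation_vectors G" UNIV] by auto
  define u where "u = (1 / norm a) *\<^sub>R a"
  have u: "norm u = 1" using a by (simp add: u_def)
  obtain g s where g: "g \<in> G" "s > 0" "norm (g 0 - s *\<^sub>R u) \<le> (1/2) * s"
    "\<And>x. norm (lin g x - x) \<le> (1/2) * norm x"
    by (rule space_group_directions[OF G u, of "1/2"]) (simp, rule that)
  have "lin g = id" using small_rotation_trivial[OF G g(1)] g(4) by simp
  then have "g = (\<lambda>x. g 0 + x)" by (rule lin_eq_idD)
  then have "g 0 \<in> translation_vectors G" using g(1) by (simp add: translation_vectors_def)
  then have "orthogonal a (g 0)" using a(2) by (simp add: span_base)
  then have "orthogonal (- (s *\<^sub>R u)) (g 0)" by (simp add: u_def orthogonal_def)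
  then have "norm (- (s *\<^sub>R u)) \<le> norm (- (s *\<^sub>R u) + g 0)" by (rule orthogonal_norm_le)
  then show False using g(2,3) u by simp
qed

text \<open>Lagrange's theorem in the finite group of linear parts. It makes the r-th power of every
  element of \<open>G\<close> a translation, with the same r for all.\<close>

lemma space_group_lin_exponent:
  fixes G :: "('a::euclidean_space \<Rightarrow> 'a) set"
  assumes G: "space_group G"
  obtains r :: nat where "r > 0" "\<And>g. g \<in> G \<Longrightarrow> lin g ^^ r = id"
proof -
  have comp: "lin g \<circ> lin h \<in> lin ` G" if "g \<in> G" "h \<in> G" for g h
    
    unfolding lin_comp[OF space_groupD(3)[OF G that(1)], symmetric]
    using that space_groupD(6)[OF G] by blast
  have b: "bij_group (lin ` G)"
    unfolding bij_group_def
  proof (intro conjI ballI)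
    show "id \<in> lin ` G" using imageI[OF space_groupD(5)[OF G], of lin] by simp
    show "bij A" if "A \<in> lin ` G" for A using that bij_lin space_groupD(3)[OF G] by blast
    show "A \<circ> B \<in> lin ` G" if "A \<in> lin ` G" "B \<in> lin ` G" for A B using that comp by blast
    show "finv A \<in> lin ` G" if "A \<in> lin ` G" for A
    proof -
      obtain g where g: "g \<in> G" "A = lin g" using \<open>A \<in> lin ` G\<close> by blast
      then have "finv A = lin (finv g)" using lin_finv[OF space_groupD(3)[OF G g(1)]] by simp
      then show ?thesis using space_groupD(7)[OF G g(1)] by blast
    qed
  qed
  then have gg: "group (grp (lin ` G))" by (rule group_grp)
  have fin: "finite (lin ` G)" by (rule space_group_finite_lin[OF G])
  show thesis
  proof (rule that[of "card (lin ` G)"])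
    show "card (lin ` G) > 0" using fin b by (auto simp: card_gt_0_iff dest: bij_groupD(2))
    fix g assume g: "g \<in> G"
    have "lin g [^]\<^bsub>grp (lin ` G)\<^esub> k = lin g ^^ k" for k :: nat
    proof (induction k)
      case 0
      then show ?case by (simp only: nat_pow_0 group.is_monoid[OF gg] grp_simps funpow_0 id_def)
    next
      case (Suc k)
      have bg: "bij (lin g)" using b g bij_groupD(1) by blast
      have "bij (lin g ^^ k)" using bg by (rule bij_fn)
      then show ?case using Suc bg mult_grp[of "lin g ^^ k" "lin g" "lin ` G"]
        by (simp only: monoid.nat_pow_Suc[OF group.is_monoid[OF gg]] funpow_Suc_right)
    qed
    then show "lin g ^^ card (lin ` G) = id"
      using group.pow_order_eq_1[OF gg, of "lin g"] g fin by (simp add: order_def)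
  qed
qed

section \<open>Bieberbach's second theorem\<close>

definition add_subgroup :: "'a::real_vector set \<Rightarrow> bool"
  where "add_subgroup K \<longleftrightarrow> 0 \<in> K \<and> (\<forall>x\<in>K. \<forall>y\<in>K. x - y \<in> K)"

lemma add_subgroupD:
  assumes "add_subgroup K"
  shows "0 \<in> K" "x \<in> K \<Longrightarrow> - x \<in> K" "x \<in> K \<Longrightarrow> y \<in> K \<Longrightarrow> x + y \<in> K"
    "x \<in> K \<Longrightarrow> of_int z *\<^sub>R x \<in> K"
proof -
  show 0: "0 \<in> K" using assms by (simp add: add_subgroup_def)
  show neg: "- x \<in> K" if "x \<in> K" for x using assms that by (metis add_subgroup_def diff_0)
  show add: "x + y \<in> K" if "x \<in> K" "y \<in> K" for x y
    using assms that neg[of y] by (metis add_subgroup_def diff_minus_eq_add)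
  have n: "of_nat n *\<^sub>R x \<in> K" if "x \<in> K" for n x
    by (induction n) (auto simp: scaleR_add_left 0 intro: add that)
  show "of_int z *\<^sub>R x \<in> K" if "x \<in> K" for x
    using n[OF that, of "nat z"] neg[OF n[OF that, of "nat (- z)"]]
    by (cases "z \<ge> 0") simp_all
qed

lemma add_subgroup_sum:
  assumes "add_subgroup K" "\<And>b. b \<in> B \<Longrightarrow> f b \<in> K"
  shows "sum f B \<in> K"
  using assms(2) by (induction B rule: infinite_finite_induct) (auto intro: add_subgroupD assms(1))

text \<open>Additivity is available on \<open>K\<close> only, so every multiple that occurs in the
  induction must be kept inside \<open>K\<close>.\<close>

lemma additive_on_scale_int:
  assumes K: "add_subgroup K" and f: "\<And>x y. x \<in> K \<Longrightarrow> y \<in> K \<Longrightarrow> f (x + y) = f x + (f y :: 'b::real_vector)"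
    and x: "x \<in> K"
  shows "f (of_int z *\<^sub>R x) = of_int z *\<^sub>R f x"
proof -
  have f0: "f 0 = 0" using f[of 0 0] add_subgroupD(1)[OF K] by simp
  have neg: "f (- y) = - f y" if "y \<in> K" for y
    using f[of y "- y"] add_subgroupD(2)[OF K that] that f0 by (simp add: add_eq_0_iff)
  have nK: "of_nat n *\<^sub>R x \<in> K" for n using add_subgroupD(4)[OF K x, of "int n"] by simp
  have n: "f (of_nat n *\<^sub>R x) = of_nat n *\<^sub>R f x" for n
    by (induction n) (simp_all add: scaleR_add_left f0 f nK x)
  show ?thesis
    using n[of "nat z"] n[of "nat (- z)"] neg[OF nK, of "nat (- z)"]
    by (cases "z \<ge> 0") simp_all
qed

lemma additive_on_sum:
  assumes K: "add_subgroup K" and f: "\<And>x y. x \<in> K \<Longrightarrow> y \<in> K \<Longrightarrow> f (x + y) = f x + (f y :: 'b::real_vector)"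
    and B: "\<And>b. b \<in> B \<Longrightarrow> g b \<in> K"
  shows "f (sum g B) = (\<Sum>b\<in>B. f (g b))"
proof -
  have f0: "f 0 = 0" using f[of 0 0] add_subgroupD(1)[OF K] by simp
  show ?thesis
    using B by (induction B rule: infinite_finite_induct) (simp_all add: f0 f add_subgroup_sum[OF K])
qed

text \<open>Subtracting the integer parts of the coordinates leaves coefficients between 0 and
  1.\<close>

lemma lattice_cobounded:
  fixes B :: "'a::euclidean_space set"
  assumes B: "finite B" "span B = UNIV"
  obtains R where "\<And>x. \<exists>z::'a \<Rightarrow> int. norm (x + (\<Sum>b\<in>B. of_int (z b) *\<^sub>R b)) \<le> R"
proof
  fix x
  have "x \<in> span B" using B by simp
  then obtain c where c: "x = (\<Sum>b\<in>B. c b *\<^sub>R b)" using B(1) by (auto simp: span_finite)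
  have "x + (\<Sum>b\<in>B. of_int (- \<lfloor>c b\<rfloor>) *\<^sub>R b) = (\<Sum>b\<in>B. (c b - of_int \<lfloor>c b\<rfloor>) *\<^sub>R b)"
    unfolding c by (simp add: sum.distrib[symmetric] scaleR_diff_left)
  also have "norm \<dots> \<le> (\<Sum>b\<in>B. norm ((c b - of_int \<lfloor>c b\<rfloor>) *\<^sub>R b))" by (rule norm_sum)
  also have "\<dots> \<le> (\<Sum>b\<in>B. 1 * norm b)"
    unfolding norm_scaleR by (intro sum_mono mult_right_mono norm_ge_zero) linarith
  finally show "\<exists>z::'a \<Rightarrow> int. norm (x + (\<Sum>b\<in>B. of_int (z b) *\<^sub>R b)) \<le> (\<Sum>b\<in>B. 1 * norm b)"
    by (intro exI[of _ "\<lambda>b. - \<lfloor>c b\<rfloor>"]) simp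
qed

text \<open>\<open>B\<close> is a basis of the vector space chosen from \<open>K\<close>. It need
  not generate \<open>K\<close> as a group, but its integer combinations already move every point
  into a fixed ball.\<close>

lemma lattice_basis:
  fixes K :: "'a::euclidean_space set"
  assumes K: "add_subgroup K" "span K = UNIV"
  obtains B R where "B \<subseteq> K" "independent B"
    "\<And>x. \<exists>z::'a \<Rightarrow> int. norm (x + (\<Sum>b\<in>B. of_int (z b) *\<^sub>R b)) \<le> R"
proof -
  obtain B where B: "B \<subseteq> K" "independent B" "K \<subseteq> span B"
    using maximal_independent_subset[of K] by metis
  have "span B = UNIV" using span_mono[OF B(3)] K(2) by (simp add: span_span top.extremum_unique)
  then obtain R where "\<And>x. \<exists>z::'a \<Rightarrow> int. norm (x + (\<Sum>b\<in>B. of_int (z b) *\<^sub>R b)) \<le> R"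
    using lattice_cobounded[OF independent_imp_finite[OF B(2)]] by metis
  then show thesis using that B by blast
qed

text \<open>Extend \<open>t\<close> linearly from a basis \<open>B\<close> in \<open>K\<close>; the
  defect \<open>D\<close> vanishes on integer combinations of \<open>B\<close>. Adding such
  combinations brings all multiples n k into one ball, which contains finitely many points of
  \<open>K\<close>. Two of them with different n coincide, so n D k = n' D k and D k = 0.\<close>

lemma lattice_hom_extends_linear:
  fixes K :: "'a::euclidean_space set" and t :: "'a \<Rightarrow> 'a"
  assumes K: "add_subgroup K" "span K = UNIV" and fin: "\<And>R. finite {k \<in> K. norm k \<le> R}"
    and t: "\<And>x y. x \<in> K \<Longrightarrow> y \<in> K \<Longrightarrow> t (x + y) = t x + t y"
  obtains A where "linear A" "\<And>k. k \<in> K \<Longrightarrow> A k = t k"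
proof -
  obtain B R where B: "B \<subseteq> K" "independent B"
    and R: "\<And>x. \<exists>z::'a \<Rightarrow> int. norm (x + (\<Sum>b\<in>B. of_int (z b) *\<^sub>R b)) \<le> R"
    using lattice_basis[OF K] by metis
  obtain A where A: "linear A" "\<And>x. x \<in> B \<Longrightarrow> A x = t x"
    using linear_independent_extend[OF B(2)] by metis
  define D where "D x = A x - t x" for x
  have D: "D (x + y) = D x + D y" if "x \<in> K" "y \<in> K" for x y
    using that by (simp add: D_def t linear_add[OF A(1)])
  have "D k = 0" if k: "k \<in> K" for k
  proof -
    have "\<forall>n::nat. \<exists>z::'a \<Rightarrow> int. norm (real n *\<^sub>R k + (\<Sum>b\<in>B. of_int (z b) *\<^sub>R b)) \<le> R"
      using R by blast
    then obtain z :: "nat \<Rightarrow> 'a \<Rightarrow> int" where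
      z: "\<And>n. norm (real n *\<^sub>R k + (\<Sum>b\<in>B. of_int (z n b) *\<^sub>R b)) \<le> R" by metis
    define p where "p n = real n *\<^sub>R k + (\<Sum>b\<in>B. of_int (z n b) *\<^sub>R b)" for n
    have nk: "real n *\<^sub>R k \<in> K" for n using add_subgroupD(4)[OF K(1) k, of "int n"] by simp
    have zK: "of_int (z n b) *\<^sub>R b \<in> K" if "b \<in> B" for n b
      using add_subgroupD(4)[OF K(1)] B(1) that by blast
    have sK: "(\<Sum>b\<in>B. of_int (z n b) *\<^sub>R b) \<in> K" for n
      using add_subgroup_sum[OF K(1), of B "\<lambda>b. of_int (z n b) *\<^sub>R b"] zK by blast
    have "range p \<subseteq> {k \<in> K. norm k \<le> R}"
      using z add_subgroupD(3)[OF K(1) nk sK] by (auto simp: p_def)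
    then have "finite (range p)" using fin finite_subset by blast
    then have "\<not> inj p" using finite_imageD[of p UNIV] by auto
    then obtain n n' where n: "p n = p n'" "n \<noteq> n'" by (auto simp: inj_def)
    have "D (p n) = real n *\<^sub>R D k" for n
    proof -
      have "D (\<Sum>b\<in>B. of_int (z n b) *\<^sub>R b) = (\<Sum>b\<in>B. D (of_int (z n b) *\<^sub>R b))"
        by (rule additive_on_sum[OF K(1) D zK])
      also have "\<dots> = 0"
      proof (rule sum.neutral, rule ballI)
        fix b assume b: "b \<in> B"
        have "D (of_int (z n b) *\<^sub>R b) = of_int (z n b) *\<^sub>R D b"
          using b B(1) by (intro additive_on_scale_int[OF K(1) D]) auto
        then show "D (of_int (z n b) *\<^sub>R b) = 0" using A(2)[OF b] by (simp add: D_def)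
      qed
      finally have "D (p n) = D (real n *\<^sub>R k)" unfolding p_def D[OF nk sK] by simp
      also have "\<dots> = real n *\<^sub>R D k"
        using additive_on_scale_int[OF K(1) D k, of "int n"] by simp
      finally show ?thesis .
    qed
    then have "real n *\<^sub>R D k = real n' *\<^sub>R D k" using n(1) by metis
    then show ?thesis using n(2) by simp
  qed
  then show thesis using that[OF A(1)] by (simp add: D_def)
qed

abbreviation (input) shift :: "'a::real_vector \<Rightarrow> 'a \<Rightarrow> 'a"
  where "shift a \<equiv> (\<lambda>x. a + x)"

lemma shift_comp: "shift a \<circ> shift b = shift (a + b)"
  by (simp add: fun_eq_iff add.assoc)

lemma shift_inject: "shift a = shift b \<longleftrightarrow> a = b"
  by (metis add.right_neutral)

lemma finv_shift: "finv (shift a) = shift (- a)"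
  by (rule finv_eqI) auto

lemma shift_0: "shift 0 = id"
  by auto

lemma shift_funpow: "shift a ^^ n = shift (real n *\<^sub>R a)"
  by (induction n) (auto simp: fun_eq_iff algebra_simps)

lemma comp_shift: "\<phi> \<in> affinities \<Longrightarrow> \<phi> \<circ> shift a = shift (lin \<phi> a) \<circ> \<phi>"
  using affinityD(3)[of \<phi> _ a] by (simp add: fun_eq_iff add.commute)

lemma translation_vectors_add_subgroup:
  assumes "space_group G"
  shows "add_subgroup (translation_vectors G)"
  unfolding add_subgroup_def translation_vectors_def
proof safe
  show "shift 0 \<in> G" using space_groupD(5)[OF assms] unfolding shift_0 .
  fix x y :: 'a assume x: "shift x \<in> G" and y: "shift y \<in> G"
  have "shift x \<circ> finv (shift y) \<in> G" by (intro space_groupD(6,7)[OF assms] x y)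
  then show "shift (x - y) \<in> G" by (simp only: finv_shift shift_comp add_uminus_conv_diff)
qed

lemma translation_vectors_lin_invariant:
  assumes "space_group G" "g \<in> G" "a \<in> translation_vectors G"
  shows "lin g a \<in> translation_vectors G"
proof -
  have "g \<circ> shift a \<circ> finv g \<in> G"
    using assms space_groupD[OF assms(1)] by (simp add: translation_vectors_def)
  moreover have "g \<circ> shift a \<circ> finv g = shift (lin g a)"
    unfolding comp_shift[OF space_groupD(3)[OF assms(1,2)]]
    using space_groupD(4)[OF assms(1,2)] by (simp add: comp_assoc finv_comp)
  ultimately show ?thesis by (simp add: translation_vectors_def)
qed

lemma lin_funpow: "\<phi> \<in> affinities \<Longrightarrow> lin (\<phi> ^^ n) = lin \<phi> ^^ n"
  by (induction n) (simp_all add: lin_comp)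

text \<open>Bieberbach's second theorem. Up to a linear change of coordinates, \<open>f\<close> is the identity on
  a lattice of translations, so it differs from the identity by a cocycle \<open>c\<close> with finitely many
  values; their barycentre trivialises the cocycle.\<close>

theorem space_group_automorphism_affine:
  fixes M :: "('a::euclidean_space \<Rightarrow> 'a) set"
  assumes M: "space_group M" and f: "bij_betw f M M"
    and hom: "\<And>g h. g \<in> M \<Longrightarrow> h \<in> M \<Longrightarrow> f (g \<circ> h) = f g \<circ> f h"
  obtains \<alpha> where "\<alpha> \<in> affinities" "\<And>g. g \<in> M \<Longrightarrow> f g \<circ> \<alpha> = \<alpha> \<circ> g"
proof -
  have fM: "f g \<in> M" if "g \<in> M" for g using f that by (auto simp: bij_betw_def)
  have aff: "g \<in> affinities" if "g \<in> M" for g using space_groupD(3)[OF M that] .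
  have bijM: "bij g" if "g \<in> M" for g using space_groupD(4)[OF M that] .
  have f_id: "f id = id"
  proof -
    have "f id \<circ> f id = f id" using hom[of id id] space_groupD(5)[OF M] by simp
    then have "f id (f id x) = f id x" for x by (metis comp_apply)
    then show ?thesis using bijM[OF fM[OF space_groupD(5)[OF M]]] by (metis bij_pointE eq_id_iff)
  qed
  have pow: "g ^^ n \<in> M \<and> f (g ^^ n) = f g ^^ n" if "g \<in> M" for g n
    using that by (induction n) (simp_all add: f_id space_groupD[OF M] hom)
  obtain r :: nat where r: "r > 0" "\<And>g. g \<in> M \<Longrightarrow> lin g ^^ r = id"
    using space_group_lin_exponent[OF M] by metis
  define T where "T = translation_vectors M"
  have spanT: "span T = UNIV" unfolding T_def by (rule space_group_translations_span[OF M])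
  have lin_pow: "lin (g ^^ r) = id" if "g \<in> M" for g using lin_funpow[OF aff[OF that]] r(2)[OF that] by simp
  \<comment> \<open>An isomorphism is not yet known to map translations to translations;
    \<open>K\<close> collects the vectors for which it does.\<close>
  define K where "K = {a \<in> T. lin (f (shift a)) = id}"
  define t where "t a = f (shift a) 0" for a
  have KM: "shift a \<in> M" if "a \<in> K" for a using that by (simp add: K_def T_def translation_vectors_def)
  have ft: "f (shift a) = shift (t a)" if "a \<in> K" for a
    using that lin_eq_idD[of "f (shift a)"] by (simp add: K_def t_def)
  have KI: "a \<in> K \<and> t a = b" if "shift a \<in> M" "f (shift a) = shift b" for a b
    using that by (simp add: K_def T_def translation_vectors_def t_def id_def)
  have Kadd: "x + y \<in> K \<and> t (x + y) = t x + t y" if "x \<in> K" "y \<in> K" for x y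
  proof (rule KI)
    show "shift (x + y) \<in> M"
      using space_groupD(6)[OF M KM[OF that(1)] KM[OF that(2)]] unfolding shift_comp .
    show "f (shift (x + y)) = shift (t x + t y)"
      using hom[OF KM[OF that(1)] KM[OF that(2)]] unfolding ft[OF that(1)] ft[OF that(2)] shift_comp .
  qed
  have Kneg: "- x \<in> K" if "x \<in> K" for x
  proof -
    have m: "shift (- x) \<in> M"
      using space_groupD(7)[OF M KM[OF that]] unfolding finv_shift .
    have "f (shift (- x)) \<circ> f (shift x) = id"
      using hom[OF m KM[OF that]] f_id unfolding shift_comp by (simp add: shift_0)
    then have "f (shift (- x)) (t x + y) = y" for y unfolding ft[OF that] by (metis comp_apply id_apply)
    from this[of "- t x + y" for y] have "f (shift (- x)) = shift (- t x)" by (simp add: fun_eq_iff)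
    then show ?thesis using KI[OF m] by blast
  qed
  have K: "add_subgroup K"
    unfolding add_subgroup_def
  proof (intro conjI ballI)
    show "0 \<in> K" using KI[of 0 0] space_groupD(5)[OF M] f_id unfolding shift_0 by blast
    show "x - y \<in> K" if "x \<in> K" "y \<in> K" for x y using Kadd[OF that(1) Kneg[OF that(2)]] by simp
  qed
  \<comment> \<open>r-th powers in \<open>M\<close> are translations. Applied to f (shift b) this
    puts r b into \<open>K\<close>, so \<open>K\<close> spans; applied to the preimage of shift b it
    puts r b into t(K), so the linear extension \<open>A\<close> of \<open>t\<close> is
    onto.\<close>
  have rT: "real r *\<^sub>R b \<in> K" "\<exists>a\<in>K. t a = real r *\<^sub>R b" if "b \<in> T" for b
  proof -
    have b: "shift b \<in> M" using that by (simp add: T_def translation_vectors_def)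
    have "f (shift b ^^ r) = shift (f (shift b ^^ r) 0)"
      using pow[OF b, of r] lin_pow[OF fM[OF b]] lin_eq_idD by metis
    then show "real r *\<^sub>R b \<in> K" using KI pow[OF b, of r] unfolding shift_funpow by blast
    obtain g where g: "g \<in> M" "f g = shift b" using f b unfolding bij_betw_def by (metis imageE)
    have gr: "g ^^ r = shift ((g ^^ r) 0)" using lin_pow[OF g(1)] by (rule lin_eq_idD)
    have "f (g ^^ r) = shift (real r *\<^sub>R b)" using pow[OF g(1), of r] g(2) by (simp add: shift_funpow)
    then show "\<exists>a\<in>K. t a = real r *\<^sub>R b" using KI pow[OF g(1), of r] gr by metis
  qed
  have span_rT: "span S = UNIV" if S: "\<And>b. b \<in> T \<Longrightarrow> real r *\<^sub>R b \<in> S" for S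
  proof -
    have "b \<in> span S" if "b \<in> T" for b
      using span_scale[OF span_base[OF S[OF that]], of "1 / real r"] r(1) by simp
    then have "span T \<subseteq> span S" by (intro span_minimal) auto
    then show ?thesis using spanT by auto
  qed
  have spanK: "span K = UNIV" using rT by (intro span_rT)
  have finK: "finite {k \<in> K. norm k \<le> R}" for R
  proof (rule finite_subset)
    show "{k \<in> K. norm k \<le> R} \<subseteq> (\<lambda>g. g 0) ` {g \<in> M. norm (g 0) \<le> R}"
      using KM by (force simp: image_iff)
    show "finite ((\<lambda>g. g 0) ` {g \<in> M. norm (g 0) \<le> R})"
      by (intro finite_imageI space_group_finite_ball[OF M])
  qed
  obtain A where A: "linear A" "\<And>k. k \<in> K \<Longrightarrow> A k = t k"
    using lattice_hom_extends_linear[OF K spanK finK, of t] Kadd by metis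
  have "range A = UNIV"
  proof -
    have "real r *\<^sub>R b \<in> range A" if "b \<in> T" for b using rT(2)[OF that] A(2) by (metis rangeI)
    then have "span (range A) = UNIV" by (rule span_rT)
    moreover have "span (range A) = range A"
      using linear_subspace_image[OF A(1) subspace_UNIV] by (simp add: span_eq_iff)
    ultimately show ?thesis by simp
  qed
  then have bijA: "bij A"
    using linear_surjective_imp_injective[OF A(1)] by (simp add: bij_def)
  \<comment> \<open>Conjugating a translation in \<open>K\<close> by \<open>g\<close> and applying
    \<open>f\<close> gives A (lin g k) = lin (f g) (A k); as \<open>K\<close> spans, this extends to
    all vectors.\<close>
  have linA: "lin (f g) (A x) = A (lin g x)" if g: "g \<in> M" for g x
  proof -
    have "(lin (f g) \<circ> A) x = (A \<circ> lin g) x"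
    proof (rule linear_eq_on_span[where B=K and f="lin (f g) \<circ> A" and g="A \<circ> lin g"])
      show "linear (lin (f g) \<circ> A)" "linear (A \<circ> lin g)"
        using affinityD(1)[OF aff] g fM A(1) by (auto intro: linear_compose)
      show "x \<in> span K" by (simp add: spanK)
      fix k assume k: "k \<in> K"
      have m: "shift (lin g k) \<in> M"
        using translation_vectors_lin_invariant[OF M g] KM[OF k] by (simp add: translation_vectors_def)
      have "f (shift (lin g k)) \<circ> f g = f (g \<circ> shift k)"
        unfolding comp_shift[OF aff[OF g]] by (rule hom[OF m g, symmetric])
      also have "\<dots> = f g \<circ> shift (t k)" using hom[OF g KM[OF k]] unfolding ft[OF k] .
      also have "\<dots> = shift (lin (f g) (t k)) \<circ> f g" by (rule comp_shift[OF aff[OF fM[OF g]]])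
      finally have "f (shift (lin g k)) (f g (finv (f g) y)) = shift (lin (f g) (t k)) (f g (finv (f g) y))" for y
        by (metis comp_apply)
      then have "f (shift (lin g k)) = shift (lin (f g) (t k))"
        using bijM[OF fM[OF g]] by (simp add: fun_eq_iff)
      then have "lin g k \<in> K \<and> t (lin g k) = lin (f g) (t k)" using KI[OF m] by blast
      then show "(lin (f g) \<circ> A) k = (A \<circ> lin g) k" using A(2) k by simp
    qed
    then show ?thesis by simp
  qed
  \<comment> \<open>In the coordinates given by \<open>A\<close>, the map \<open>f g\<close> becomes
    \<open>g\<close> followed by the translation by \<open>c g\<close>. This is a 1-cocycle for the
    action through linear parts, and it is zero on the translations in \<open>K\<close>.\<close>
  define c where "c g = finv A (f g 0) - g 0" for g
  have Ac: "f g (A x) = A (c g + g x)" if g: "g \<in> M" for g x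
  proof -
    have "A (c g + g x) = A (finv A (f g 0) + lin g x)" by (simp add: c_def lin_def algebra_simps)
    also have "\<dots> = f g 0 + lin (f g) (A x)" using bijA by (simp add: linear_add[OF A(1)] linA[OF g])
    also have "\<dots> = f g (A x)" by (simp add: lin_def)
    finally show ?thesis by simp
  qed
  have Ainj: "x = y" if "A x = A y" for x y using bijA that by (auto simp: bij_def dest: injD)
  have cocycle: "c (g \<circ> h) = c g + lin g (c h)" if g: "g \<in> M" and h: "h \<in> M" for g h
  proof -
    have "A (c (g \<circ> h) + (g \<circ> h) 0) = f (g \<circ> h) (A 0)"
      using Ac[OF space_groupD(6)[OF M g h], of 0] by simp
    also have "\<dots> = f g (A (c h + h 0))" by (simp add: hom[OF g h] Ac[OF h])
    also have "\<dots> = A (c g + (g (h 0) + lin g (c h)))"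
      using affinityD(3)[OF aff[OF g], of "h 0" "c h"] by (simp add: Ac[OF g] add.commute)
    finally have "c (g \<circ> h) + (g \<circ> h) 0 = c g + (g (h 0) + lin g (c h))" by (rule Ainj)
    then show ?thesis by simp
  qed
  have cK: "c (shift k) = 0" if k: "k \<in> K" for k
  proof -
    have "A (c (shift k) + (k + 0)) = A k"
      using Ac[OF KM[OF k], of 0] by (simp add: ft[OF k] A linear_0[OF A(1)] k)
    then have "c (shift k) + (k + 0) = k" by (rule Ainj)
    then show ?thesis by simp
  qed
  define F where "F = c ` M"
  have finF: "finite F"
  proof -
    obtain B R where B: "B \<subseteq> K" and R: "\<And>x. \<exists>z::'a \<Rightarrow> int. norm (x + (\<Sum>b\<in>B. of_int (z b) *\<^sub>R b)) \<le> R"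
      using lattice_basis[OF K spanK] by metis
    have "c g \<in> c ` {g \<in> M. norm (g 0) \<le> R}" if g: "g \<in> M" for g
    proof -
      \<comment> \<open>\<open>c\<close> does not change under right multiplication by translations
        in \<open>K\<close>, and (g o shift k) 0 = lin g (p + k). Hence it is \<open>p\<close>, not
        \<open>g 0\<close>, that has to be moved into the ball of radius \<open>R\<close>.\<close>
      define p where "p = finv (lin g) (g 0)"
      have p: "lin g p = g 0" using bij_lin[OF aff[OF g]] by (simp add: p_def)
      obtain z :: "'a \<Rightarrow> int" where z: "norm (p + (\<Sum>b\<in>B. of_int (z b) *\<^sub>R b)) \<le> R" using R by blast
      define k where "k = (\<Sum>b\<in>B. of_int (z b) *\<^sub>R b)"
      have k: "k \<in> K" unfolding k_def
        using B add_subgroupD(4)[OF K] by (intro add_subgroup_sum[OF K]) blast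
      have "(g \<circ> shift k) 0 = lin g (p + k)"
        using affinityD(3)[OF aff[OF g], of 0 k] p by (simp add: linear_add[OF affinityD(1)[OF aff[OF g]]])
      then have "norm ((g \<circ> shift k) 0) \<le> R"
        using z isometries_lin_norm[OF space_groupD(2)[OF M g]] by (simp add: k_def)
      moreover have "g \<circ> shift k \<in> M" by (rule space_groupD(6)[OF M g KM[OF k]])
      moreover have "c (g \<circ> shift k) = c g"
        using cocycle[OF g KM[OF k]] by (simp add: cK[OF k] linear_0[OF affinityD(1)[OF aff[OF g]]])
      ultimately show ?thesis by (metis (mono_tags, lifting) imageI mem_Collect_eq)
    qed
    then have "F \<subseteq> c ` {g \<in> M. norm (g 0) \<le> R}" by (auto simp: F_def)
    then show ?thesis using space_group_finite_ball[OF M] by (meson finite_imageI finite_subset)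
  qed
  have Fne: "F \<noteq> {}" using space_groupD(5)[OF M] by (auto simp: F_def)
  define a where "a = (1 / real (card F)) *\<^sub>R sum (\<lambda>y. y) F"
  have cardF: "real (card F) > 0" using finF Fne by (simp add: card_gt_0_iff)
  \<comment> \<open>By the cocycle identity, y \<mapsto> c g + lin g y permutes the finite set
    \<open>F\<close>; an affine map that permutes \<open>F\<close> fixes its mean.\<close>
  have fix_a: "c g + lin g a = a" if g: "g \<in> M" for g
  proof -
    let ?s = "\<lambda>y. c g + lin g y"
    have L: "linear (lin g)" by (rule affinityD(1)[OF aff[OF g]])
    have inj: "inj_on ?s F" using bij_lin[OF aff[OF g]] by (auto simp: inj_on_def bij_def dest: injD)
    have "?s ` F \<subseteq> F"
    proof
      fix y assume "y \<in> ?s ` F"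
      then obtain h where h: "h \<in> M" "y = c g + lin g (c h)" by (auto simp: F_def)
      then show "y \<in> F" using cocycle[OF g h(1)] space_groupD(6)[OF M g h(1)] unfolding F_def by force
    qed
    then have "?s ` F = F" by (rule endo_inj_surj[OF finF _ inj])
    then have "sum (\<lambda>y. y) F = (\<Sum>y\<in>F. ?s y)" using sum.reindex[OF inj, of "\<lambda>y. y"] by (simp add: o_def)
    also have "\<dots> = real (card F) *\<^sub>R c g + lin g (sum (\<lambda>y. y) F)"
      by (simp add: sum.distrib linear_sum[OF L] scaleR_conv_of_real sum_constant_scaleR)
    finally have "a = (1 / real (card F)) *\<^sub>R (real (card F) *\<^sub>R c g + lin g (sum (\<lambda>y. y) F))"
      by (simp add: a_def)
    then show ?thesis
      using cardF by (simp add: scaleR_add_right linear_scale[OF L, symmetric] a_def[symmetric])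
  qed
  define \<alpha> where "\<alpha> = A \<circ> shift a"
  have Aaff: "A \<in> affinities"
    using A(1) bijA by (simp add: affinities_iff lin_def linear_0)
  show thesis
  proof (rule that)
    show "\<alpha> \<in> affinities" unfolding \<alpha>_def by (intro affinities_comp Aaff shift_affinity)
    fix g assume g: "g \<in> M"
    show "f g \<circ> \<alpha> = \<alpha> \<circ> g"
    proof
      fix x
      have "(f g \<circ> \<alpha>) x = A (c g + g (x + a))" by (simp add: \<alpha>_def Ac[OF g] add.commute)
      also have "c g + g (x + a) = a + g x"
        using fix_a[OF g] affinityD(3)[OF aff[OF g], of x a] by (simp add: algebra_simps)
      finally show "(f g \<circ> \<alpha>) x = (\<alpha> \<circ> g) x" by (simp add: \<alpha>_def)
    qed
  qed
qed

section \<open>The span of the center as the common fixed space of the linear parts\<close>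

text \<open>A translation commutes with \<open>g\<close> exactly when \<open>lin g\<close> fixes its
  vector, and fixing a set means fixing its span.\<close>

lemma center_fixed:
  assumes M: "space_group M" and v: "v \<in> Span (center (grp M))" and g: "g \<in> M"
  shows "lin g v = v"
proof -
  have L: "linear (lin g)" by (rule affinityD(1)[OF space_groupD(3)[OF M g]])
  have *: "lin g a = a" if "shift a \<in> center (grp M)" for a
  proof -
    have "shift a \<circ> g = g \<circ> shift a"
      using that g space_groupD(4)[OF M] by (simp add: center_def mult_Maps)
    also have "\<dots> = shift (lin g a) \<circ> g" by (rule comp_shift[OF space_groupD(3)[OF M g]])
    finally have "shift a (g 0) = shift (lin g a) (g 0)" by (metis comp_apply)
    then show ?thesis by simp
  qed
  have "lin g v = (\<lambda>x. x) v"
    by (rule linear_eq_on_span[OF L linear_ident _ v[unfolded Span_def]]) (simp add: *)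
  then show ?thesis by simp
qed

text \<open>Summing over the finite group of linear parts, \<open>P\<close> turns translation
  vectors of \<open>M\<close> into invariant ones, hence into central translations. On a fixed
  vector \<open>P\<close> is multiplication by the order of the group, and translation vectors span
  the whole space.\<close>

lemma fixed_in_center_span:
  fixes M :: "('a::euclidean_space \<Rightarrow> 'a) set"
  assumes M: "space_group M" and v: "\<And>g. g \<in> M \<Longrightarrow> lin g v = v"
  shows "v \<in> Span (center (grp M))"
proof -
  define L where "L = lin ` M"
  have fin: "finite L" unfolding L_def by (rule space_group_finite_lin[OF M])
  have idL: "id \<in> L" using imageI[OF space_groupD(5)[OF M], of lin] by (simp add: L_def)
  define P where "P x = (\<Sum>A\<in>L. A x)" for x
  have linL: "linear A" if "A \<in> L" for A
    using that affinityD(1) space_groupD(3)[OF M] by (auto simp: L_def)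
  have linP: "linear P" unfolding P_def by (intro linear_compose_sum) (use linL in auto)
  have PT: "shift (P a) \<in> center (grp M)" if a: "a \<in> translation_vectors M" for a
  proof -
    have "P a \<in> translation_vectors M"
      unfolding P_def using a
      by (intro add_subgroup_sum[OF translation_vectors_add_subgroup[OF M]])
        (auto simp: L_def intro: translation_vectors_lin_invariant[OF M])
    moreover have "lin g (P a) = P a" if g: "g \<in> M" for g
    proof -
      have gaff: "g \<in> affinities" by (rule space_groupD(3)[OF M g])
      have inj: "inj_on ((\<circ>) (lin g)) L"
        using bij_lin[OF gaff] by (auto intro!: inj_onI dest: fun.inj_map_strong simp: bij_def fun_eq_iff inj_eq)
      have sub: "(\<circ>) (lin g) ` L \<subseteq> L"
      proof clarify
        fix A assume "A \<in> L"
        then obtain h where h: "h \<in> M" "A = lin h" by (auto simp: L_def)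
        then have "lin g \<circ> A = lin (g \<circ> h)" using lin_comp[OF gaff] by simp
        then show "lin g \<circ> A \<in> L" using space_groupD(6)[OF M g h(1)] by (simp add: L_def)
      qed
      have "P a = (\<Sum>A\<in>(\<circ>) (lin g) ` L. A a)"
        unfolding endo_inj_surj[OF fin sub inj] P_def ..
      also have "\<dots> = lin g (P a)"
        unfolding sum.reindex[OF inj] P_def by (simp add: linear_sum[OF affinityD(1)[OF gaff]])
      finally show ?thesis by simp
    qed
    ultimately show ?thesis
      using comp_shift[OF space_groupD(3)[OF M]] space_groupD(4)[OF M]
      by (simp add: center_def translation_vectors_def mult_Maps)
  qed
  have "P v = real (card L) *\<^sub>R v"
    unfolding P_def using v by (subst sum.cong[of L L _ "\<lambda>_. v"]) (auto simp: L_def sum_constant_scaleR)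
  moreover have "card L > 0" using fin idL by (auto simp: card_gt_0_iff)
  ultimately have "v = (1 / real (card L)) *\<^sub>R P v" by simp
  moreover have "P v \<in> span (P ` translation_vectors M)"
    unfolding linear_span_image[OF linP] space_group_translations_span[OF M] by simp
  moreover have "span (P ` translation_vectors M) \<subseteq> Span (center (grp M))"
    unfolding Span_def using PT by (intro span_mono) auto
  ultimately show ?thesis
    unfolding Span_def by (metis span_scale subsetD)
qed

section \<open>The affine normalizer of a space group\<close>

lemma (in group) conj_hom: "(\<lambda>g. restrict (conj_by G g) (carrier G)) \<in> hom G (AutoGroup G)"
proof -
  have closed: "conj_by G g x \<in> carrier G" if "g \<in> carrier G" "x \<in> carrier G" for g x
    using that by (simp add: conj_by_def)
  have comp: "conj_by G g (conj_by G h x) = conj_by G (g \<otimes> h) x"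
    if "g \<in> carrier G" "h \<in> carrier G" "x \<in> carrier G" for g h x
    using that by (simp add: conj_by_def inv_mult_group m_assoc)
  have one: "conj_by G \<one> x = x" if "x \<in> carrier G" for x
    using that by (simp add: conj_by_def)
  have bij: "bij_betw (conj_by G g) (carrier G) (carrier G)" if g: "g \<in> carrier G" for g
  proof (rule bij_betw_byWitness[where f' = "conj_by G (inv g)"])
    show "\<forall>x\<in>carrier G. conj_by G (inv g) (conj_by G g x) = x"
      "\<forall>x\<in>carrier G. conj_by G g (conj_by G (inv g) x) = x"
      using g by (simp_all add: comp one)
  qed (use closed g in auto)
  have mult: "conj_by G g (x \<otimes> y) = conj_by G g x \<otimes> conj_by G g y"
    if "g \<in> carrier G" "x \<in> carrier G" "y \<in> carrier G" for g x y
  proof -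
    have "inv g \<otimes> (g \<otimes> (y \<otimes> inv g)) = y \<otimes> inv g"
      using that by (simp add: m_assoc[symmetric])
    then show ?thesis using that by (simp add: conj_by_def m_assoc)
  qed
  have Bij: "restrict (conj_by G g) (carrier G) \<in> Bij (carrier G)" if "g \<in> carrier G" for g
    using bij[OF that] by (simp add: Bij_def cong: bij_betw_cong)
  show ?thesis
  proof (rule homI)
    show "restrict (conj_by G g) (carrier G) \<in> carrier (AutoGroup G)" if "g \<in> carrier G" for g
      using that Bij[OF that] closed mult by (auto simp: AutoGroup_def auto_def hom_def)
    show "restrict (conj_by G (g \<otimes> h)) (carrier G) =
        restrict (conj_by G g) (carrier G) \<otimes>\<^bsub>AutoGroup G\<^esub> restrict (conj_by G h) (carrier G)"
      if "g \<in> carrier G" "h \<in> carrier G" for g h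
      using that Bij[OF that(1)] Bij[OF that(2)] closed comp
      by (auto simp: AutoGroup_def BijGroup_def compose_def fun_eq_iff)
  qed
qed

lemma (in group) conj_by_conj_by:
  "a \<in> carrier G \<Longrightarrow> b \<in> carrier G \<Longrightarrow> x \<in> carrier G \<Longrightarrow> conj_by G a (conj_by G b x) = conj_by G (a \<otimes> b) x"
  by (simp add: conj_by_def inv_mult_group m_assoc)

lemma (in group) Inn_subgroup: "subgroup (Inn G) (AutoGroup G)"
proof -
  interpret group_hom G "AutoGroup G" "\<lambda>g. restrict (conj_by G g) (carrier G)"
    using conj_hom AutoGroup is_group by (simp add: group_hom_def group_hom_axioms_def)
  have "(\<lambda>g. restrict (conj_by G g) (carrier G)) ` carrier G = Inn G" by (auto simp: Inn_def)
  then show ?thesis using img_is_subgroup by simp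
qed

lemma mult_AutoGroup:
  "f \<in> Bij (carrier G) \<Longrightarrow> g \<in> Bij (carrier G) \<Longrightarrow> f \<otimes>\<^bsub>AutoGroup G\<^esub> g = compose (carrier G) f g"
  by (simp add: AutoGroup_def BijGroup_def)

locale orbifold =
  fixes M :: "('a::euclidean_space \<Rightarrow> 'a) set"
  assumes M: "space_group M"
begin

abbreviation NM :: "('a \<Rightarrow> 'a) set" where "NM \<equiv> affine_normalizer M"

abbreviation st :: "('a \<Rightarrow> 'a) \<Rightarrow> 'a set \<Rightarrow> 'a set" where "st \<equiv> star M M"

lemma bij_group_M: "bij_group M" and subgroup_M: "subgroup M Maps"
  using space_groupD(1)[OF M] by (simp_all add: subgroup_Maps_iff)

lemma bij_M: "m \<in> M \<Longrightarrow> bij m"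
  by (rule space_groupD(4)[OF M])

lemma normalizer_conj_image: "\<phi> \<in> affinities \<Longrightarrow> conj_by Maps \<phi> ` M = (\<lambda>m. \<phi> \<circ> m \<circ> finv \<phi>) ` M"
  by (intro image_cong refl conj_by_Maps bij_M affinityD(2))

text \<open>Both inclusions are listed because for an infinite group one does not give the other; in
  this form membership is symmetric in \<phi> and its inverse.\<close>

lemma mem_normalizer:
  "\<phi> \<in> NM \<longleftrightarrow> \<phi> \<in> affinities \<and> (\<forall>m\<in>M. \<phi> \<circ> m \<circ> finv \<phi> \<in> M) \<and> (\<forall>m\<in>M. finv \<phi> \<circ> m \<circ> \<phi> \<in> M)"
proof (cases "\<phi> \<in> affinities")
  case True
  then have b: "bij \<phi>" by (rule affinityD)
  have c1: "finv \<phi> \<circ> (\<phi> \<circ> m \<circ> finv \<phi>) \<circ> \<phi> = m" and c2: "\<phi> \<circ> (finv \<phi> \<circ> m \<circ> \<phi>) \<circ> finv \<phi> = m" for m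
    using b by (simp_all add: fun_eq_iff)
  have "(\<lambda>m. \<phi> \<circ> m \<circ> finv \<phi>) ` M = M \<longleftrightarrow>
      (\<forall>m\<in>M. \<phi> \<circ> m \<circ> finv \<phi> \<in> M) \<and> (\<forall>m\<in>M. finv \<phi> \<circ> m \<circ> \<phi> \<in> M)" (is "?f ` M = M \<longleftrightarrow> ?R")
  proof
    assume eq: "?f ` M = M"
    have "finv \<phi> \<circ> m \<circ> \<phi> \<in> M" if m: "m \<in> M" for m
    proof -
      obtain m' where "m' \<in> M" "m = ?f m'" using eq m by blast
      then show ?thesis using c1[of m'] by simp
    qed
    then show ?R using eq by blast
  next
    assume R: ?R
    have "m \<in> ?f ` M" if m: "m \<in> M" for m
      using R m c2[of m] by (intro image_eqI[of m ?f "finv \<phi> \<circ> m \<circ> \<phi>"]) simp_all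
    then show "?f ` M = M" using R by blast
  qed
  then show ?thesis
    using True by (simp add: affine_normalizer_def normalizer_conj_image)
qed (simp add: affine_normalizer_def)

lemma NM_aff: "\<phi> \<in> NM \<Longrightarrow> \<phi> \<in> affinities" and NM_bij: "\<phi> \<in> NM \<Longrightarrow> bij \<phi>"
  by (simp_all add: mem_normalizer affinityD)

lemma NM_conj: "\<phi> \<in> NM \<Longrightarrow> m \<in> M \<Longrightarrow> \<phi> \<circ> m \<circ> finv \<phi> \<in> M"
  "\<phi> \<in> NM \<Longrightarrow> m \<in> M \<Longrightarrow> finv \<phi> \<circ> m \<circ> \<phi> \<in> M"
  by (simp_all add: mem_normalizer)

lemma NM_finv: "\<phi> \<in> NM \<Longrightarrow> finv \<phi> \<in> NM"
  by (simp add: mem_normalizer affinities_finv affinityD(2))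

lemma NM_comp:
  assumes "\<phi> \<in> NM" "\<psi> \<in> NM"
  shows "\<phi> \<circ> \<psi> \<in> NM"
proof -
  have "(\<phi> \<circ> \<psi>) \<circ> m \<circ> finv (\<phi> \<circ> \<psi>) = \<phi> \<circ> (\<psi> \<circ> m \<circ> finv \<psi>) \<circ> finv \<phi>"
    "finv (\<phi> \<circ> \<psi>) \<circ> m \<circ> (\<phi> \<circ> \<psi>) = finv \<psi> \<circ> (finv \<phi> \<circ> m \<circ> \<phi>) \<circ> \<psi>" for m
    using finv_comp_dist[OF NM_bij NM_bij, OF assms] by (simp_all add: comp_assoc)
  then show ?thesis
    using assms NM_conj affinities_comp NM_aff unfolding mem_normalizer[of "\<phi> \<circ> \<psi>"] by metis
qed

lemma M_NM: "m \<in> M \<Longrightarrow> m \<in> NM"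
  by (simp add: mem_normalizer space_groupD[OF M])

lemma id_NM: "id \<in> NM"
  by (rule M_NM[OF space_groupD(5)[OF M]])

lemma commuting_NM:
  assumes "\<phi> \<in> affinities" "\<And>m. m \<in> M \<Longrightarrow> \<phi> \<circ> m = m \<circ> \<phi>"
  shows "\<phi> \<in> NM"
proof -
  have "\<phi> \<circ> m \<circ> finv \<phi> = m" "finv \<phi> \<circ> m \<circ> \<phi> = m" if "m \<in> M" for m
  proof -
    have "finv \<phi> \<circ> m \<circ> \<phi> = finv \<phi> \<circ> \<phi> \<circ> m"
      unfolding comp_assoc using assms(2)[OF that] by simp
    moreover have "\<phi> \<circ> m \<circ> finv \<phi> = m \<circ> (\<phi> \<circ> finv \<phi>)"
      unfolding assms(2)[OF that] comp_assoc ..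
    ultimately show "\<phi> \<circ> m \<circ> finv \<phi> = m" "finv \<phi> \<circ> m \<circ> \<phi> = m"
      using affinityD(2)[OF assms(1)] by (simp_all add: finv_comp)
  qed
  then show ?thesis using assms(1) by (simp add: mem_normalizer)
qed

lemma shift_center_commutes: "v \<in> Span (center (grp M)) \<Longrightarrow> m \<in> M \<Longrightarrow> shift v \<circ> m = m \<circ> shift v"
  by (simp add: comp_shift space_groupD(3)[OF M] center_fixed[OF M])

lemma shift_center_NM: "v \<in> Span (center (grp M)) \<Longrightarrow> shift v \<in> NM"
  by (intro commuting_NM shift_affinity shift_center_commutes)

lemma st_orbit: "\<phi> \<in> NM \<Longrightarrow> st \<phi> (orbit M x) = orbit M (\<phi> x)"
  by (intro star_orbit subgroup_M NM_bij) (simp_all add: affine_normalizer_def)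

lemma star_eqI:
  assumes "\<And>x. star M1 M2 \<phi> (orbit M1 x) = star M1 M3 \<psi> (orbit M1 x)"
  shows "star M1 M2 \<phi> = star M1 M3 \<psi>"
proof
  fix X
  show "star M1 M2 \<phi> X = star M1 M3 \<psi> X"
  proof (cases "X \<in> orbit_space M1")
    case True
    then show ?thesis using assms by (auto simp: orbit_space_def)
  qed (simp add: star_def)
qed

lemma orbit_refl: "x \<in> orbit M x"
  using space_groupD(5)[OF M] unfolding orbit_def by (metis id_apply image_eqI)

lemma orbit_mem: "y \<in> orbit M x \<longleftrightarrow> orbit M y = orbit M x"
proof
  assume "y \<in> orbit M x"
  then show "orbit M y = orbit M x" using orbit_eq[OF subgroup_M] by (auto simp: orbit_def[of M x])
qed (use orbit_refl in blast)

lemma orbit_in_space: "orbit M x \<in> orbit_space M"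
  by (simp add: orbit_space_def)

lemma st_Bij:
  assumes "\<phi> \<in> NM"
  shows "st \<phi> \<in> Bij (orbit_space M)"
proof -
  have "bij_betw (st \<phi>) (orbit_space M) (orbit_space M)"
  proof (rule bij_betw_byWitness[where f' = "st (finv \<phi>)"])
    show "\<forall>a\<in>orbit_space M. st (finv \<phi>) (st \<phi> a) = a" "\<forall>a\<in>orbit_space M. st \<phi> (st (finv \<phi>) a) = a"
      using assms by (auto simp: orbit_space_def st_orbit NM_finv NM_bij)
    show "st \<phi> ` orbit_space M \<subseteq> orbit_space M" "st (finv \<phi>) ` orbit_space M \<subseteq> orbit_space M"
      using assms by (auto simp: orbit_space_def st_orbit NM_finv)
  qed
  then show ?thesis by (simp add: Bij_def star_def)
qed

lemma st_comp:
  assumes "\<phi> \<in> NM" "\<psi> \<in> NM"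
  shows "st (\<phi> \<circ> \<psi>) = st \<phi> \<otimes>\<^bsub>Aff M\<^esub> st \<psi>"
proof
  fix X
  show "st (\<phi> \<circ> \<psi>) X = (st \<phi> \<otimes>\<^bsub>Aff M\<^esub> st \<psi>) X"
  proof (cases "X \<in> orbit_space M")
    case True
    then show ?thesis using assms st_Bij
      by (auto simp: Aff_def BijGroup_def compose_def orbit_space_def st_orbit NM_comp)
  next
    case False
    then show ?thesis using assms st_Bij
      by (auto simp: Aff_def BijGroup_def compose_def star_def[of M M "\<phi> \<circ> \<psi>"])
  qed
qed

lemma st_id: "st id = \<one>\<^bsub>Aff M\<^esub>"
proof
  fix X
  show "st id X = \<one>\<^bsub>Aff M\<^esub> X"
  proof (cases "X \<in> orbit_space M")
    case True
    then show ?thesis by (auto simp: Aff_def BijGroup_def orbit_space_def st_orbit id_NM)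
  qed (simp add: Aff_def BijGroup_def star_def)
qed

lemma carrier_Aff: "carrier (Aff M) = st ` NM"
  by (simp add: Aff_def)

lemma group_Aff: "group (Aff M)"
proof (rule groupI)
  show "x \<otimes>\<^bsub>Aff M\<^esub> y \<in> carrier (Aff M)" if "x \<in> carrier (Aff M)" "y \<in> carrier (Aff M)" for x y
    using that by (auto simp: carrier_Aff st_comp[symmetric] NM_comp)
  show "\<one>\<^bsub>Aff M\<^esub> \<in> carrier (Aff M)" by (auto simp: carrier_Aff st_id[symmetric] id_NM)
  show "x \<otimes>\<^bsub>Aff M\<^esub> y \<otimes>\<^bsub>Aff M\<^esub> z = x \<otimes>\<^bsub>Aff M\<^esub> (y \<otimes>\<^bsub>Aff M\<^esub> z)"
    if "x \<in> carrier (Aff M)" "y \<in> carrier (Aff M)" "z \<in> carrier (Aff M)" for x y z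
    using that by (auto simp: carrier_Aff st_comp[symmetric] NM_comp comp_assoc)
  show "\<one>\<^bsub>Aff M\<^esub> \<otimes>\<^bsub>Aff M\<^esub> x = x" if "x \<in> carrier (Aff M)" for x
    using that by (auto simp: carrier_Aff st_id[symmetric] st_comp[symmetric] id_NM)
  show "\<exists>y\<in>carrier (Aff M). y \<otimes>\<^bsub>Aff M\<^esub> x = \<one>\<^bsub>Aff M\<^esub>" if "x \<in> carrier (Aff M)" for x
  proof -
    obtain \<phi> where \<phi>: "\<phi> \<in> NM" "x = st \<phi>"
      using \<open>x \<in> carrier (Aff M)\<close> by (auto simp: carrier_Aff)
    have "st (finv \<phi>) \<otimes>\<^bsub>Aff M\<^esub> x = \<one>\<^bsub>Aff M\<^esub>"
      using \<phi> by (simp add: st_comp[symmetric] NM_finv st_id[symmetric] finv_comp NM_bij)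
    then show ?thesis using NM_finv[OF \<phi>(1)] by (auto simp: carrier_Aff)
  qed
qed

lemma inv_st: "\<phi> \<in> NM \<Longrightarrow> inv\<^bsub>Aff M\<^esub> (st \<phi>) = st (finv \<phi>)"
  by (intro group.inv_equality[OF group_Aff])
    (auto simp: carrier_Aff NM_finv st_comp[symmetric] st_id[symmetric] finv_comp NM_bij)

lemma conj_st: "\<alpha> \<in> NM \<Longrightarrow> \<phi> \<in> NM \<Longrightarrow> conj_by (Aff M) (st \<alpha>) (st \<phi>) = st (\<alpha> \<circ> \<phi> \<circ> finv \<alpha>)"
  by (simp add: conj_by_def inv_st st_comp NM_comp NM_finv)

text \<open>The kernel of \<open>st\<close> on the normalizer is \<open>M\<close>, so
  \<open>Aff M\<close> is the quotient of the normalizer by \<open>M\<close>. The substantial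
  direction is \<open>orbit_preserving_affinity\<close>.\<close>

lemma st_eq_id_iff: "\<phi> \<in> NM \<Longrightarrow> st \<phi> = st id \<longleftrightarrow> \<phi> \<in> M"
proof
  assume \<phi>: "\<phi> \<in> NM" and eq: "st \<phi> = st id"
  show "\<phi> \<in> M"
  proof (rule orbit_preserving_affinity[OF M NM_aff[OF \<phi>]])
    show "\<phi> x \<in> orbit M x" for x
      using fun_cong[OF eq, of "orbit M x"] by (simp add: orbit_mem st_orbit \<phi> id_NM)
  qed
next
  assume \<phi>: "\<phi> \<in> NM" "\<phi> \<in> M"
  show "st \<phi> = st id"
    by (rule star_eqI) (simp add: st_orbit \<phi> id_NM orbit_eq[OF subgroup_M])
qed

lemma st_eq_iff:
  assumes "\<phi> \<in> NM" "\<psi> \<in> NM"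
  shows "st \<phi> = st \<psi> \<longleftrightarrow> \<phi> \<circ> finv \<psi> \<in> M"
proof -
  interpret A: group "Aff M" by (rule group_Aff)
  have "st \<phi> = st \<psi> \<longleftrightarrow> st \<phi> \<otimes>\<^bsub>Aff M\<^esub> inv\<^bsub>Aff M\<^esub> st \<psi> = \<one>\<^bsub>Aff M\<^esub>"
    using assms A.inv_solve_right'[of "st \<psi>" "\<one>\<^bsub>Aff M\<^esub>" "st \<psi>"]
    by (metis A.inv_solve_right' A.l_one A.one_closed A.r_inv carrier_Aff image_eqI)
  also have "\<dots> \<longleftrightarrow> st (\<phi> \<circ> finv \<psi>) = st id"
    using assms by (simp add: inv_st st_comp NM_finv st_id)
  also have "\<dots> \<longleftrightarrow> \<phi> \<circ> finv \<psi> \<in> M"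
    using assms by (intro st_eq_id_iff NM_comp NM_finv)
  finally show ?thesis .
qed

lemma st_eqE:
  assumes "st \<phi> = st \<psi>" "\<phi> \<in> NM" "\<psi> \<in> NM"
  obtains m where "m \<in> M" "\<phi> = m \<circ> \<psi>"
proof (rule that)
  show "\<phi> \<circ> finv \<psi> \<in> M" using assms st_eq_iff by blast
  show "\<phi> = \<phi> \<circ> finv \<psi> \<circ> \<psi>" by (simp add: comp_assoc finv_comp NM_bij[OF assms(3)])
qed

lemma st_M_comp: "m \<in> M \<Longrightarrow> \<phi> \<in> NM \<Longrightarrow> st (m \<circ> \<phi>) = st \<phi>"
  using st_eq_iff[of "m \<circ> \<phi>" \<phi>] by (simp add: NM_comp M_NM comp_assoc finv_comp NM_bij)

text \<open>A normalizing map carries orbits onto orbits as sets, and an isometry preserves the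
  distance between sets.\<close>

lemma st_Isom:
  assumes \<phi>: "\<phi> \<in> NM" "\<phi> \<in> isometries"
  shows "st \<phi> \<in> Isom M"
proof -
  have img: "orbit M (\<phi> x) = \<phi> ` orbit M x" for x
  proof
    show "\<phi> ` orbit M x \<subseteq> orbit M (\<phi> x)"
    proof clarify
      fix y assume "y \<in> orbit M x"
      then obtain m where m: "m \<in> M" "y = m x" by (auto simp: orbit_def)
      have "\<phi> y = (\<phi> \<circ> m \<circ> finv \<phi>) (\<phi> x)" using NM_bij[OF \<phi>(1)] by (simp add: m)
      then show "\<phi> y \<in> orbit M (\<phi> x)" unfolding orbit_def using NM_conj(1)[OF \<phi>(1) m(1)] by blast
    qed
    show "orbit M (\<phi> x) \<subseteq> \<phi> ` orbit M x"
    proof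
      fix y assume "y \<in> orbit M (\<phi> x)"
      then obtain m where m: "m \<in> M" "y = m (\<phi> x)" by (auto simp: orbit_def)
      have "y = \<phi> ((finv \<phi> \<circ> m \<circ> \<phi>) x)" using NM_bij[OF \<phi>(1)] by (simp add: m)
      then show "y \<in> \<phi> ` orbit M x" unfolding orbit_def using NM_conj(2)[OF \<phi>(1) m(1)] by blast
    qed
  qed
  have "setdist (\<phi> ` A) (\<phi> ` B) = setdist A B" for A B
  proof -
    have "{dist x y |x y. x \<in> \<phi> ` A \<and> y \<in> \<phi> ` B} = {dist x y |x y. x \<in> A \<and> y \<in> B}"
      using \<phi>(2) unfolding isometries_dist by (auto) (metis imageI)
    then show ?thesis unfolding setdist_def by simp
  qed
  then show ?thesis using st_Bij[OF \<phi>(1)] by (auto simp: Isom_def orbit_space_def st_orbit[OF \<phi>(1)] img)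
qed

section \<open>The homomorphism Omega on representatives\<close>

definition cj :: "('a \<Rightarrow> 'a) \<Rightarrow> ('a \<Rightarrow> 'a) \<Rightarrow> ('a \<Rightarrow> 'a)"
  where "cj \<phi> = restrict (conj_by Maps \<phi>) M"

lemma cj_app: "\<phi> \<in> NM \<Longrightarrow> m \<in> M \<Longrightarrow> cj \<phi> m = \<phi> \<circ> m \<circ> finv \<phi>"
  by (simp add: cj_def conj_by_Maps NM_bij bij_M)

lemma cj_auto:
  assumes \<phi>: "\<phi> \<in> NM"
  shows "cj \<phi> \<in> carrier (AutoGroup (grp M))"
proof -
  have b: "bij \<phi>" by (rule NM_bij[OF \<phi>])
  have "bij_betw (cj \<phi>) M M"
  proof (rule bij_betw_byWitness[where f' = "cj (finv \<phi>)"])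
    show "\<forall>a\<in>M. cj (finv \<phi>) (cj \<phi> a) = a" "\<forall>a\<in>M. cj \<phi> (cj (finv \<phi>) a) = a"
      using \<phi> b by (simp_all add: cj_app NM_finv NM_conj) (simp_all add: fun_eq_iff)
    show "cj \<phi> ` M \<subseteq> M" "cj (finv \<phi>) ` M \<subseteq> M"
      using \<phi> b by (auto simp: cj_app NM_finv NM_conj)
  qed
  then have Bij: "cj \<phi> \<in> Bij M" by (simp add: Bij_def cj_def)
  have "cj \<phi> \<in> hom (grp M) (grp M)"
  proof (rule homI)
    show "cj \<phi> x \<in> carrier (grp M)" if "x \<in> carrier (grp M)" for x
      using that \<phi> by (simp add: cj_app NM_conj)
    fix x y assume xy: "x \<in> carrier (grp M)" "y \<in> carrier (grp M)"
    then have "\<phi> \<circ> (x \<circ> y) \<circ> finv \<phi> = (\<phi> \<circ> x \<circ> finv \<phi>) \<circ> (\<phi> \<circ> y \<circ> finv \<phi>)"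
      using b by (simp add: fun_eq_iff)
    moreover have "bij (\<phi> \<circ> x \<circ> finv \<phi>)" if "x \<in> M" for x using NM_conj[OF \<phi> that] bij_M by blast
    ultimately show "cj \<phi> (x \<otimes>\<^bsub>grp M\<^esub> y) = cj \<phi> x \<otimes>\<^bsub>grp M\<^esub> cj \<phi> y"
      using xy \<phi> by (simp add: mult_Maps bij_M cj_app space_groupD(6)[OF M])
  qed
  then show ?thesis using Bij by (simp add: AutoGroup_def auto_def)
qed

lemma cj_comp: "\<phi> \<in> NM \<Longrightarrow> \<psi> \<in> NM \<Longrightarrow> cj (\<phi> \<circ> \<psi>) = cj \<phi> \<otimes>\<^bsub>AutoGroup (grp M)\<^esub> cj \<psi>"
  using cj_auto[of \<phi>] cj_auto[of \<psi>]
  by (subst mult_AutoGroup)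
    (auto simp: AutoGroup_def auto_def fun_eq_iff compose_def cj_app NM_comp NM_conj
      finv_comp_dist NM_bij cj_def[of "\<phi> \<circ> \<psi>"] conj_by_Maps bij_comp bij_M)

lemma Inn_M: "Inn (grp M) = cj ` M"
proof -
  have "restrict (conj_by (grp M) m) M = cj m" if "m \<in> M" for m
    using that by (auto simp: cj_def fun_eq_iff conj_by_grp[OF bij_group_M] conj_by_Maps bij_M)
  then show ?thesis by (simp add: Inn_def Setcompr_eq_image)
qed

text \<open>Representatives of the same class differ by a left factor from \<open>M\<close>, whose
  conjugation action is inner; so all of them give the same coset and \<open>the_elem\<close> is
  justified.\<close>

lemma Omega_st:
  assumes \<phi>: "\<phi> \<in> NM"
  shows "Omega M (st \<phi>) = Inn (grp M) #>\<^bsub>AutoGroup (grp M)\<^esub> cj \<phi>"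
proof -
  interpret G: group "grp M" by (rule group_grp[OF bij_group_M])
  interpret A: group "AutoGroup (grp M)" by (rule G.AutoGroup)
  have "Inn (grp M) #>\<^bsub>AutoGroup (grp M)\<^esub> cj \<psi> = Inn (grp M) #>\<^bsub>AutoGroup (grp M)\<^esub> cj \<phi>"
    if \<psi>: "\<psi> \<in> NM" "st \<psi> = st \<phi>" for \<psi>
  proof (rule A.repr_independence[symmetric, OF _ cj_auto[OF \<phi>] G.Inn_subgroup])
    obtain m where m: "m \<in> M" "\<psi> = m \<circ> \<phi>" using st_eqE[OF \<psi>(2) \<psi>(1) \<phi>] by blast
    have "cj \<psi> = cj m \<otimes>\<^bsub>AutoGroup (grp M)\<^esub> cj \<phi>" unfolding m(2) by (rule cj_comp[OF M_NM[OF m(1)] \<phi>])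
    then show "cj \<psi> \<in> Inn (grp M) #>\<^bsub>AutoGroup (grp M)\<^esub> cj \<phi>"
      using m(1) by (auto simp: r_coset_def Inn_M)
  qed
  then have coset: "(\<lambda>\<psi>. Inn (grp M) #>\<^bsub>AutoGroup (grp M)\<^esub> cj \<psi>) ` {\<psi> \<in> NM. st \<psi> = st \<phi>}
      = (\<lambda>_. Inn (grp M) #>\<^bsub>AutoGroup (grp M)\<^esub> cj \<phi>) ` {\<psi> \<in> NM. st \<psi> = st \<phi>}"
    by (intro image_cong refl) simp
  have "{\<psi> \<in> NM. st \<psi> = st \<phi>} \<noteq> {}" using \<phi> by blast
  with coset have "(\<lambda>\<psi>. Inn (grp M) #>\<^bsub>AutoGroup (grp M)\<^esub> cj \<psi>) ` {\<psi> \<in> NM. st \<psi> = st \<phi>}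
      = {Inn (grp M) #>\<^bsub>AutoGroup (grp M)\<^esub> cj \<phi>}" by (simp add: image_constant_conv)
  then show ?thesis unfolding Omega_def cj_def[symmetric] by simp
qed

text \<open>For a suitable m in \<open>M\<close> the maps \<phi> and m o \<psi> act on
  \<open>M\<close> by the same conjugation. Their quotient centralizes \<open>M\<close> and is
  therefore a translation. This converts finiteness of the image of \<open>Omega\<close> into
  finiteness of linear parts up to isometric left factors.\<close>

lemma Omega_eq_lin:
  assumes \<phi>: "\<phi> \<in> NM" and \<psi>: "\<psi> \<in> NM" and eq: "Omega M (st \<phi>) = Omega M (st \<psi>)"
  obtains m where "m \<in> M" "lin \<phi> = lin m \<circ> lin \<psi>"
proof -
  interpret G: group "grp M" by (rule group_grp[OF bij_group_M])
  interpret A: group "AutoGroup (grp M)" by (rule G.AutoGroup)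
  have "cj \<phi> \<in> Inn (grp M) #>\<^bsub>AutoGroup (grp M)\<^esub> cj \<psi>"
    using A.rcos_self[OF cj_auto[OF \<phi>] G.Inn_subgroup] eq unfolding Omega_st[OF \<phi>] Omega_st[OF \<psi>] by simp
  then obtain m where m: "m \<in> M" "cj \<phi> = cj (m \<circ> \<psi>)"
    by (auto simp: r_coset_def Inn_M cj_comp[OF M_NM \<psi>])
  define \<omega> where "\<omega> = m \<circ> \<psi>"
  have \<omega>: "\<omega> \<in> NM" unfolding \<omega>_def by (rule NM_comp[OF M_NM[OF m(1)] \<psi>])
  have "lin (finv \<omega> \<circ> \<phi>) = id"
  proof (rule centralizer_translation[OF M])
    show "finv \<omega> \<circ> \<phi> \<in> affinities" by (intro affinities_comp affinities_finv NM_aff \<omega> \<phi>)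
    fix g assume g: "g \<in> M"
    have "\<phi> \<circ> g \<circ> finv \<phi> = \<omega> \<circ> g \<circ> finv \<omega>"
      using fun_cong[OF m(2), of g] g \<phi> \<omega> by (simp add: cj_app \<omega>_def)
    then have *: "\<phi> (g (finv \<phi> x)) = \<omega> (g (finv \<omega> x))" for x by (metis comp_apply)
    show "finv \<omega> \<circ> \<phi> \<circ> g = g \<circ> (finv \<omega> \<circ> \<phi>)"
      using *[of "\<phi> x" for x] NM_bij[OF \<phi>] NM_bij[OF \<omega>] by (simp add: fun_eq_iff)
  qed
  then have "finv (lin \<omega>) (lin \<phi> x) = x" for x
    using lin_comp[OF affinities_finv[OF NM_aff[OF \<omega>]], of \<phi>] lin_finv[OF NM_aff[OF \<omega>]]
    by (metis comp_apply id_apply)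
  then have "lin \<phi> x = lin \<omega> x" for x using bij_lin[OF NM_aff[OF \<omega>]] by (metis finv_app(2))
  then have "lin \<phi> = lin m \<circ> lin \<psi>"
    using lin_comp[OF space_groupD(3)[OF M m(1)], of \<psi>] by (simp add: \<omega>_def fun_eq_iff)
  then show thesis using that m(1) by blast
qed

end

text \<open>Gram-Schmidt for \<open>S\<close>.\<close>

lemma inner_product_coordinates:
  fixes S :: "'a::euclidean_space \<Rightarrow> 'a \<Rightarrow> real"
  assumes L: "\<And>y. linear (\<lambda>x. S x y)" and sym: "\<And>x y. S x y = S y x"
    and pos: "\<And>x. x \<noteq> 0 \<Longrightarrow> S x x > 0"
  obtains C :: "'a \<Rightarrow> 'a" where "linear C" "bij C" "\<And>x y. C x \<bullet> C y = S x y"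
proof -
  have flip: "S x = (\<lambda>y. S y x)" for x by (rule ext) (rule sym)
  have L2: "linear (S x)" for x by (subst flip) (rule L)
  note lS = linear_add[OF L] linear_diff[OF L] linear_scale[OF L] linear_sum[OF L]
    linear_add[OF L2] linear_diff[OF L2] linear_scale[OF L2] linear_sum[OF L2]
  have gs: "\<exists>c. \<forall>b\<in>F. \<forall>b'\<in>F. S (c b) (c b') = (if b = b' then 1 else 0)"
    if "finite F" "F \<subseteq> (Basis :: 'a set)" for F
    using that
  proof (induction F rule: finite_induct)
    case (insert b F)
    then obtain c where c: "\<And>x y. x \<in> F \<Longrightarrow> y \<in> F \<Longrightarrow> S (c x) (c y) = (if x = y then 1 else (0::real))"
      by auto
    \<comment> \<open>Fewer vectors than the dimension have been chosen, so there is a vector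
      \<open>x\<close> outside their span on which to continue.\<close>
    have "dim (span (c ` F)) < DIM('a)"
    proof -
      have "dim (span (c ` F)) \<le> card (c ` F)" using insert(1) by (simp add: dim_le_card')
      also have "\<dots> \<le> card F" using insert(1) by (rule card_image_le)
      also have "\<dots> < card (insert b F)" using insert by simp
      also have "\<dots> \<le> DIM('a)" using insert.prems by (intro card_mono) auto
      finally show ?thesis .
    qed
    then have "span (c ` F) \<noteq> UNIV" by (metis dim_UNIV less_irrefl)
    then obtain x where x: "x \<notin> span (c ` F)" by blast
    define y where "y = x - (\<Sum>a\<in>F. S x (c a) *\<^sub>R c a)"
    have "(\<Sum>a\<in>F. S x (c a) *\<^sub>R c a) \<in> span (c ` F)"
      by (intro span_sum span_scale span_base) auto
    then have "y \<noteq> 0" using x by (auto simp: y_def)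
    then have Sy: "S y y > 0" by (rule pos)
    have yF: "S y (c a) = 0" if a: "a \<in> F" for a
    proof -
      have "(\<Sum>d\<in>F. S x (c d) * S (c d) (c a)) = (\<Sum>d\<in>F. if d = a then S x (c d) else 0)"
        using a by (intro sum.cong) (auto simp: c)
      then show ?thesis using insert(1) a by (simp add: y_def lS)
    qed
    define e where "e = (1 / sqrt (S y y)) *\<^sub>R y"
    have "S e e = 1" using Sy by (simp add: e_def lS)
    moreover have "S e (c a) = 0" "S (c a) e = 0" if "a \<in> F" for a
      using yF[OF that] sym[of "c a" y] by (simp_all add: e_def lS)
    ultimately show ?case
      using c insert(2) by (intro exI[of _ "c(b := e)"]) auto
  qed simp
  obtain c :: "'a \<Rightarrow> 'a" where c0: "\<forall>b\<in>Basis. \<forall>b'\<in>Basis. S (c b) (c b') = (if b = b' then 1 else 0)"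
    using gs[OF finite_Basis subset_refl] by (elim exE) (rule that)
  have c: "S (c b) (c b') = (if b = b' then 1 else 0)" if "b \<in> Basis" "b' \<in> Basis" for b b'
    using c0 that by simp
  \<comment> \<open>\<open>D\<close> sends \<open>Basis\<close> to an S-orthonormal family and so
    carries the standard product to \<open>S\<close>; the required \<open>C\<close> is its
    inverse.\<close>
  define D where "D x = (\<Sum>b\<in>Basis. (x \<bullet> b) *\<^sub>R c b)" for x :: 'a
  have D: "linear D"
    unfolding D_def by (intro linear_compose_sum ballI)
      (simp add: linear_iff inner_add_left scaleR_add_left)
  have SD: "S (D x) (D y) = x \<bullet> y" for x y
  proof -
    have "S (D x) (D y) = (\<Sum>b\<in>Basis. (\<Sum>b'\<in>Basis. (x \<bullet> b) * ((y \<bullet> b') * S (c b) (c b'))))"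
      by (simp add: D_def lS sum_distrib_left) (subst sum.swap, simp add: mult.left_commute)
    also have "\<dots> = (\<Sum>b\<in>Basis. (\<Sum>b'\<in>Basis. if b' = b then (x \<bullet> b) * (y \<bullet> b') else 0))"
      by (intro sum.cong) (auto simp: c)
    also have "\<dots> = x \<bullet> y" by (simp add: euclidean_inner[of x y])
    finally show ?thesis .
  qed
  have "inj D"
    unfolding linear_injective_0[OF D] using SD linear_0[OF L] by (metis inner_eq_zero_iff)
  then have bD: "bij D" using linear_injective_imp_surjective[OF D] by (simp add: bij_def)
  show thesis
  proof (rule that[of "finv D"])
    show "linear (finv D)" by (rule inj_linear_imp_inv_linear[OF D \<open>inj D\<close>])
    show "bij (finv D)" using bD by simp
    show "finv D x \<bullet> finv D y = S x y" for x y using SD[of "finv D x" "finv D y"] bD by simp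
  qed
qed

section \<open>Lifts of a homomorphism\<close>

lemma map_prod_inject:
  fixes a c :: "'a \<Rightarrow> 'b" and b d :: "'c \<Rightarrow> 'd"
  shows "map_prod a b = map_prod c d \<longleftrightarrow> a = c \<and> b = d"
proof
  assume eq: "map_prod a b = map_prod c d"
  have "a x = c x \<and> b y = d y" for x y using fun_cong[OF eq, of "(x, y)"] by simp
  then show "a = c \<and> b = d" by auto
qed simp

lemma map_prod_comp: "map_prod a b \<circ> map_prod c d = map_prod (a \<circ> c) (b \<circ> d)"
  by (simp add: map_prod_compose)

lemma bij_map_prod: "bij a \<Longrightarrow> bij b \<Longrightarrow> bij (map_prod a b)"
  by (metis bij_betw_map_prod UNIV_Times_UNIV)

lemma finv_map_prod: "bij a \<Longrightarrow> bij b \<Longrightarrow> finv (map_prod a b) = map_prod (finv a) (finv b)"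
  by (rule finv_eqI) auto

lemma part_map_prod [simp]: "fst_part (map_prod a b) = a" "snd_part (map_prod a b) = b"
  by (simp_all add: fst_part_def snd_part_def fun_eq_iff)

lemma isometries_map_prod:
  assumes "a \<in> isometries" "b \<in> isometries"
  shows "map_prod a b \<in> isometries"
  using assms by (auto simp: isometries_dist dist_Pair_Pair)

lemma isometries_fst_part:
  fixes a :: "'a::euclidean_space \<Rightarrow> 'a" and b :: "real \<Rightarrow> real"
  assumes g: "map_prod a b \<in> isometries"
  shows "a \<in> isometries"
  unfolding isometries_dist
proof (intro allI)
  fix x y :: 'a
  have "dist (map_prod a b (x, 0)) (map_prod a b (y, 0)) = dist (x, 0 :: real) (y, 0)"
    using g unfolding isometries_dist by blast
  then show "dist (a x) (a y) = dist x y" by (simp add: dist_Pair_Pair)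
qed

definition ext :: "('a \<Rightarrow> 'a) set \<Rightarrow> ('a \<times> real \<Rightarrow> 'a \<times> real) set"
  where "ext G = (\<lambda>m. map_prod m id) ` G"

lemma map_prod_ext: "map_prod a id \<in> ext G \<longleftrightarrow> a \<in> G"
  by (auto simp: ext_def map_prod_inject)

text \<open>\<Delta> is an arbitrary 1-space group in this locale. The translation of
  \<open>psi\<close> into a statement about lifts is carried out at this level; the dihedral group
  is substituted afterwards.\<close>

locale orbifold_extension = orbifold M for M :: "('a::euclidean_space \<Rightarrow> 'a) set" +
  fixes \<Delta> :: "(real \<Rightarrow> real) set"
  assumes D: "space_group \<Delta>"
begin

definition hom_to_Aff :: "((real \<Rightarrow> real) \<Rightarrow> 'a set \<Rightarrow> 'a set) \<Rightarrow> bool"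
  where "hom_to_Aff \<eta> \<longleftrightarrow> (\<forall>d\<in>\<Delta>. \<exists>\<phi>\<in>NM. \<eta> d = st \<phi>) \<and>
    (\<forall>d\<in>\<Delta>. \<forall>e\<in>\<Delta>. \<eta> (d \<circ> e) = \<eta> d \<otimes>\<^bsub>Aff M\<^esub> \<eta> e)"

lemma hom_to_Aff_iff: "hom_to_Aff \<eta> \<longleftrightarrow> \<eta> \<in> hom (grp \<Delta>) (Aff M)"
proof -
  have "\<eta> (d \<otimes>\<^bsub>grp \<Delta>\<^esub> e) = \<eta> (d \<circ> e)" if "d \<in> \<Delta>" "e \<in> \<Delta>" for d e
    using that by (simp add: mult_Maps space_groupD(4)[OF D])
  then show ?thesis by (auto simp: hom_to_Aff_def hom_def carrier_Aff Pi_iff)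
qed

lemma hom_to_AffE:
  assumes "hom_to_Aff \<eta>" "d \<in> \<Delta>"
  obtains \<phi> where "\<phi> \<in> NM" "\<eta> d = st \<phi>"
  using assms unfolding hom_to_Aff_def by blast

lemma hom_to_Aff_id:
  assumes \<eta>: "hom_to_Aff \<eta>"
  shows "\<eta> id = st id"
proof -
  interpret A: group "Aff M" by (rule group_Aff)
  obtain \<phi> where \<phi>: "\<phi> \<in> NM" "\<eta> id = st \<phi>" using hom_to_AffE[OF \<eta> space_groupD(5)[OF D]] .
  have "\<eta> id \<otimes>\<^bsub>Aff M\<^esub> \<eta> id = \<eta> id"
    using \<eta> space_groupD(5)[OF D] unfolding hom_to_Aff_def by (metis comp_id)
  then show ?thesis
    using A.l_cancel_one[of "\<eta> id" "\<eta> id"] \<phi> by (auto simp: st_id carrier_Aff)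
qed

text \<open>The fibre product of the normalizer of M and \<Delta> over \<open>Aff M\<close>, that
  is, the pullback along \<eta> of the extension of \<open>Aff M\<close> by \<open>M\<close>. It
  acts on E^n by affinities, in general not by isometries.\<close>

definition lifts :: "((real \<Rightarrow> real) \<Rightarrow> 'a set \<Rightarrow> 'a set) \<Rightarrow> ('a \<times> real \<Rightarrow> 'a \<times> real) set"
  where "lifts \<eta> = {map_prod \<phi> \<delta> | \<phi> \<delta>. \<delta> \<in> \<Delta> \<and> \<phi> \<in> NM \<and> st \<phi> = \<eta> \<delta>}"

lemma map_prod_lifts: "map_prod \<phi> \<delta> \<in> lifts \<eta> \<longleftrightarrow> \<delta> \<in> \<Delta> \<and> \<phi> \<in> NM \<and> st \<phi> = \<eta> \<delta>"
  by (auto simp: lifts_def map_prod_inject)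

lemma liftsE:
  assumes "\<gamma> \<in> lifts \<eta>"
  obtains \<phi> \<delta> where "\<gamma> = map_prod \<phi> \<delta>" "\<delta> \<in> \<Delta>" "\<phi> \<in> NM" "st \<phi> = \<eta> \<delta>"
  using assms unfolding lifts_def by blast

lemma bij_group_lifts:
  assumes \<eta>: "hom_to_Aff \<eta>"
  shows "bij_group (lifts \<eta>)"
  unfolding bij_group_def
proof (intro conjI ballI)
  interpret A: group "Aff M" by (rule group_Aff)
  have "map_prod id id \<in> lifts \<eta>"
    by (simp add: map_prod_lifts id_NM space_groupD(5)[OF D] hom_to_Aff_id[OF \<eta>])
  then show "id \<in> lifts \<eta>" by (simp add: prod.map_id0)
  fix g assume "g \<in> lifts \<eta>"
  then obtain \<phi> d where g: "g = map_prod \<phi> d" "d \<in> \<Delta>" "\<phi> \<in> NM" "st \<phi> = \<eta> d" by (rule liftsE)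
  show "bij g" using g by (simp add: bij_map_prod NM_bij space_groupD(4)[OF D])
  obtain \<psi>' where \<psi>': "\<psi>' \<in> NM" "\<eta> (finv d) = st \<psi>'"
    using hom_to_AffE[OF \<eta> space_groupD(7)[OF D g(2)]] .
  have "\<eta> (finv d) \<otimes>\<^bsub>Aff M\<^esub> \<eta> d = \<eta> (finv d \<circ> d)"
    using \<eta> g(2) space_groupD(7)[OF D g(2)] by (simp add: hom_to_Aff_def)
  also have "\<dots> = st id" using space_groupD(4)[OF D g(2)] by (simp add: finv_comp hom_to_Aff_id[OF \<eta>])
  finally have inv: "inv\<^bsub>Aff M\<^esub> (st \<phi>) = \<eta> (finv d)"
    using \<psi>' g(3) g(4)[symmetric] by (intro A.inv_equality) (auto simp: carrier_Aff st_id)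
  have "map_prod (finv \<phi>) (finv d) \<in> lifts \<eta>"
    using g(2,3) inv inv_st[OF g(3)] by (simp add: map_prod_lifts NM_finv space_groupD(7)[OF D])
  then show "finv g \<in> lifts \<eta>" using g by (simp add: finv_map_prod NM_bij space_groupD(4)[OF D])
  fix h assume "h \<in> lifts \<eta>"
  then obtain \<psi> e where h: "h = map_prod \<psi> e" "e \<in> \<Delta>" "\<psi> \<in> NM" "st \<psi> = \<eta> e" by (rule liftsE)
  have "\<eta> (d \<circ> e) = \<eta> d \<otimes>\<^bsub>Aff M\<^esub> \<eta> e" using \<eta> g h unfolding hom_to_Aff_def by blast
  then show "g \<circ> h \<in> lifts \<eta>"
    using g h by (simp add: map_prod_comp map_prod_lifts NM_comp st_comp space_groupD(6)[OF D])
qed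

lemma lifts_id: "hom_to_Aff \<eta> \<Longrightarrow> map_prod \<phi> id \<in> lifts \<eta> \<longleftrightarrow> \<phi> \<in> M"
  using st_eq_id_iff[of \<phi>] M_NM[of \<phi>]
  by (auto simp: map_prod_lifts hom_to_Aff_id space_groupD(5)[OF D])

lemma ext_lifts: "hom_to_Aff \<eta> \<Longrightarrow> ext M \<subseteq> lifts \<eta>"
  by (auto simp: ext_def lifts_id)

lemma lifts_fiber:
  assumes "map_prod \<phi> d \<in> lifts \<eta>" "map_prod \<psi> d \<in> lifts \<eta>"
  obtains m where "m \<in> M" "\<psi> = m \<circ> \<phi>"
  using assms st_eqE[of \<psi> \<phi>] by (auto simp: map_prod_lifts)

lemma lifts_M_comp: "map_prod \<phi> d \<in> lifts \<eta> \<Longrightarrow> m \<in> M \<Longrightarrow> map_prod (m \<circ> \<phi>) d \<in> lifts \<eta>"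
  by (simp add: map_prod_lifts NM_comp M_NM st_M_comp)

lemma lifts_surj:
  assumes "hom_to_Aff \<eta>" "d \<in> \<Delta>"
  obtains \<phi> where "map_prod \<phi> d \<in> lifts \<eta>"
  using hom_to_AffE[OF assms] assms(2) by (metis map_prod_lifts)

text \<open>By \<open>Omega_eq_lin\<close>, the pullback of the scalar product along a lift of \<open>\<eta> d\<close> depends only on
  \<open>Omega M (\<eta> d)\<close>. So there are only finitely many such pullbacks, and their sum is invariant.\<close>

lemma invariant_coordinates:
  assumes \<eta>: "hom_to_Aff \<eta>" and fin: "finite ((\<lambda>d. Omega M (\<eta> d)) ` \<Delta>)"
  obtains C :: "'a \<Rightarrow> 'a" where "linear C" "bij C"
    "\<And>\<phi> d x. map_prod \<phi> d \<in> lifts \<eta> \<Longrightarrow> norm (C (lin \<phi> x)) = norm (C x)"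
proof -
  define P where "P = {\<phi> \<in> NM. st \<phi> \<in> \<eta> ` \<Delta>}"
  have P: "\<phi> \<in> P \<longleftrightarrow> (\<exists>d. map_prod \<phi> d \<in> lifts \<eta>)" for \<phi>
    by (auto simp: P_def map_prod_lifts)
  have idP: "id \<in> P"
    using id_NM hom_to_Aff_id[OF \<eta>] space_groupD(5)[OF D] by (force simp: P_def)
  have Pcomp: "\<phi> \<circ> \<psi> \<in> P" if "\<phi> \<in> P" "\<psi> \<in> P" for \<phi> \<psi>
    using that bij_groupD(3)[OF bij_group_lifts[OF \<eta>]] unfolding P by (metis map_prod_comp)
  have aff: "\<phi> \<in> affinities" if "\<phi> \<in> P" for \<phi> using that by (simp add: P_def NM_aff)
  define B where "B \<phi> = (\<lambda>x y. lin \<phi> x \<bullet> lin \<phi> y)" for \<phi> :: "'a \<Rightarrow> 'a"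
  define Q where "Q = B ` P"
  have Bcong: "B \<phi> = B \<psi>" if "\<phi> \<in> NM" "\<psi> \<in> NM" "Omega M (st \<phi>) = Omega M (st \<psi>)" for \<phi> \<psi>
  proof -
    obtain m where m: "m \<in> M" "lin \<phi> = lin m \<circ> lin \<psi>"
      using Omega_eq_lin[OF \<open>\<phi> \<in> NM\<close> \<open>\<psi> \<in> NM\<close> \<open>Omega M (st \<phi>) = Omega M (st \<psi>)\<close>] .
    have "orthogonal_transformation (lin m)"
      using space_groupD(2)[OF M m(1)] by (simp add: isometries_iff)
    then show ?thesis by (simp add: B_def m(2) orthogonal_transformation_def)
  qed
  have finQ: "finite Q"
  proof -
    \<comment> \<open>One pullback is selected for each value of \<open>Omega\<close>; by
      \<open>Bcong\<close> it does not matter which representative is picked.\<close>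
    define F where "F \<omega> = B (SOME \<phi>. \<phi> \<in> NM \<and> Omega M (st \<phi>) = \<omega>)" for \<omega>
    have "B \<phi> \<in> F ` (\<lambda>d. Omega M (\<eta> d)) ` \<Delta>" if \<phi>: "\<phi> \<in> P" for \<phi>
    proof -
      obtain d where d: "d \<in> \<Delta>" "st \<phi> = \<eta> d" and \<phi>N: "\<phi> \<in> NM" using \<phi> by (auto simp: P_def)
      define \<psi> where "\<psi> = (SOME \<psi>. \<psi> \<in> NM \<and> Omega M (st \<psi>) = Omega M (\<eta> d))"
      have "\<psi> \<in> NM \<and> Omega M (st \<psi>) = Omega M (\<eta> d)"
        unfolding \<psi>_def by (rule someI[of _ \<phi>]) (simp add: \<phi>N d)
      then have "B \<phi> = B \<psi>" using \<phi>N d by (intro Bcong) simp_all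
      then show ?thesis using d(1) unfolding F_def \<psi>_def by blast
    qed
    then have "Q \<subseteq> F ` (\<lambda>d. Omega M (\<eta> d)) ` \<Delta>" by (auto simp: Q_def)
    then show ?thesis using fin finite_subset by blast
  qed
  define S where "S x y = (\<Sum>b\<in>Q. b x y)" for x y
  have lB: "linear (\<lambda>x. b x y)" if "b \<in> Q" for b y
  proof -
    obtain \<phi> where \<phi>: "\<phi> \<in> P" "b = B \<phi>" using \<open>b \<in> Q\<close> by (auto simp: Q_def)
    have "linear (lin \<phi>)" by (rule affinityD[OF aff[OF \<phi>(1)]])
    then show ?thesis
      by (simp add: \<phi>(2) B_def linear_iff inner_add_left)
  qed
  have S1: "linear (\<lambda>x. S x y)" for y unfolding S_def by (intro linear_compose_sum ballI lB)
  have S2: "S x y = S y x" for x y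
    unfolding S_def by (intro sum.cong) (auto simp: Q_def B_def inner_commute)
  \<comment> \<open>The summand of the identity is the standard product, and the others are
    nonnegative on the diagonal.\<close>
  have S3: "S x x > 0" if "x \<noteq> 0" for x
  proof -
    have "B id x x \<le> S x x"
      unfolding S_def using idP finQ
      by (intro member_le_sum[of "B id" Q "\<lambda>b. b x x"]) (auto simp: Q_def, simp add: B_def)
    moreover have "B id x x > 0" using that by (simp add: B_def)
    ultimately show ?thesis by simp
  qed
  have inv: "S (lin \<phi> x) (lin \<phi> y) = S x y" if \<phi>: "\<phi> \<in> P" for \<phi> x y
  proof -
    \<comment> \<open>Precomposition with \<open>lin \<phi>\<close> sends \<open>B \<psi>\<close> to
      \<open>B (\<psi> \<circ> \<phi>)\<close>; it thus permutes the finite set \<open>Q\<close>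
      over which \<open>S\<close> sums.\<close>
    let ?t = "\<lambda>b x y. b (lin \<phi> x) (lin \<phi> y)"
    have bl: "bij (lin \<phi>)" by (rule bij_lin[OF aff[OF \<phi>]])
    have inj: "inj_on ?t Q"
    proof (rule inj_onI)
      fix b b' :: "'a \<Rightarrow> 'a \<Rightarrow> real" assume eq: "?t b = ?t b'"
      have "b x y = b' x y" for x y
        using fun_cong[OF fun_cong[OF eq, of "finv (lin \<phi>) x"], of "finv (lin \<phi>) y"] bl by simp
      then show "b = b'" by blast
    qed
    have "?t ` Q \<subseteq> Q"
    proof clarify
      fix b assume "b \<in> Q"
      then obtain \<psi> where \<psi>: "\<psi> \<in> P" "b = B \<psi>" by (auto simp: Q_def)
      have "?t b = B (\<psi> \<circ> \<phi>)" by (simp add: \<psi>(2) B_def lin_comp[OF aff[OF \<psi>(1)]])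
      then show "?t b \<in> Q" using Pcomp[OF \<psi>(1) \<phi>] by (simp add: Q_def)
    qed
    then have img: "?t ` Q = Q" by (rule endo_inj_surj[OF finQ _ inj])
    have "S x y = (\<Sum>b\<in>?t ` Q. b x y)" by (simp add: img S_def)
    also have "\<dots> = S (lin \<phi> x) (lin \<phi> y)" unfolding sum.reindex[OF inj] by (simp add: S_def)
    finally show ?thesis by simp
  qed
  obtain C :: "'a \<Rightarrow> 'a" where C: "linear C" "bij C" and CS: "\<And>x y. C x \<bullet> C y = S x y"
    by (rule inner_product_coordinates[OF S1 S2 S3], assumption) (rule that)
  show thesis
  proof (rule that[OF C])
    fix \<phi> d x assume "map_prod \<phi> d \<in> lifts \<eta>"
    then have "\<phi> \<in> P" using P by blast
    then show "norm (C (lin \<phi> x)) = norm (C x)" by (simp add: norm_eq CS inv)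
  qed
qed

end

section \<open>Realizations as space groups\<close>

text \<open>An unconditional composition, in contrast to \<open>conj_by Maps\<close>, with which it
  agrees on bijections.\<close>

definition conjg :: "('b \<Rightarrow> 'b) \<Rightarrow> ('b \<Rightarrow> 'b) \<Rightarrow> ('b \<Rightarrow> 'b)"
  where "conjg c g = c \<circ> g \<circ> finv c"

lemma conjg_app [simp]: "bij c \<Longrightarrow> conjg c g (c x) = c (g x)"
  by (simp add: conjg_def)

lemma conjg_comp: "bij c \<Longrightarrow> conjg c (g \<circ> h) = conjg c g \<circ> conjg c h"
  by (simp add: conjg_def fun_eq_iff)

lemma conjg_id [simp]: "bij c \<Longrightarrow> conjg c id = id"
  by (simp add: conjg_def finv_comp)

lemma bij_conjg: "bij c \<Longrightarrow> bij g \<Longrightarrow> bij (conjg c g)"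
  by (simp add: conjg_def bij_comp)

lemma conjg_finv: "bij c \<Longrightarrow> bij g \<Longrightarrow> finv (conjg c g) = conjg c (finv g)"
  by (simp add: conjg_def finv_comp_dist bij_comp comp_assoc)

lemma conjg_conjg: "bij c \<Longrightarrow> bij d \<Longrightarrow> conjg c (conjg d g) = conjg (c \<circ> d) g"
  by (simp add: conjg_def finv_comp_dist comp_assoc)

lemma conjg_inverse [simp]: "bij c \<Longrightarrow> conjg (finv c) (conjg c g) = g" "bij c \<Longrightarrow> conjg c (conjg (finv c) g) = g"
  by (simp_all add: conjg_conjg finv_comp) (simp_all add: conjg_def)

lemma conjg_inject [simp]: "bij c \<Longrightarrow> conjg c g = conjg c h \<longleftrightarrow> g = h"
  by (metis conjg_inverse(1))

lemma conjg_map_prod: "bij a \<Longrightarrow> bij b \<Longrightarrow> conjg (map_prod a b) (map_prod f g) = map_prod (conjg a f) (conjg b g)"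
  by (simp add: conjg_def finv_map_prod map_prod_comp)

lemma conj_by_Maps_image: "bij c \<Longrightarrow> bij_group G \<Longrightarrow> conj_by Maps c ` G = conjg c ` G"
  by (intro image_cong) (simp_all add: conj_by_Maps bij_groupD(1) conjg_def)

lemma bij_group_conjg:
  assumes c: "bij c" and G: "bij_group G"
  shows "bij_group (conjg c ` G)"
  unfolding bij_group_def
proof (intro conjI ballI)
  show "id \<in> conjg c ` G" using bij_groupD(2)[OF G] conjg_id[OF c] by (metis imageI)
  fix x assume "x \<in> conjg c ` G"
  then obtain g where g: "g \<in> G" "x = conjg c g" by blast
  show "bij x" using g c bij_groupD(1)[OF G] by (simp add: bij_conjg)
  show "finv x \<in> conjg c ` G" using g c bij_groupD(1,4)[OF G] by (simp add: conjg_finv)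
  fix y assume "y \<in> conjg c ` G"
  then obtain h where h: "h \<in> G" "y = conjg c h" by blast
  show "x \<circ> y \<in> conjg c ` G"
    using g h c bij_groupD(3)[OF G] by (simp add: conjg_comp[symmetric])
qed

lemma iso_grp_iff:
  assumes "bij_group G" "bij_group H"
  shows "f \<in> iso (grp G) (grp H) \<longleftrightarrow> bij_betw f G H \<and> (\<forall>g\<in>G. \<forall>h\<in>G. f (g \<circ> h) = f g \<circ> f h)"
proof -
  have "f (g \<otimes>\<^bsub>grp G\<^esub> h) = f g \<otimes>\<^bsub>grp H\<^esub> f h \<longleftrightarrow> f (g \<circ> h) = f g \<circ> f h"
    if "g \<in> G" "h \<in> G" "f g \<in> H" "f h \<in> H" for g h
    using that assms by (simp add: mult_Maps bij_groupD(1))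
  then show ?thesis
    by (auto simp: iso_def hom_def Pi_iff dest: bij_betwE)
qed

lemma conjg_iso:
  assumes "bij c" "bij_group G"
  shows "conjg c \<in> iso (grp G) (grp (conjg c ` G))"
  using assms by (simp add: iso_grp_iff bij_group_conjg conjg_comp bij_betw_def inj_on_def)

text \<open>By homogeneity, discreteness has to be checked at the identity only: h near g on the
  points g^-1 x means that h g^-1 is near the identity on the points x.\<close>

lemma space_groupI_id:
  fixes G :: "('a::euclidean_space \<Rightarrow> 'a) set"
  assumes G: "bij_group G" "\<And>g. g \<in> G \<Longrightarrow> g \<in> isometries"
    and X: "finite X" "e > 0" "\<And>h. h \<in> G \<Longrightarrow> (\<And>x. x \<in> X \<Longrightarrow> dist (h x) x < e) \<Longrightarrow> h = id"
    and K: "compact K" "\<And>x. \<exists>g\<in>G. g x \<in> K"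
  shows "space_group G"
proof (rule space_groupI[OF G _ K])
  fix g assume g: "g \<in> G"
  have b: "bij g" using G(1) g by (rule bij_groupD)
  have "h = g" if h: "h \<in> G" "\<forall>x\<in>finv g ` X. dist (h x) (g x) < e" for h
  proof -
    have "h \<circ> finv g = id"
    proof (rule X(3))
      show "h \<circ> finv g \<in> G" using G(1) g h(1) by (simp add: bij_groupD)
      show "dist ((h \<circ> finv g) x) x < e" if "x \<in> X" for x using h(2) that b by force
    qed
    then have "h \<circ> (finv g \<circ> g) = id \<circ> g" by (metis comp_assoc)
    then show ?thesis using b by (simp add: finv_comp)
  qed
  then show "\<exists>X e. finite X \<and> e > 0 \<and> (\<forall>h\<in>G. (\<forall>x\<in>X. dist (h x) (g x) < e) \<longrightarrow> h = g)"
    using X(1,2) by (intro exI[of _ "finv g ` X"] exI[of _ e]) blast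
qed

lemma space_group_discrete_id:
  fixes G :: "('a::euclidean_space \<Rightarrow> 'a) set"
  assumes G: "space_group G"
  obtains X e where "finite X" "e > 0" "\<forall>h\<in>G. (\<forall>x\<in>X. dist (h x) x < e) \<longrightarrow> h = id"
proof -
  have "discrete G" using G by (simp add: space_group_def)
  then obtain X e where "finite X" "e > 0" "\<forall>h\<in>G. (\<forall>x\<in>X. dist (h x) (id x) < e) \<longrightarrow> h = id"
    using space_groupD(5)[OF G] unfolding discrete_fun_iff by metis
  then show thesis using that[of X e] by simp
qed

text \<open>\<open>c\<close> may distort distances. Its inverse is Lipschitz with constant
  \<open>B\<close>, so discreteness survives with radius \<open>e / B\<close>; the image under
  \<open>c\<close> of a compact set meeting all orbits meets all new orbits.\<close>

lemma space_group_conjg: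
  fixes G :: "('a::euclidean_space \<Rightarrow> 'a) set"
  assumes G: "space_group G" and c: "c \<in> affinities" and iso: "\<And>g. g \<in> G \<Longrightarrow> conjg c g \<in> isometries"
  shows "space_group (conjg c ` G)"
proof -
  have b: "bij c" by (rule affinityD(2)[OF c])
  obtain X e where X: "finite X" "e > 0" "\<forall>h\<in>G. (\<forall>x\<in>X. dist (h x) x < e) \<longrightarrow> h = id"
    by (rule space_group_discrete_id[OF G])
  obtain R where R: "\<And>x. \<exists>g\<in>G. norm (g x) \<le> R" using space_group_cobounded[OF G] by metis
  have ci: "finv c \<in> affinities" by (rule affinities_finv[OF c])
  obtain B where B: "B > 0" "\<And>x. norm (lin (finv c) x) \<le> B * norm x"
    using linear_bounded_pos[OF affinityD(1)[OF ci]] by metis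
  have lip: "dist (finv c x) (finv c y) \<le> B * dist x y" for x y
    using affinityD(3)[OF ci, of y "x - y"] B(2)[of "x - y"] by (simp add: dist_norm)
  show ?thesis
  proof (rule space_groupI_id[where X = "c ` X" and e = "e / B" and K = "c ` cball 0 R"])
    show "bij_group (conjg c ` G)" by (rule bij_group_conjg[OF b space_groupD(1)[OF G]])
    show "finite (c ` X)" "e / B > 0" using X(1,2) B(1) by simp_all
    show "g \<in> isometries" if "g \<in> conjg c ` G" for g using that iso by blast
    show "compact (c ` cball 0 R)"
      by (intro compact_continuous_image affinity_continuous c compact_cball)
    show "\<exists>g\<in>conjg c ` G. g x \<in> c ` cball 0 R" for x
    proof -
      obtain g where g: "g \<in> G" "norm (g (finv c x)) \<le> R" using R by blast
      then have "conjg c g x \<in> c ` cball 0 R" by (simp add: conjg_def)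
      then show ?thesis using g(1) by blast
    qed
    fix h assume "h \<in> conjg c ` G" and h: "\<And>x. x \<in> c ` X \<Longrightarrow> dist (h x) x < e / B"
    then obtain g where g: "g \<in> G" "h = conjg c g" by blast
    have "g = id"
    proof (rule X(3)[rule_format, OF g(1)])
      fix x assume "x \<in> X"
      then have "dist (c (g x)) (c x) < e / B" using h[of "c x"] b g(2) by simp
      then show "dist (g x) x < e"
        using lip[of "c (g x)" "c x"] b B(1) by (simp add: field_simps)
    qed
    then show "h = id" using b g(2) by simp
  qed
qed

lemma ext_conjg: "bij c \<Longrightarrow> conjg (map_prod c id) ` ext G = ext (conjg c ` G)"
  by (simp add: ext_def image_image conjg_map_prod)

lemma bij_group_ext: "bij_group G \<Longrightarrow> bij_group (ext G)"
  unfolding bij_group_def ext_def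
  by (auto simp: bij_map_prod map_prod_comp finv_map_prod image_iff map_prod_inject prod.map_id0
      intro!: exI bexI[of _ id])

context orbifold_extension
begin

lemma NM_conjg_image:
  assumes \<alpha>: "\<alpha> \<in> NM"
  shows "conjg \<alpha> ` M = M"
proof
  show "conjg \<alpha> ` M \<subseteq> M" using NM_conj(1)[OF \<alpha>] by (auto simp: conjg_def)
  show "M \<subseteq> conjg \<alpha> ` M"
  proof
    fix m assume "m \<in> M"
    then have "conjg (finv \<alpha>) m \<in> M" using NM_conj(1)[OF NM_finv[OF \<alpha>]] by (simp add: conjg_def)
    then show "m \<in> conjg \<alpha> ` M" using conjg_inverse(2)[OF NM_bij[OF \<alpha>], of m] by (metis imageI)
  qed
qed

text \<open>All lifts are included, also those of the identity. Hence conjugation by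
  \<open>C\<close> turns \<open>M\<close> as well as the first components of all other lifts into
  isometries.\<close>

definition rotates :: "((real \<Rightarrow> real) \<Rightarrow> 'a set \<Rightarrow> 'a set) \<Rightarrow> ('a \<Rightarrow> 'a) \<Rightarrow> bool"
  where "rotates \<eta> C \<longleftrightarrow> linear C \<and> bij C \<and>
    (\<forall>\<phi> d x. map_prod \<phi> d \<in> lifts \<eta> \<longrightarrow> norm (C (lin \<phi> x)) = norm (C x))"

lemma linear_affinity:
  assumes "linear C" "bij C"
  shows "C \<in> affinities" "lin C = C"
  using assms by (simp_all add: affinities_iff lin_def linear_0)

lemma rotates_isometry:
  assumes \<eta>: "rotates \<eta> C" and g: "map_prod \<phi> d \<in> lifts \<eta>"
  shows "conjg C \<phi> \<in> isometries"
proof -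
  have C: "linear C" "bij C" using \<eta> by (simp_all add: rotates_def)
  note aC = linear_affinity[OF C]
  have a\<phi>: "\<phi> \<in> affinities" using g by (simp add: map_prod_lifts NM_aff)
  have "conjg C \<phi> \<in> affinities" unfolding conjg_def by (intro affinities_comp affinities_finv aC a\<phi>)
  moreover have "lin (conjg C \<phi>) = C \<circ> lin \<phi> \<circ> finv C"
    unfolding conjg_def using aC a\<phi> by (simp add: lin_comp affinities_comp lin_finv)
  moreover have "norm (C (lin \<phi> (finv C x))) = norm x" for x
    using \<eta> g C(2) unfolding rotates_def by (metis finv_app(2))
  ultimately show ?thesis
    using affinityD(1)[of "conjg C \<phi>"] by (simp add: isometries_iff orthogonal_transformation)
qed

lemma space_group_cnj_M:
  assumes \<eta>: "hom_to_Aff \<eta>" "rotates \<eta> C"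
  shows "space_group (conjg C ` M)"
proof (rule space_group_conjg[OF M])
  show "C \<in> affinities" using \<eta>(2) linear_affinity(1)[of C] by (simp add: rotates_def)
  show "conjg C m \<in> isometries" if "m \<in> M" for m
    using rotates_isometry[OF \<eta>(2), of m id] lifts_id[OF \<eta>(1)] that by simp
qed

abbreviation realization :: "((real \<Rightarrow> real) \<Rightarrow> 'a set \<Rightarrow> 'a set) \<Rightarrow> ('a \<Rightarrow> 'a) \<Rightarrow> ('a \<times> real \<Rightarrow> 'a \<times> real) set"
  where "realization \<eta> C \<equiv> conjg (map_prod C id) ` lifts \<eta>"

lemma realizationE:
  assumes "bij C" "\<gamma> \<in> realization \<eta> C"
  obtains \<phi> d where "\<gamma> = map_prod (conjg C \<phi>) d" "map_prod \<phi> d \<in> lifts \<eta>"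
proof -
  obtain g where g: "g \<in> lifts \<eta>" "\<gamma> = conjg (map_prod C id) g" using assms(2) by blast
  obtain \<phi> d where "g = map_prod \<phi> d" using g(1) by (rule liftsE)
  then show thesis using that g assms(1) by (simp add: conjg_map_prod) (simp add: conjg_def)
qed

lemma realizationI:
  assumes "bij C" "map_prod \<phi> d \<in> lifts \<eta>"
  shows "map_prod (conjg C \<phi>) d \<in> realization \<eta> C"
  using assms by (intro image_eqI[of _ _ "map_prod \<phi> d"]) (simp_all add: conjg_map_prod, simp add: conjg_def)

lemma bij_group_realization: "hom_to_Aff \<eta> \<Longrightarrow> bij C \<Longrightarrow> bij_group (realization \<eta> C)"
  by (intro bij_group_conjg bij_group_lifts bij_map_prod) auto

text \<open>Both properties are assembled from base and fibre. For compactness, a lift bounds the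
  second coordinate and then an element of the conjugate of \<open>M\<close>, which does not touch
  that coordinate, bounds the first. For discreteness, the points (0, t) force the second component
  to be the identity, after which the first lies in the conjugate of \<open>M\<close> and is tested
  on the points (x, 0).\<close>

lemma space_group_realization:
  assumes \<eta>: "hom_to_Aff \<eta>" "rotates \<eta> C"
  shows "space_group (realization \<eta> C)"
proof -
  have C: "linear C" "bij C" using \<eta>(2) by (simp_all add: rotates_def)
  have M': "space_group (conjg C ` M)" by (rule space_group_cnj_M[OF \<eta>])
  obtain X1 e1 where X1: "finite X1" "e1 > 0"
    "\<forall>h\<in>\<Delta>. (\<forall>x\<in>X1. dist (h x) x < e1) \<longrightarrow> h = id"
    by (rule space_group_discrete_id[OF D])
  obtain X2 e2 where X2: "finite X2" "e2 > 0"
    "\<forall>h\<in>conjg C ` M. (\<forall>x\<in>X2. dist (h x) x < e2) \<longrightarrow> h = id"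
    by (rule space_group_discrete_id[OF M'])
  obtain R1 where R1: "\<And>x. \<exists>g\<in>\<Delta>. norm (g x) \<le> R1" using space_group_cobounded[OF D] by metis
  obtain R2 where R2: "\<And>x. \<exists>g\<in>conjg C ` M. norm (g x) \<le> R2" using space_group_cobounded[OF M'] by metis
  let ?X = "(\<lambda>x. (x, 0)) ` X2 \<union> (\<lambda>t. (0, t)) ` X1"
  show ?thesis
  proof (rule space_groupI_id[where X = ?X and e = "min e1 e2" and K = "cball 0 R2 \<times> cball 0 R1"])
    show "bij_group (realization \<eta> C)" by (rule bij_group_realization[OF \<eta>(1) C(2)])
    show "finite ?X" "min e1 e2 > 0" using X1 X2 by simp_all
    show "compact (cball 0 R2 \<times> cball 0 R1 :: ('a \<times> real) set)" by (intro compact_Times compact_cball)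
    show "g \<in> isometries" if "g \<in> realization \<eta> C" for g
      by (rule realizationE[OF C(2) that])
        (simp add: isometries_map_prod rotates_isometry[OF \<eta>(2)] space_groupD(2)[OF D] map_prod_lifts[THEN iffD1])
    show "\<exists>g\<in>realization \<eta> C. g p \<in> cball 0 R2 \<times> cball 0 R1" for p
    proof (cases p)
      case (Pair x t)
      obtain d where d: "d \<in> \<Delta>" "norm (d t) \<le> R1" using R1 by blast
      obtain \<phi> where \<phi>: "map_prod \<phi> d \<in> lifts \<eta>" by (rule lifts_surj[OF \<eta>(1) d(1)])
      obtain m where m: "m \<in> M" "norm (conjg C m (conjg C \<phi> x)) \<le> R2" using R2[of "conjg C \<phi> x"] by blast
      have "map_prod (conjg C (m \<circ> \<phi>)) d \<in> realization \<eta> C"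
        by (intro realizationI C lifts_M_comp \<phi> m)
      moreover have "map_prod (conjg C (m \<circ> \<phi>)) d p \<in> cball 0 R2 \<times> cball 0 R1"
        using m(2) d(2) C(2) by (simp add: Pair conjg_comp)
      ultimately show ?thesis by (intro bexI[of _ "map_prod (conjg C (m \<circ> \<phi>)) d"])
    qed
    fix \<gamma> assume \<gamma>: "\<gamma> \<in> realization \<eta> C" and near: "\<And>x. x \<in> ?X \<Longrightarrow> dist (\<gamma> x) x < min e1 e2"
    obtain \<phi> d where g: "\<gamma> = map_prod (conjg C \<phi>) d" "map_prod \<phi> d \<in> lifts \<eta>"
      by (rule realizationE[OF C(2) \<gamma>])
    have d: "d = id"
    proof (rule X1(3)[rule_format])
      show "d \<in> \<Delta>" using g(2) by (simp add: map_prod_lifts)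
      fix t assume "t \<in> X1"
      then have "dist (\<gamma> (0, t)) (0, t) < e1" using near[of "(0, t)"] by simp
      then show "dist (d t) t < e1"
        using dist_snd_le[of "\<gamma> (0, t)" "(0, t)"] by (simp add: g(1))
    qed
    have "conjg C \<phi> = id"
    proof (rule X2(3)[rule_format])
      show "conjg C \<phi> \<in> conjg C ` M" using g(2) d lifts_id[OF \<eta>(1)] by simp
      fix x assume "x \<in> X2"
      then have "dist (\<gamma> (x, 0)) (x, 0) < e2" using near[of "(x, 0)"] by simp
      then show "dist (conjg C \<phi> x) x < e2"
        using dist_fst_le[of "\<gamma> (x, 0)" "(x, 0)"] by (simp add: g(1))
    qed
    then show "\<gamma> = id" by (simp add: g(1) d prod.map_id0)
  qed
qed

section \<open>Existence and uniqueness of the pair for given coordinates\<close>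

lemma conjg_normalizer:
  assumes M': "space_group (conjg C ` M)" and C: "linear C" "bij C" and \<phi>: "bij \<phi>"
  shows "conjg C \<phi> \<in> affine_normalizer (conjg C ` M) \<longleftrightarrow> \<phi> \<in> NM"
proof -
  interpret O: orbifold "conjg C ` M" by unfold_locales (rule M')
  note aC = linear_affinity(1)[OF C]
  have "conjg C \<phi> \<in> affinities \<longleftrightarrow> \<phi> \<in> affinities"
  proof
    assume "conjg C \<phi> \<in> affinities"
    then have "conjg (finv C) (conjg C \<phi>) \<in> affinities"
      unfolding conjg_def[of "finv C"] by (intro affinities_comp affinities_finv aC)
    then show "\<phi> \<in> affinities" using C(2) by simp
  qed (simp add: conjg_def affinities_comp affinities_finv aC)
  moreover have "conjg C \<phi> \<circ> conjg C m \<circ> finv (conjg C \<phi>) = conjg C (\<phi> \<circ> m \<circ> finv \<phi>)"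
    "finv (conjg C \<phi>) \<circ> conjg C m \<circ> conjg C \<phi> = conjg C (finv \<phi> \<circ> m \<circ> \<phi>)" for m
    using C(2) \<phi> by (simp_all add: conjg_comp conjg_finv)
  ultimately show ?thesis
    using C(2) unfolding O.mem_normalizer mem_normalizer by (auto simp: image_iff)
qed

lemma star_C_orbit:
  assumes M': "space_group (conjg C ` M)" and C: "linear C" "bij C"
  shows "star M (conjg C ` M) C (orbit M x) = orbit (conjg C ` M) (C x)"
  using space_groupD(1)[OF M'] C(2)
  by (intro star_orbit subgroup_M) (simp_all add: subgroup_Maps_iff conj_by_Maps_image bij_group_M)

text \<open>\<open>sharp\<close> is defined through an inverse of \<open>star\<close>; as
  \<open>C\<close> induces an injective map on orbits, it amounts to conjugating a representative by
  \<open>C\<close>.\<close>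

lemma sharp_st:
  assumes M': "space_group (conjg C ` M)" and C: "linear C" "bij C" and \<phi>: "\<phi> \<in> NM"
  shows "sharp M (conjg C ` M) C (st \<phi>) = star (conjg C ` M) (conjg C ` M) (conjg C \<phi>)"
proof
  let ?M = "conjg C ` M"
  interpret O: orbifold ?M by unfold_locales (rule M')
  have N: "conjg C \<phi> \<in> affine_normalizer ?M" using conjg_normalizer[OF M' C NM_bij[OF \<phi>]] \<phi> by simp
  have inj: "inj_on (star M ?M C) (orbit_space M)"
  proof (rule inj_onI)
    fix X Y assume "X \<in> orbit_space M" "Y \<in> orbit_space M" and eq: "star M ?M C X = star M ?M C Y"
    then obtain x y where xy: "X = orbit M x" "Y = orbit M y" by (auto simp: orbit_space_def)
    have "C x \<in> orbit ?M (C y)" using eq by (simp add: xy star_C_orbit[OF M' C] O.orbit_mem)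
    then obtain m where "m \<in> M" "C x = C (m y)" using C(2) by (auto simp: orbit_def)
    then have "x \<in> orbit M y" using C(2) by (auto simp: orbit_def bij_def dest: injD)
    then show "X = Y" by (simp add: xy orbit_mem)
  qed
  fix Y
  show "sharp M ?M C (st \<phi>) Y = star ?M ?M (conjg C \<phi>) Y"
  proof (cases "Y \<in> orbit_space ?M")
    case True
    then obtain y where y: "Y = orbit ?M y" by (auto simp: orbit_space_def)
    define x where "x = finv C y"
    have Y: "Y = star M ?M C (orbit M x)" using C(2) by (simp add: y x_def star_C_orbit[OF M' C])
    have "inv_into (orbit_space M) (star M ?M C) Y = orbit M x"
      unfolding Y by (rule inv_into_f_f[OF inj orbit_in_space])
    then have "sharp M ?M C (st \<phi>) Y = orbit ?M (C (\<phi> x))"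
      using True by (simp add: sharp_def st_orbit[OF \<phi>] star_C_orbit[OF M' C])
    also have "\<dots> = star ?M ?M (conjg C \<phi>) Y"
      unfolding y O.st_orbit[OF N] by (simp add: x_def conjg_def)
    finally show ?thesis .
  qed (simp add: sharp_def star_def)
qed

text \<open>The first isomorphism theorem for \<open>snd_part\<close>: its kernel on the realization
  consists of the lifts of \<open>id\<close>, which are the elements of \<open>M\<close> by
  \<open>lifts_id\<close>.\<close>

lemma normal_ext_realization:
  assumes \<eta>: "hom_to_Aff \<eta>" and C: "bij C"
  shows "ext (conjg C ` M) \<lhd> grp (realization \<eta> C)" "grp (realization \<eta> C) Mod ext (conjg C ` M) \<cong> grp \<Delta>"
proof -
  let ?G = "grp (realization \<eta> C)"
  have bG: "bij_group (realization \<eta> C)" by (rule bij_group_realization[OF \<eta> C])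
  have snd: "snd_part \<gamma> \<in> \<Delta>" if \<gamma>: "\<gamma> \<in> realization \<eta> C" for \<gamma>
    by (rule realizationE[OF C \<gamma>]) (simp add: map_prod_lifts)
  interpret h: group_hom ?G "grp \<Delta>" snd_part
  proof (intro group_hom.intro group_hom_axioms.intro group_grp bG space_groupD(1)[OF D] homI)
    show "snd_part x \<in> carrier (grp \<Delta>)" if "x \<in> carrier ?G" for x using snd that by simp
    fix x y assume "x \<in> carrier ?G" "y \<in> carrier ?G"
    then have xy: "x \<in> realization \<eta> C" "y \<in> realization \<eta> C" by simp_all
    obtain \<phi> d where x: "x = map_prod (conjg C \<phi>) d" by (rule realizationE[OF C xy(1)])
    obtain \<psi> e where y: "y = map_prod (conjg C \<psi>) e" by (rule realizationE[OF C xy(2)])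
    have "x \<otimes>\<^bsub>?G\<^esub> y = x \<circ> y" by (rule mult_grp[OF bij_groupD(1)[OF bG xy(1)] bij_groupD(1)[OF bG xy(2)]])
    moreover have "snd_part x \<otimes>\<^bsub>grp \<Delta>\<^esub> snd_part y = snd_part x \<circ> snd_part y"
      using snd[OF xy(1)] snd[OF xy(2)] space_groupD(4)[OF D] by (simp add: mult_Maps)
    moreover have "snd_part (x \<circ> y) = snd_part x \<circ> snd_part y" by (simp add: x y map_prod_comp)
    ultimately show "snd_part (x \<otimes>\<^bsub>?G\<^esub> y) = snd_part x \<otimes>\<^bsub>grp \<Delta>\<^esub> snd_part y" by simp
  qed
  have ker: "kernel ?G (grp \<Delta>) snd_part = ext (conjg C ` M)"
  proof
    show "kernel ?G (grp \<Delta>) snd_part \<subseteq> ext (conjg C ` M)"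
    proof
      fix x assume "x \<in> kernel ?G (grp \<Delta>) snd_part"
      then have x: "x \<in> realization \<eta> C" "snd_part x = id" by (simp_all add: kernel_def)
      obtain \<phi> d where "x = map_prod (conjg C \<phi>) d" "map_prod \<phi> d \<in> lifts \<eta>" by (rule realizationE[OF C x(1)])
      then show "x \<in> ext (conjg C ` M)" using x(2) lifts_id[OF \<eta>] by (auto simp: map_prod_ext)
    qed
    show "ext (conjg C ` M) \<subseteq> kernel ?G (grp \<Delta>) snd_part"
    proof
      fix x assume "x \<in> ext (conjg C ` M)"
      then obtain m where m: "m \<in> M" "x = map_prod (conjg C m) id" by (auto simp: ext_def)
      then show "x \<in> kernel ?G (grp \<Delta>) snd_part"
        using realizationI[OF C, of m id \<eta>] lifts_id[OF \<eta>, of m] by (simp add: kernel_def)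
    qed
  qed
  show "ext (conjg C ` M) \<lhd> ?G" using h.normal_kernel by (simp add: ker)
  have "snd_part ` carrier ?G = carrier (grp \<Delta>)"
  proof
    show "carrier (grp \<Delta>) \<subseteq> snd_part ` carrier ?G"
    proof
      fix d assume "d \<in> carrier (grp \<Delta>)"
      then have d: "d \<in> \<Delta>" by simp
      obtain \<phi> where "map_prod \<phi> d \<in> lifts \<eta>" by (rule lifts_surj[OF \<eta> d])
      then have "map_prod (conjg C \<phi>) d \<in> realization \<eta> C" by (rule realizationI[OF C])
      then show "d \<in> snd_part ` carrier ?G" by (intro image_eqI[of _ _ "map_prod (conjg C \<phi>) d"]) simp_all
    qed
  qed (use snd in auto)
  from h.FactGroup_iso[OF this] show "?G Mod ext (conjg C ` M) \<cong> grp \<Delta>" by (simp add: ker)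
qed

lemma realizes_realization:
  assumes \<eta>: "hom_to_Aff \<eta>" "rotates \<eta> C"
  shows "realizes \<Delta> M \<eta> C (realization \<eta> C, ext (conjg C ` M))"
proof -
  have C: "linear C" "bij C" using \<eta>(2) by (simp_all add: rotates_def)
  have M': "space_group (conjg C ` M)" by (rule space_group_cnj_M[OF \<eta>])
  interpret O: orbifold "conjg C ` M" by unfold_locales (rule M')
  have "sharp M (conjg C ` M) C (\<eta> d) \<in> Isom (conjg C ` M)" if d: "d \<in> \<Delta>" for d
  proof -
    obtain \<phi> where \<phi>: "map_prod \<phi> d \<in> lifts \<eta>" by (rule lifts_surj[OF \<eta>(1) d])
    then have N: "\<phi> \<in> NM" "\<eta> d = st \<phi>" by (simp_all add: map_prod_lifts)
    show ?thesis
      unfolding N(2) sharp_st[OF M' C N(1)]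
      by (intro O.st_Isom rotates_isometry[OF \<eta>(2) \<phi>]) (simp add: conjg_normalizer[OF M' C NM_bij[OF N(1)]] N)
  qed
  moreover have "ext (conjg C ` M) = {\<gamma> \<in> realization \<eta> C. snd_part \<gamma> = id}"
  proof
    show "ext (conjg C ` M) \<subseteq> {\<gamma> \<in> realization \<eta> C. snd_part \<gamma> = id}"
      using realizationI[OF C(2), of _ id \<eta>] lifts_id[OF \<eta>(1)] by (auto simp: ext_def)
    show "{\<gamma> \<in> realization \<eta> C. snd_part \<gamma> = id} \<subseteq> ext (conjg C ` M)"
    proof clarify
      fix x assume x: "x \<in> lifts \<eta>" "snd_part (conjg (map_prod C id) x) = id"
      then have "conjg (map_prod C id) x \<in> realization \<eta> C" by blast
      then obtain \<phi> d where "conjg (map_prod C id) x = map_prod (conjg C \<phi>) d" "map_prod \<phi> d \<in> lifts \<eta>"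
        by (rule realizationE[OF C(2)])
      then show "conjg (map_prod C id) x \<in> ext (conjg C ` M)"
        using x(2) lifts_id[OF \<eta>(1)] by (auto simp: map_prod_ext)
    qed
  qed
  moreover have "\<gamma> = map_prod (fst_part \<gamma>) (snd_part \<gamma>)" "snd_part \<gamma> \<in> \<Delta>"
      "star (conjg C ` M) (conjg C ` M) (fst_part \<gamma>) = sharp M (conjg C ` M) C (\<eta> (snd_part \<gamma>))"
    if \<gamma>: "\<gamma> \<in> realization \<eta> C" for \<gamma>
  proof -
    obtain \<phi> d where g: "\<gamma> = map_prod (conjg C \<phi>) d" "map_prod \<phi> d \<in> lifts \<eta>"
      by (rule realizationE[OF C(2) \<gamma>])
    then have N: "\<phi> \<in> NM" "st \<phi> = \<eta> d" "d \<in> \<Delta>" by (simp_all add: map_prod_lifts)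
    show "\<gamma> = map_prod (fst_part \<gamma>) (snd_part \<gamma>)" "snd_part \<gamma> \<in> \<Delta>" using N by (simp_all add: g(1))
    show "star (conjg C ` M) (conjg C ` M) (fst_part \<gamma>) = sharp M (conjg C ` M) C (\<eta> (snd_part \<gamma>))"
      using sharp_st[OF M' C N(1)] by (simp add: g(1) N(2))
  qed
  moreover have "d \<in> snd_part ` realization \<eta> C" if d: "d \<in> \<Delta>" for d
  proof -
    obtain \<phi> where \<phi>: "map_prod \<phi> d \<in> lifts \<eta>" by (rule lifts_surj[OF \<eta>(1) d])
    show ?thesis
      by (rule image_eqI[OF _ realizationI[OF C(2) \<phi>]]) simp
  qed
  ultimately show ?thesis
    unfolding realizes_def Let_def prod.case conj_by_Maps_image[OF C(2) bij_group_M] ext_def[symmetric]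
    using C M' space_group_realization[OF \<eta>] normal_ext_realization(1)[OF \<eta>(1) C(2)]
    by (intro conjI) (auto simp del: map_prod_inject)
qed

text \<open>The first component of any element of \<Gamma> normalizes the conjugate of
  \<open>M\<close>, because the element normalizes \<open>N\<close>. The prescribed action on the
  orbit space then determines it up to a factor from that group, so \<Gamma> lies in the
  realization; equality holds since \<Gamma> contains \<open>N\<close> and maps onto
  \<Delta>.\<close>

lemma realizes_unique:
  assumes \<eta>: "hom_to_Aff \<eta>" and r: "realizes \<Delta> M \<eta> C (\<Gamma>, N)"
  shows "linear C" "bij C" "space_group \<Gamma>" "\<Gamma> = realization \<eta> C" "N = ext (conjg C ` M)"
proof -
  let ?M = "conjg C ` M"
  show C: "linear C" "bij C" using r by (auto simp: realizes_def Let_def)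
  have r: "space_group ?M" "N = ext ?M" "space_group \<Gamma>" "N \<lhd> grp \<Gamma>"
    "\<And>\<gamma>. \<gamma> \<in> \<Gamma> \<Longrightarrow> \<gamma> = map_prod (fst_part \<gamma>) (snd_part \<gamma>)" "N = {\<gamma> \<in> \<Gamma>. snd_part \<gamma> = id}"
    "snd_part ` \<Gamma> = \<Delta>"
    "\<And>\<gamma>. \<gamma> \<in> \<Gamma> \<Longrightarrow> star ?M ?M (fst_part \<gamma>) = sharp M ?M C (\<eta> (snd_part \<gamma>))"
    using r unfolding realizes_def Let_def prod.case conj_by_Maps_image[OF C(2) bij_group_M]
      ext_def[symmetric] by blast+
  show "space_group \<Gamma>" "N = ext ?M" by fact+
  note \<Gamma> = space_groupD[OF r(3)]
  interpret O: orbifold ?M by unfold_locales (rule r(1))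
  have sub: "\<exists>\<phi> d. \<gamma> = map_prod (conjg C \<phi>) d \<and> map_prod \<phi> d \<in> lifts \<eta>" if \<gamma>: "\<gamma> \<in> \<Gamma>" for \<gamma>
  proof -
    define a d where "a = fst_part \<gamma>" and "d = snd_part \<gamma>"
    have g: "\<gamma> = map_prod a d" using r(5)[OF \<gamma>] by (simp add: a_def d_def)
    have d: "d \<in> \<Delta>" using r(7) \<gamma> by (auto simp: d_def)
    have ai: "a \<in> isometries" using isometries_fst_part \<Gamma>(2)[OF \<gamma>] unfolding g .
    have ba: "bij a" by (rule isometries_bij[OF ai])
    have bd: "bij d" by (rule space_groupD(4)[OF D d])
    have cl: "\<gamma>' \<circ> n \<circ> finv \<gamma>' \<in> N" if "\<gamma>' \<in> \<Gamma>" "n \<in> N" for \<gamma>' n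
    proof -
      have "n \<in> \<Gamma>" using that(2) r(6) by blast
      then have "\<gamma>' \<otimes>\<^bsub>grp \<Gamma>\<^esub> n \<otimes>\<^bsub>grp \<Gamma>\<^esub> inv\<^bsub>grp \<Gamma>\<^esub> \<gamma>' = \<gamma>' \<circ> n \<circ> finv \<gamma>'"
        using conj_by_grp[OF \<Gamma>(1) that(1)] unfolding conj_by_def by simp
      then show ?thesis using normal.inv_op_closed2[OF r(4), of \<gamma>' n] that by simp
    qed
    have aN: "a \<in> affine_normalizer ?M"
      unfolding O.mem_normalizer
    proof (intro conjI ballI)
      show "a \<in> affinities" by (rule isometries_affinities[OF ai])
      fix m assume m: "m \<in> ?M"
      then have n: "map_prod m id \<in> N" by (simp add: r(2) map_prod_ext)
      show "a \<circ> m \<circ> finv a \<in> ?M"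
        using cl[OF \<gamma> n] ba bd unfolding g r(2)
        by (simp add: finv_map_prod map_prod_comp finv_comp map_prod_ext)
      show "finv a \<circ> m \<circ> a \<in> ?M"
        using cl[OF \<Gamma>(7)[OF \<gamma>] n] ba bd unfolding g r(2)
        by (simp add: finv_map_prod map_prod_comp finv_comp map_prod_ext)
    qed
    obtain \<phi> where \<phi>: "\<phi> \<in> NM" "\<eta> d = st \<phi>" by (rule hom_to_AffE[OF \<eta> d])
    have "star ?M ?M a = star ?M ?M (conjg C \<phi>)"
      using r(8)[OF \<gamma>] sharp_st[OF r(1) C \<phi>(1)] by (simp add: a_def[symmetric] d_def[symmetric] \<phi>(2))
    then obtain m' where m': "m' \<in> ?M" "a = m' \<circ> conjg C \<phi>"
      using O.st_eqE[OF _ aN] conjg_normalizer[OF r(1) C NM_bij[OF \<phi>(1)]] \<phi>(1) by blast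
    then obtain m where m: "m \<in> M" "m' = conjg C m" by blast
    have "\<gamma> = map_prod (conjg C (m \<circ> \<phi>)) d" by (simp add: g m'(2) m(2) conjg_comp C)
    moreover have "map_prod (m \<circ> \<phi>) d \<in> lifts \<eta>"
      using lifts_M_comp[OF _ m(1), of \<phi> d \<eta>] \<phi> d by (simp add: map_prod_lifts)
    ultimately show ?thesis by blast
  qed
  show "\<Gamma> = realization \<eta> C"
  proof
    show "\<Gamma> \<subseteq> realization \<eta> C" using sub realizationI[OF C(2)] by blast
    show "realization \<eta> C \<subseteq> \<Gamma>"
    proof
      fix x assume x: "x \<in> realization \<eta> C"
      obtain \<phi> d where g: "x = map_prod (conjg C \<phi>) d" "map_prod \<phi> d \<in> lifts \<eta>"
        by (rule realizationE[OF C(2) x])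
      have "d \<in> snd_part ` \<Gamma>" using g(2) by (simp add: map_prod_lifts r(7))
      then obtain \<gamma> where \<gamma>: "\<gamma> \<in> \<Gamma>" "d = snd_part \<gamma>" by blast
      obtain \<psi> e where h: "\<gamma> = map_prod (conjg C \<psi>) e" "map_prod \<psi> e \<in> lifts \<eta>" using sub[OF \<gamma>(1)] by blast
      have e: "e = d" using \<gamma>(2) by (simp add: h(1))
      obtain m where m: "m \<in> M" "\<phi> = m \<circ> \<psi>" using lifts_fiber[of \<psi> d \<eta> \<phi>] g(2) h(2) e by blast
      have "map_prod (conjg C m) id \<in> N" using m(1) by (simp add: r(2) map_prod_ext)
      then have "map_prod (conjg C m) id \<circ> \<gamma> \<in> \<Gamma>" using \<Gamma>(6) \<gamma>(1) r(6) by blast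
      then show "x \<in> \<Gamma>" by (simp add: g(1) h(1) e m(2) map_prod_comp conjg_comp C)
    qed
  qed
qed

end

section \<open>Injectivity criterion for the classifying map\<close>

lemma conjg_image_inverse: "bij c \<Longrightarrow> conjg (finv c) ` conjg c ` A = A"
  by (simp add: image_image)

lemma pair_iso_conjg:
  assumes "bij c" "bij d" "bij_group G" "bij_group H"
    and f: "f \<in> iso (grp G) (grp H)" "f ` A = B"
  shows "\<exists>f\<in>iso (grp (conjg c ` G)) (grp (conjg d ` H)). f ` (conjg c ` A) = conjg d ` B"
proof (rule bexI)
  have f: "bij_betw f G H" "\<And>g h. g \<in> G \<Longrightarrow> h \<in> G \<Longrightarrow> f (g \<circ> h) = f g \<circ> f h" "f ` A = B"
    using assms iso_grp_iff by blast+
  let ?f = "conjg d \<circ> f \<circ> conjg (finv c)"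
  show "?f ` (conjg c ` A) = conjg d ` B" using assms(1) by (simp add: image_image f(3)[symmetric])
  have "bij_betw (conjg (finv c)) (conjg c ` G) G"
    using assms(1) by (auto simp: bij_betw_def inj_on_def image_image)
  moreover have "bij_betw (conjg d) H (conjg d ` H)"
    using assms(2) by (auto simp: bij_betw_def inj_on_def)
  ultimately have "bij_betw ?f (conjg c ` G) (conjg d ` H)"
    using f(1) by (intro bij_betw_trans)
  then show "?f \<in> iso (grp (conjg c ` G)) (grp (conjg d ` H))"
    using assms f(2) by (auto simp: iso_grp_iff bij_group_conjg conjg_comp[symmetric])
qed

lemma pair_iso_conjg_iff:
  assumes "bij c" "bij d" "bij_group G" "bij_group H"
  shows "(\<exists>f\<in>iso (grp (conjg c ` G)) (grp (conjg d ` H)). f ` (conjg c ` A) = conjg d ` B) \<longleftrightarrow>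
    (\<exists>f\<in>iso (grp G) (grp H). f ` A = B)"
proof
  assume "\<exists>f\<in>iso (grp (conjg c ` G)) (grp (conjg d ` H)). f ` (conjg c ` A) = conjg d ` B"
  then obtain f where "f \<in> iso (grp (conjg c ` G)) (grp (conjg d ` H))" "f ` (conjg c ` A) = conjg d ` B"
    by blast
  from pair_iso_conjg[OF bij_finv[OF assms(1)] bij_finv[OF assms(2)]
      bij_group_conjg[OF assms(1,3)] bij_group_conjg[OF assms(2,4)] this]
  show "\<exists>f\<in>iso (grp G) (grp H). f ` A = B"
    unfolding conjg_image_inverse[OF assms(1)] conjg_image_inverse[OF assms(2)] .
qed (use pair_iso_conjg assms in blast)

lemma equiv_Iso_rel: "equiv (Iso_pairs \<Delta> M) (Iso_rel \<Delta> M)"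
proof (rule equivI)
  have grp: "group (grp \<Gamma>)" "N \<subseteq> \<Gamma>" if "(\<Gamma>, N) \<in> Iso_pairs \<Delta> M" for \<Gamma> N
    using that group_grp space_groupD(1) subgroup.subset[OF normal_imp_subgroup[of N "grp \<Gamma>"]]
    by (auto simp: Iso_pairs_def)
  show "Iso_rel \<Delta> M \<subseteq> Iso_pairs \<Delta> M \<times> Iso_pairs \<Delta> M" by (auto simp: Iso_rel_def)
  show "refl_on (Iso_pairs \<Delta> M) (Iso_rel \<Delta> M)"
    by (rule refl_onI) (auto simp: Iso_rel_def intro!: bexI[OF _ iso_set_refl])
  show "sym (Iso_rel \<Delta> M)"
  proof (rule symI)
    fix p q assume "(p, q) \<in> Iso_rel \<Delta> M"
    then obtain G N H K f where pq: "p = (G, N)" "q = (H, K)" "(G, N) \<in> Iso_pairs \<Delta> M" "(H, K) \<in> Iso_pairs \<Delta> M"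
      and f: "f \<in> iso (grp G) (grp H)" "f ` N = K" by (auto simp: Iso_rel_def)
    have inj: "inj_on f G" using f(1) by (auto simp: iso_def bij_betw_def)
    have "inv_into G f \<in> iso (grp H) (grp G)"
      using group.iso_set_sym[OF grp(1)[OF pq(3)] f(1)] by simp
    moreover have "inv_into G f ` K = N"
      unfolding f(2)[symmetric] by (rule inv_into_image_cancel[OF inj grp(2)[OF pq(3)]])
    ultimately show "(q, p) \<in> Iso_rel \<Delta> M" using pq by (auto simp: Iso_rel_def)
  qed
  show "trans (Iso_rel \<Delta> M)"
  proof (rule transI)
    fix p q r assume pq': "(p, q) \<in> Iso_rel \<Delta> M" and qr: "(q, r) \<in> Iso_rel \<Delta> M"
    from pq' obtain G N H K f where pq: "p = (G, N)" "q = (H, K)" "(G, N) \<in> Iso_pairs \<Delta> M"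
      and f: "f \<in> iso (grp G) (grp H)" "f ` N = K" by (auto simp: Iso_rel_def)
    obtain L P g where r: "r = (L, P)" "(L, P) \<in> Iso_pairs \<Delta> M"
      and g: "g \<in> iso (grp H) (grp L)" "g ` K = P" using qr unfolding pq(2) by (auto simp: Iso_rel_def)
    have "g \<circ> f \<in> iso (grp G) (grp L)" by (rule iso_set_trans[OF f(1) g(1)])
    moreover have "(g \<circ> f) ` N = P" by (simp only: image_comp[symmetric] f(2) g(2))
    ultimately have "\<exists>h\<in>iso (grp G) (grp L). h ` N = P" by (intro bexI[of _ "g \<circ> f"])
    then show "(p, r) \<in> Iso_rel \<Delta> M" using pq r by (simp add: Iso_rel_def)
  qed
qed

context orbifold_extension
begin

text \<open>Isomorphism of pairs in a form that is free of the coordinates \<open>C\<close>.\<close>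

definition lifts_iso :: "((real \<Rightarrow> real) \<Rightarrow> 'a set \<Rightarrow> 'a set) \<Rightarrow> ((real \<Rightarrow> real) \<Rightarrow> 'a set \<Rightarrow> 'a set) \<Rightarrow> bool"
  where "lifts_iso \<eta> \<eta>' \<longleftrightarrow> (\<exists>f\<in>iso (grp (lifts \<eta>)) (grp (lifts \<eta>')). f ` ext M = ext M)"

lemma realizes_Iso_pairs:
  assumes \<eta>: "hom_to_Aff \<eta>" and r: "realizes \<Delta> M \<eta> C (\<Gamma>, N)"
  shows "(\<Gamma>, N) \<in> Iso_pairs \<Delta> M"
proof -
  note u = realizes_unique[OF \<eta> r]
  have bM': "bij_group (conjg C ` M)" by (rule bij_group_conjg[OF u(2) bij_group_M])
  have "(\<lambda>m. map_prod m id) \<in> iso (grp (conjg C ` M)) (grp (ext (conjg C ` M)))"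
    unfolding iso_grp_iff[OF bM' bij_group_ext[OF bM']]
    by (auto simp: ext_def bij_betw_def inj_on_def map_prod_inject map_prod_comp)
  then have "(\<lambda>m. map_prod m id) \<circ> conjg C \<in> iso (grp M) (grp (ext (conjg C ` M)))"
    by (rule iso_set_trans[OF conjg_iso[OF u(2) bij_group_M]])
  then have "grp M \<cong> grp (ext (conjg C ` M))" by (rule is_isoI)
  then have "grp (ext (conjg C ` M)) \<cong> grp M"
    by (rule group.iso_sym[OF group_grp[OF bij_group_M]])
  then show ?thesis
    using u normal_ext_realization[OF \<eta> u(2)] by (simp add: Iso_pairs_def)
qed

text \<open>Each realization is conjugate to its group of lifts, so isomorphisms can be transported
  back and forth even when \<open>C\<close> and \<open>C'\<close> differ.\<close>

lemma Iso_class_eq_iff: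
  assumes \<eta>: "hom_to_Aff \<eta>" "realizes \<Delta> M \<eta> C p" and \<eta>': "hom_to_Aff \<eta>'" "realizes \<Delta> M \<eta>' C' p'"
  shows "Iso_class \<Delta> M p = Iso_class \<Delta> M p' \<longleftrightarrow> lifts_iso \<eta> \<eta>'"
proof -
  obtain \<Gamma> N \<Gamma>' N' where p: "p = (\<Gamma>, N)" "p' = (\<Gamma>', N')" by (metis surj_pair)
  note u = realizes_unique[OF \<eta>(1) \<eta>(2)[unfolded p(1)]] and u' = realizes_unique[OF \<eta>'(1) \<eta>'(2)[unfolded p(2)]]
  have P: "p \<in> Iso_pairs \<Delta> M" "p' \<in> Iso_pairs \<Delta> M"
    using realizes_Iso_pairs[OF \<eta>(1)] realizes_Iso_pairs[OF \<eta>'(1)] \<eta>(2) \<eta>'(2) p by blast+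
  have b: "bij (map_prod C id :: 'a \<times> real \<Rightarrow> _)" "bij (map_prod C' id :: 'a \<times> real \<Rightarrow> _)"
    using u(2) u'(2) by (simp_all add: bij_map_prod)
  have "Iso_class \<Delta> M p = Iso_class \<Delta> M p' \<longleftrightarrow> (p, p') \<in> Iso_rel \<Delta> M"
    unfolding Iso_class_def by (rule eq_equiv_class_iff[OF equiv_Iso_rel P])
  also have "\<dots> \<longleftrightarrow> (\<exists>f\<in>iso (grp (realization \<eta> C)) (grp (realization \<eta>' C')).
      f ` (conjg (map_prod C id) ` ext M) = conjg (map_prod C' id) ` ext M)"
    unfolding ext_conjg[OF u(2)] ext_conjg[OF u'(2)] u(4)[symmetric] u(5)[symmetric] u'(4)[symmetric] u'(5)[symmetric]
    using P unfolding p by (simp add: Iso_rel_def)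
  also have "\<dots> \<longleftrightarrow> lifts_iso \<eta> \<eta>'"
    unfolding lifts_iso_def by (rule pair_iso_conjg_iff[OF b bij_group_lifts[OF \<eta>(1)] bij_group_lifts[OF \<eta>'(1)]])
  finally show ?thesis .
qed

lemma Hom_f_iff: "\<eta> \<in> Hom_f \<Delta> M \<longleftrightarrow>
    hom_to_Aff \<eta> \<and> \<eta> \<in> extensional \<Delta> \<and> finite ((\<lambda>d. Omega M (\<eta> d)) ` \<Delta>)"
  by (auto simp: Hom_f_def hom_to_Aff_iff)

lemma ex_realizes:
  assumes "\<eta> \<in> Hom_f \<Delta> M"
  obtains C p where "realizes \<Delta> M \<eta> C p" "rotates \<eta> C"
proof -
  have \<eta>: "hom_to_Aff \<eta>" "finite ((\<lambda>d. Omega M (\<eta> d)) ` \<Delta>)" using assms by (simp_all add: Hom_f_iff)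
  obtain C :: "'a \<Rightarrow> 'a" where C: "linear C" "bij C"
    "\<And>\<phi> d x. map_prod \<phi> d \<in> lifts \<eta> \<Longrightarrow> norm (C (lin \<phi> x)) = norm (C x)"
    by (rule invariant_coordinates[OF \<eta>]) (rule that)
  then have r: "rotates \<eta> C" by (simp add: rotates_def)
  show thesis by (rule that[OF realizes_realization[OF \<eta>(1) r] r])
qed

text \<open>The \<open>Aff M\<close>-orbit of \<open>\<eta> \<circ> \<beta>\<close>.\<close>

definition twisted :: "((real \<Rightarrow> real) \<Rightarrow> 'a set \<Rightarrow> 'a set) \<Rightarrow> ((real \<Rightarrow> real) \<Rightarrow> (real \<Rightarrow> real)) \<Rightarrow>
    ((real \<Rightarrow> real) \<Rightarrow> 'a set \<Rightarrow> 'a set) set"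
  where "twisted \<eta> \<beta> = (\<lambda>a. \<lambda>d\<in>\<Delta>. conj_by (Aff M) a (\<eta> (\<beta> d))) ` carrier (Aff M)"

section \<open>Precomposition with automorphisms and well-definedness of psi\<close>

lemma autoD:
  assumes "\<beta> \<in> auto (grp \<Delta>)"
  shows "bij_betw \<beta> \<Delta> \<Delta>" "\<beta> \<in> Bij \<Delta>" "d \<in> \<Delta> \<Longrightarrow> \<beta> d \<in> \<Delta>"
    "d \<in> \<Delta> \<Longrightarrow> e \<in> \<Delta> \<Longrightarrow> \<beta> (d \<circ> e) = \<beta> d \<circ> \<beta> e"
proof -
  show b: "bij_betw \<beta> \<Delta> \<Delta>" "\<beta> \<in> Bij \<Delta>" using assms by (auto simp: auto_def Bij_def)
  show c: "d \<in> \<Delta> \<Longrightarrow> \<beta> d \<in> \<Delta>" for d using b by (auto simp: bij_betw_def)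
  show "\<beta> (d \<circ> e) = \<beta> d \<circ> \<beta> e" if "d \<in> \<Delta>" "e \<in> \<Delta>"
    using assms that c[OF that(1)] c[OF that(2)] space_groupD(4)[OF D]
    by (auto simp: auto_def hom_def mult_Maps)
qed

lemma compose_Aff_orbit:
  assumes "\<beta> \<in> auto (grp \<Delta>)"
  shows "(\<lambda>\<zeta>. compose \<Delta> \<zeta> \<beta>) ` Aff_orbit \<Delta> M \<eta> = twisted \<eta> \<beta>"
proof -
  have "compose \<Delta> (\<lambda>d\<in>\<Delta>. conj_by (Aff M) a (\<eta> d)) \<beta> = (\<lambda>d\<in>\<Delta>. conj_by (Aff M) a (\<eta> (\<beta> d)))" for a
    using autoD(3)[OF assms] by (auto simp: compose_def fun_eq_iff)
  then show ?thesis by (simp add: Aff_orbit_def twisted_def Setcompr_eq_image image_image)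
qed

lemma hom_conj:
  assumes \<eta>: "hom_to_Aff \<eta>" and "d \<in> \<Delta>" "e \<in> \<Delta>"
  shows "\<eta> (d \<circ> e \<circ> finv d) = conj_by (Aff M) (\<eta> d) (\<eta> e)"
proof -
  interpret group_hom "grp \<Delta>" "Aff M" \<eta>
    using \<eta> group_Aff group_grp[OF space_groupD(1)[OF D]]
    by (simp add: group_hom_def group_hom_axioms_def hom_to_Aff_iff)
  have "d \<in> carrier (grp \<Delta>)" "e \<in> carrier (grp \<Delta>)" using assms(2,3) by simp_all
  then have "\<eta> (conj_by (grp \<Delta>) d e) = conj_by (Aff M) (\<eta> d) (\<eta> e)"
    by (simp only: conj_by_def hom_mult hom_inv G.m_closed G.inv_closed)
  then show ?thesis using assms(2,3) by (simp add: conj_by_grp[OF space_groupD(1)[OF D]])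
qed

lemma twisted_inner:
  assumes \<eta>: "hom_to_Aff \<eta>" and \<beta>: "\<beta> \<in> auto (grp \<Delta>)" and d: "d \<in> \<Delta>"
    and \<beta>': "\<And>e. e \<in> \<Delta> \<Longrightarrow> \<beta>' e = d \<circ> \<beta> e \<circ> finv d"
  shows "twisted \<eta> \<beta>' = twisted \<eta> \<beta>"
proof -
  interpret A: group "Aff M" by (rule group_Aff)
  let ?t = "\<lambda>a. \<lambda>e\<in>\<Delta>. conj_by (Aff M) a (\<eta> (\<beta> e))"
  have car: "\<eta> e \<in> carrier (Aff M)" if "e \<in> \<Delta>" for e
    using hom_to_AffE[OF \<eta> that] by (metis carrier_Aff imageI)
  have "(\<lambda>e\<in>\<Delta>. conj_by (Aff M) a (\<eta> (\<beta>' e))) = ?t (a \<otimes>\<^bsub>Aff M\<^esub> \<eta> d)" if "a \<in> carrier (Aff M)" for a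
    using that car d by (auto simp: fun_eq_iff \<beta>' hom_conj[OF \<eta> d autoD(3)[OF \<beta>]] A.conj_by_conj_by autoD(3)[OF \<beta>])
  then have "twisted \<eta> \<beta>' = ?t ` (\<lambda>a. a \<otimes>\<^bsub>Aff M\<^esub> \<eta> d) ` carrier (Aff M)"
    unfolding twisted_def image_image by (intro image_cong refl)
  also have "(\<lambda>a. a \<otimes>\<^bsub>Aff M\<^esub> \<eta> d) ` carrier (Aff M) = carrier (Aff M)"
  proof
    show "carrier (Aff M) \<subseteq> (\<lambda>a. a \<otimes>\<^bsub>Aff M\<^esub> \<eta> d) ` carrier (Aff M)"
    proof
      fix a assume "a \<in> carrier (Aff M)"
      then show "a \<in> (\<lambda>a. a \<otimes>\<^bsub>Aff M\<^esub> \<eta> d) ` carrier (Aff M)"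
        using car[OF d] by (intro image_eqI[of _ _ "a \<otimes>\<^bsub>Aff M\<^esub> inv\<^bsub>Aff M\<^esub> \<eta> d"]) (simp_all add: A.m_assoc)
    qed
  qed (use car[OF d] in auto)
  finally show ?thesis unfolding twisted_def[of \<eta> \<beta>] .
qed

text \<open>By \<open>twisted_inner\<close> every automorphism in the coset yields the same orbit,
  so \<open>the_elem\<close> is applied to a singleton.\<close>

lemma Out_act_coset:
  assumes \<eta>: "hom_to_Aff \<eta>" and \<beta>: "\<beta> \<in> auto (grp \<Delta>)"
  shows "Out_act \<Delta> (Aff_orbit \<Delta> M \<eta>) (Inn (grp \<Delta>) #>\<^bsub>AutoGroup (grp \<Delta>)\<^esub> \<beta>) = twisted \<eta> \<beta>"
proof -
  let ?c = "Inn (grp \<Delta>) #>\<^bsub>AutoGroup (grp \<Delta>)\<^esub> \<beta>"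
  interpret G: group "grp \<Delta>" by (rule group_grp[OF space_groupD(1)[OF D]])
  interpret A: group "AutoGroup (grp \<Delta>)" by (rule G.AutoGroup)
  have car: "carrier (AutoGroup (grp \<Delta>)) = auto (grp \<Delta>)" by (simp add: AutoGroup_def)
  have "(\<lambda>\<zeta>. compose \<Delta> \<zeta> \<beta>') ` Aff_orbit \<Delta> M \<eta> = twisted \<eta> \<beta>" if "\<beta>' \<in> ?c" for \<beta>'
  proof -
    obtain i where i: "i \<in> Inn (grp \<Delta>)" "\<beta>' = i \<otimes>\<^bsub>AutoGroup (grp \<Delta>)\<^esub> \<beta>"
      using \<open>\<beta>' \<in> ?c\<close> by (auto simp: r_coset_def)
    have iA: "i \<in> auto (grp \<Delta>)" using subgroup.subset[OF G.Inn_subgroup] i(1) car by blast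
    obtain d where d: "d \<in> \<Delta>" "i = restrict (conj_by (grp \<Delta>) d) \<Delta>" using i(1) by (auto simp: Inn_def)
    have \<beta>': "\<beta>' \<in> auto (grp \<Delta>)" using A.m_closed iA \<beta> unfolding i(2) car by blast
    have "\<beta>' = compose \<Delta> i \<beta>"
      unfolding i(2) using mult_AutoGroup[of i "grp \<Delta>" \<beta>] autoD(2)[OF iA] autoD(2)[OF \<beta>] by simp
    then have "\<beta>' e = d \<circ> \<beta> e \<circ> finv d" if "e \<in> \<Delta>" for e
      using that d autoD(3)[OF \<beta> that] by (simp add: compose_def conj_by_grp[OF space_groupD(1)[OF D]])
    then show ?thesis unfolding compose_Aff_orbit[OF \<beta>'] by (rule twisted_inner[OF \<eta> \<beta> d(1)])
  qed
  moreover have "\<beta> \<in> ?c" using A.rcos_self[OF _ G.Inn_subgroup] \<beta> car by blast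
  ultimately have "(\<lambda>\<beta>'. (\<lambda>\<zeta>. compose \<Delta> \<zeta> \<beta>') ` Aff_orbit \<Delta> M \<eta>) ` ?c = {twisted \<eta> \<beta>}"
    by (intro equalityI image_subsetI subsetI) auto
  then show ?thesis by (simp add: Out_act_def)
qed

lemma Aff_class_eq_twisted: "hom_to_Aff \<eta> \<Longrightarrow> Aff_class \<Delta> M \<eta> = twisted \<eta> ` auto (grp \<Delta>)"
proof -
  assume \<eta>: "hom_to_Aff \<eta>"
  have car: "carrier (Out (grp \<Delta>)) =
      (\<lambda>\<beta>. Inn (grp \<Delta>) #>\<^bsub>AutoGroup (grp \<Delta>)\<^esub> \<beta>) ` auto (grp \<Delta>)"
    by (auto simp: Out_def FactGroup_def RCOSETS_def AutoGroup_def)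
  show ?thesis
    unfolding Aff_class_def car image_image by (intro image_cong refl Out_act_coset \<eta>)
qed

text \<open>The isomorphism conjugates first components by the inverse of \<alpha> and applies
  \<beta> to second components. It is written with \<open>fst_part\<close> and
  \<open>snd_part\<close> because it has to be a total function on maps of E^n.\<close>

lemma twist_lifts_iso:
  assumes \<eta>: "hom_to_Aff \<eta>" "hom_to_Aff \<eta>'" and \<alpha>: "\<alpha> \<in> NM" and \<beta>: "\<beta> \<in> auto (grp \<Delta>)"
    and eq: "\<And>d. d \<in> \<Delta> \<Longrightarrow> \<eta>' d = conj_by (Aff M) (st \<alpha>) (\<eta> (\<beta> d))"
  shows "lifts_iso \<eta>' \<eta>"
proof -
  have b\<alpha>: "bij \<alpha>" by (rule NM_bij[OF \<alpha>])
  define f where "f \<gamma> = map_prod (conjg (finv \<alpha>) (fst_part \<gamma>)) (\<beta> (snd_part \<gamma>))" for \<gamma> :: "'a \<times> real \<Rightarrow> 'a \<times> real"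
  have f: "f (map_prod \<phi> d) = map_prod (conjg (finv \<alpha>) \<phi>) (\<beta> d)" for \<phi> d by (simp add: f_def)
  have st_conjg: "st (conjg \<alpha> \<phi>) = conj_by (Aff M) (st \<alpha>) (st \<phi>)" if "\<phi> \<in> NM" for \<phi>
    using conj_st[OF \<alpha> that] by (simp add: conjg_def)
  have NMc: "conjg \<alpha> \<phi> \<in> NM" "conjg (finv \<alpha>) \<phi> \<in> NM" if "\<phi> \<in> NM" for \<phi>
    using that \<alpha> b\<alpha> by (simp_all add: conjg_def NM_comp NM_finv)
  have key: "map_prod (conjg \<alpha> \<psi>) d \<in> lifts \<eta>' \<longleftrightarrow> map_prod \<psi> (\<beta> d) \<in> lifts \<eta>"
    if d: "d \<in> \<Delta>" and \<psi>: "\<psi> \<in> NM" for \<psi> d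
  proof -
    obtain \<omega> where \<omega>: "\<omega> \<in> NM" "\<eta> (\<beta> d) = st \<omega>" by (rule hom_to_AffE[OF \<eta>(1) autoD(3)[OF \<beta> d]])
    have "st (conjg \<alpha> \<psi>) = \<eta>' d \<longleftrightarrow> st (conjg \<alpha> \<psi>) = st (conjg \<alpha> \<omega>)"
      by (simp add: eq[OF d] \<omega> st_conjg)
    also have "\<dots> \<longleftrightarrow> conjg \<alpha> (\<psi> \<circ> finv \<omega>) \<in> M"
      using st_eq_iff[OF NMc(1)[OF \<psi>] NMc(1)[OF \<omega>(1)]] b\<alpha> by (simp add: conjg_comp conjg_finv NM_bij[OF \<omega>(1)])
    also have "\<dots> \<longleftrightarrow> \<psi> \<circ> finv \<omega> \<in> M"
      using NM_conj(1)[OF \<alpha>] NM_conj(1)[OF NM_finv[OF \<alpha>]] conjg_inverse(1)[OF b\<alpha>]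
      by (metis conjg_def)
    also have "\<dots> \<longleftrightarrow> st \<psi> = \<eta> (\<beta> d)" unfolding \<omega>(2) by (rule st_eq_iff[OF \<psi> \<omega>(1), symmetric])
    finally show ?thesis using d \<psi> by (simp add: map_prod_lifts NMc autoD(3)[OF \<beta>])
  qed
  have "bij_betw f (lifts \<eta>') (lifts \<eta>)"
    unfolding bij_betw_def
  proof
    show "inj_on f (lifts \<eta>')"
    proof (rule inj_onI)
      fix g h assume g: "g \<in> lifts \<eta>'" and h: "h \<in> lifts \<eta>'" and e: "f g = f h"
      obtain \<phi> d where g': "g = map_prod \<phi> d" "d \<in> \<Delta>" using g by (rule liftsE)
      obtain \<psi> e where h': "h = map_prod \<psi> e" "e \<in> \<Delta>" using h by (rule liftsE)
      have "conjg (finv \<alpha>) \<phi> = conjg (finv \<alpha>) \<psi>" "\<beta> d = \<beta> e"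
        using e unfolding g'(1) h'(1) f map_prod_inject by blast+
      then have "\<phi> = \<psi>" "d = e"
        using conjg_inject[OF bij_finv[OF b\<alpha>]] inj_onD[OF bij_betw_imp_inj_on[OF autoD(1)[OF \<beta>]]]
          g'(2) h'(2) by blast+
      then show "g = h" by (simp add: g' h')
    qed
    show "f ` lifts \<eta>' = lifts \<eta>"
    proof
      show "f ` lifts \<eta>' \<subseteq> lifts \<eta>"
      proof clarify
        fix g assume "g \<in> lifts \<eta>'"
        then obtain \<phi> d where g: "g = map_prod \<phi> d" "d \<in> \<Delta>" "\<phi> \<in> NM" "st \<phi> = \<eta>' d" by (rule liftsE)
        then have "map_prod (conjg \<alpha> (conjg (finv \<alpha>) \<phi>)) d \<in> lifts \<eta>'" using b\<alpha> by (simp add: map_prod_lifts)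
        then show "f g \<in> lifts \<eta>" unfolding g(1) f by (simp add: key[OF g(2) NMc(2)[OF g(3)]])
      qed
      show "lifts \<eta> \<subseteq> f ` lifts \<eta>'"
      proof
        fix g assume gl: "g \<in> lifts \<eta>"
        then obtain \<phi> d where g: "g = map_prod \<phi> d" "d \<in> \<Delta>" "\<phi> \<in> NM" by (rule liftsE)
        have "d \<in> \<beta> ` \<Delta>" using bij_betw_imp_surj_on[OF autoD(1)[OF \<beta>]] g(2) by simp
        then obtain e where e: "e \<in> \<Delta>" "\<beta> e = d" by blast
        have "map_prod (conjg \<alpha> \<phi>) e \<in> lifts \<eta>'" using key[OF e(1) g(3)] gl by (simp add: g(1) e(2))
        moreover have "f (map_prod (conjg \<alpha> \<phi>) e) = g" using b\<alpha> by (simp add: f g(1) e(2))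
        ultimately show "g \<in> f ` lifts \<eta>'" by (metis imageI)
      qed
    qed
  qed
  moreover have "f (g \<circ> h) = f g \<circ> f h" if gh: "g \<in> lifts \<eta>'" "h \<in> lifts \<eta>'" for g h
  proof -
    obtain \<phi> d where g': "g = map_prod \<phi> d" "d \<in> \<Delta>" using gh(1) by (rule liftsE)
    obtain \<psi> e where h': "h = map_prod \<psi> e" "e \<in> \<Delta>" using gh(2) by (rule liftsE)
    show ?thesis
      using b\<alpha> g'(2) h'(2) by (simp add: g'(1) h'(1) map_prod_comp f conjg_comp autoD(4)[OF \<beta>])
  qed
  moreover have "f ` ext M = ext M"
  proof -
    have "\<beta> id \<circ> \<beta> id = \<beta> id"
      using autoD(4)[OF \<beta>, of id id] space_groupD(5)[OF D] by simp
    then have \<beta>id: "\<beta> id = id"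
      using space_groupD(4)[OF D autoD(3)[OF \<beta> space_groupD(5)[OF D]]]
      by (metis comp_assoc finv_comp(1) id_comp)
    have "conjg (finv \<alpha>) ` M = M" by (rule NM_conjg_image[OF NM_finv[OF \<alpha>]])
    moreover have "f ` ext M = ext (conjg (finv \<alpha>) ` M)"
      unfolding ext_def image_image f \<beta>id ..
    ultimately show ?thesis by simp
  qed
  ultimately show ?thesis
    unfolding lifts_iso_def iso_grp_iff[OF bij_group_lifts[OF \<eta>(2)] bij_group_lifts[OF \<eta>(1)]] Bex_def by blast
qed

text \<open>A class is a set of orbits, and \<eta>' lies in the orbit of its own class that belongs
  to the identity automorphism. Hence \<eta>' lies in some orbit
  \<open>twisted \<eta> \<beta>\<close> of the other class, which is the situation of
  \<open>twist_lifts_iso\<close>.\<close>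

lemma Aff_class_lifts_iso:
  assumes \<eta>: "\<eta> \<in> Hom_f \<Delta> M" "\<eta>' \<in> Hom_f \<Delta> M" and eq: "Aff_class \<Delta> M \<eta>' = Aff_class \<Delta> M \<eta>"
  shows "lifts_iso \<eta>' \<eta>"
proof -
  have h: "hom_to_Aff \<eta>" "hom_to_Aff \<eta>'" "\<eta>' \<in> extensional \<Delta>" using \<eta> by (simp_all add: Hom_f_iff)
  interpret A: group "Aff M" by (rule group_Aff)
  have id: "(\<lambda>d\<in>\<Delta>. d) \<in> auto (grp \<Delta>)"
    using group.id_in_auto[OF group_grp[OF space_groupD(1)[OF D]]] by simp
  have "conj_by (Aff M) \<one>\<^bsub>Aff M\<^esub> (\<eta>' d) = \<eta>' d" if d: "d \<in> \<Delta>" for d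
  proof -
    obtain \<phi> where \<phi>: "\<phi> \<in> NM" "\<eta>' d = st \<phi>" by (rule hom_to_AffE[OF h(2) d])
    then show ?thesis by (simp add: conj_by_def carrier_Aff)
  qed
  then have "\<eta>' = (\<lambda>d\<in>\<Delta>. conj_by (Aff M) \<one>\<^bsub>Aff M\<^esub> (\<eta>' ((\<lambda>d\<in>\<Delta>. d) d)))"
    using h(3) by (auto simp: fun_eq_iff extensional_def)
  then have "\<eta>' \<in> twisted \<eta>' (\<lambda>d\<in>\<Delta>. d)" unfolding twisted_def using A.one_closed by blast
  moreover have "twisted \<eta>' (\<lambda>d\<in>\<Delta>. d) \<in> twisted \<eta> ` auto (grp \<Delta>)"
    using eq id unfolding Aff_class_eq_twisted[OF h(1)] Aff_class_eq_twisted[OF h(2)] by blast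
  ultimately obtain \<beta> where \<beta>: "\<beta> \<in> auto (grp \<Delta>)" "\<eta>' \<in> twisted \<eta> \<beta>" by auto
  then obtain \<alpha> where \<alpha>: "\<alpha> \<in> NM" "\<eta>' = (\<lambda>d\<in>\<Delta>. conj_by (Aff M) (st \<alpha>) (\<eta> (\<beta> d)))"
    by (auto simp: twisted_def carrier_Aff)
  show ?thesis by (rule twist_lifts_iso[OF h(1,2) \<alpha>(1) \<beta>(1)]) (simp add: \<alpha>(2))
qed

text \<open>All choices of a homomorphism in the class and of coordinates give isomorphic pairs, so
  the set in the definition of \<open>psi\<close> has one element.\<close>

lemma psi_eq_Iso_class:
  assumes \<eta>: "\<eta> \<in> Hom_f \<Delta> M" and r: "realizes \<Delta> M \<eta> C p"
  shows "psi \<Delta> M (Aff_class \<Delta> M \<eta>) = Iso_class \<Delta> M p"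
proof -
  have "{Iso_class \<Delta> M p' | \<eta>' C' p'. \<eta>' \<in> Hom_f \<Delta> M \<and> Aff_class \<Delta> M \<eta>' = Aff_class \<Delta> M \<eta> \<and>
      realizes \<Delta> M \<eta>' C' p'} = {Iso_class \<Delta> M p}" (is "?S = _")
  proof
    show "{Iso_class \<Delta> M p} \<subseteq> ?S" using \<eta> r by blast
    show "?S \<subseteq> {Iso_class \<Delta> M p}"
    proof clarify
      fix \<eta>' C' \<Gamma>' N' assume \<eta>': "\<eta>' \<in> Hom_f \<Delta> M" "Aff_class \<Delta> M \<eta>' = Aff_class \<Delta> M \<eta>"
        "realizes \<Delta> M \<eta>' C' (\<Gamma>', N')"
      have h: "hom_to_Aff \<eta>" "hom_to_Aff \<eta>'" using \<eta> \<eta>'(1) by (simp_all add: Hom_f_iff)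
      show "Iso_class \<Delta> M (\<Gamma>', N') = Iso_class \<Delta> M p"
        unfolding Iso_class_eq_iff[OF h(2) \<eta>'(3) h(1) r] by (rule Aff_class_lifts_iso[OF \<eta> \<eta>'(1,2)])
    qed
  qed
  then show ?thesis by (simp add: psi_def)
qed

text \<open>After this point quotient sets and coordinates have disappeared; what remains is to
  decide when two groups of lifts are isomorphic relative to \<open>ext M\<close>.\<close>

theorem psi_eq_iff:
  assumes "\<eta> \<in> Hom_f \<Delta> M" "\<eta>' \<in> Hom_f \<Delta> M"
  shows "psi \<Delta> M (Aff_class \<Delta> M \<eta>) = psi \<Delta> M (Aff_class \<Delta> M \<eta>') \<longleftrightarrow> lifts_iso \<eta> \<eta>'"
proof -
  have h: "hom_to_Aff \<eta>" "hom_to_Aff \<eta>'" using assms by (simp_all add: Hom_f_iff)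
  obtain C p where p: "realizes \<Delta> M \<eta> C p" by (rule ex_realizes[OF assms(1)])
  obtain C' p' where p': "realizes \<Delta> M \<eta>' C' p'" by (rule ex_realizes[OF assms(2)])
  show ?thesis
    unfolding psi_eq_Iso_class[OF assms(1) p] psi_eq_Iso_class[OF assms(2) p']
    by (rule Iso_class_eq_iff[OF h(1) p h(2) p'])
qed

end

section \<open>The infinite dihedral group\<close>

definition mirror :: "int \<Rightarrow> real \<Rightarrow> real"
  where "mirror k = (\<lambda>x. of_int k - x)"

abbreviation (input) step :: "int \<Rightarrow> real \<Rightarrow> real"
  where "step k \<equiv> shift (of_int k)"

lemma delta_mirror: "\<delta>\<^sub>1 = mirror 0" "\<delta>\<^sub>2 = mirror 1"
  by (simp_all add: \<delta>\<^sub>1_def \<delta>\<^sub>2_def mirror_def)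

lemma mirror_comp:
  "mirror i \<circ> mirror j = step (i - j)" "step i \<circ> mirror j = mirror (i + j)"
  "mirror i \<circ> step j = mirror (i - j)" "step i \<circ> step j = step (i + j)"
  by (simp_all add: mirror_def fun_eq_iff)

lemma mirror_mirror [simp]: "mirror k (mirror k x) = x"
  by (simp add: mirror_def)

lemma bij_mirror [simp]: "bij (mirror k)"
  by (rule o_bij[of "mirror k"]) auto

lemma finv_mirror [simp]: "finv (mirror k) = mirror k"
  by (rule finv_eqI) auto

lemma step_inject: "step i = step j \<longleftrightarrow> i = j"
  by (simp add: shift_inject)

lemma mirror_neq_step: "mirror i \<noteq> step j"
proof
  assume eq: "mirror i = step j"
  show False using fun_cong[OF eq, of 0] fun_cong[OF eq, of 1] by (simp add: mirror_def)
qed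

lemma Dihedral_iff: "d \<in> Dihedral \<longleftrightarrow> (\<exists>k. d = step k) \<or> (\<exists>k. d = mirror k)"
proof -
  define H where "H = range step \<union> range mirror"
  have H: "bij_group H"
    unfolding bij_group_def
  proof (intro conjI ballI)
    have "step 0 \<in> H" unfolding H_def by blast
    then show "id \<in> H" by (simp add: id_def)
    have HE: "(\<exists>i. g = step i) \<or> (\<exists>i. g = mirror i)" if "g \<in> H" for g
      using that unfolding H_def by blast
    have HI: "step i \<in> H" "mirror i \<in> H" for i unfolding H_def by blast+
    fix g assume g: "g \<in> H"
    show "bij g" using HE[OF g] by auto
    show "finv g \<in> H"
      using HE[OF g]
    proof (elim disjE exE)
      fix i assume "g = step i"
      then have "finv g = step (- i)" by (simp add: finv_shift)
      then show ?thesis using HI by metis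
    next
      fix i assume "g = mirror i"
      then show ?thesis using HI by simp
    qed
    fix h assume h: "h \<in> H"
    show "g \<circ> h \<in> H" using HE[OF g] HE[OF h] by (elim disjE exE) (simp_all only: mirror_comp HI)
  qed
  interpret B: group "Maps :: (real \<Rightarrow> real) monoid" by (rule group_BijGroup)
  have "Dihedral \<subseteq> H"
    unfolding Dihedral_def using H
    by (intro B.generate_subgroup_incl) (auto simp: H_def delta_mirror subgroup_Maps_iff)
  moreover have "H \<subseteq> Dihedral"
  proof -
    have sub: "bij_group Dihedral"
      unfolding Dihedral_def subgroup_Maps_iff[symmetric]
      by (rule B.generate_is_subgroup) (auto simp: delta_mirror)
    have d: "mirror 0 \<in> Dihedral" "mirror 1 \<in> Dihedral"
      unfolding Dihedral_def by (auto simp: delta_mirror[symmetric] intro: generate.incl)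
    have s1: "step 1 \<in> Dihedral" using bij_groupD(3)[OF sub d(2,1)] unfolding mirror_comp by simp
    have sm: "step (- 1) \<in> Dihedral"
      using bij_groupD(3)[OF sub d(1,2)] unfolding mirror_comp by (simp only: diff_0)
    have s: "step k \<in> Dihedral" for k
    proof (induction k rule: int_induct[of _ 0])
      case base
      then show ?case using bij_groupD(2)[OF sub] by (simp add: id_def)
    next
      case (step1 i)
      then show ?case using bij_groupD(3)[OF sub step1(2) s1] unfolding mirror_comp by simp
    next
      case (step2 i)
      then show ?case
        using bij_groupD(3)[OF sub step2(2) sm] unfolding mirror_comp by (simp only: add_uminus_conv_diff)
    qed
    have "mirror k \<in> Dihedral" for k
      using bij_groupD(3)[OF sub s[of k] d(1)] unfolding mirror_comp by simp
    then show ?thesis using s by (auto simp: H_def)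
  qed
  ultimately show ?thesis by (auto simp: H_def)
qed

lemma mirror_Dihedral: "mirror k \<in> Dihedral" "step k \<in> Dihedral"
  unfolding Dihedral_iff by blast+

lemma bij_group_Dihedral: "bij_group Dihedral"
proof -
  have "subgroup Dihedral Maps"
    unfolding Dihedral_def
    by (rule group.generate_is_subgroup[OF group_BijGroup]) (auto simp: delta_mirror)
  then show ?thesis by (simp add: subgroup_Maps_iff)
qed

lemma delta_Dihedral: "\<delta>\<^sub>1 \<in> Dihedral" "\<delta>\<^sub>2 \<in> Dihedral"
  by (auto simp: Dihedral_iff delta_mirror)

lemma space_group_Dihedral: "space_group Dihedral"
\<comment> \<open>At 0 an element with parameter \<open>k\<close> moves by |k|, so closeness forces
  \<open>k = 0\<close>. The point 1/4 separates the identity from \<delta>_1, which fixes 0 and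
  moves 1/4 by exactly 1/2.\<close>
proof (rule space_groupI_id[OF bij_group_Dihedral, where X = "{0, 1/4}" and e = "1/2" and K = "cball 0 1"])
  show "g \<in> isometries" if "g \<in> Dihedral" for g
    using that by (auto simp: Dihedral_iff isometries_dist mirror_def dist_real_def)
  show "h = id" if "h \<in> Dihedral" and near: "\<And>x. x \<in> {0, 1/4} \<Longrightarrow> dist (h x) x < 1/2" for h
  proof -
    consider k where "h = step k" | k where "h = mirror k" using \<open>h \<in> Dihedral\<close> by (auto simp: Dihedral_iff)
    then show ?thesis
    proof cases
      case 1
      then have "\<bar>real_of_int k\<bar> < 1" using near[of 0] by (simp add: dist_real_def)
      then have "k = 0" by linarith
      then show ?thesis using 1 by (simp add: id_def)
    next
      case 2
      then have "\<bar>real_of_int k\<bar> < 1" using near[of 0] by (simp add: dist_real_def mirror_def)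
      then have "k = 0" by linarith
      then show ?thesis using near[of "1/4"] 2 by (simp add: dist_real_def mirror_def)
    qed
  qed
  show "\<exists>g\<in>Dihedral. g x \<in> cball 0 1" for x
  proof (rule bexI[of _ "step (- \<lfloor>x\<rfloor>)"])
    show "step (- \<lfloor>x\<rfloor>) x \<in> cball 0 1" by simp linarith
  qed (rule mirror_Dihedral)
qed simp_all

lemma conjg_mirror:
  "conjg (step k) (mirror i) = mirror (i + 2 * k)" "conjg (mirror k) (mirror i) = mirror (2 * k - i)"
  by (simp_all add: conjg_def finv_shift) (simp_all add: mirror_def fun_eq_iff)

text \<open>Conjugation in the dihedral group changes the index of a mirror by sign and even
  numbers. Of two adjacent indices one is even and can be moved to 0; the other becomes 1 if the
  right one of the two possible conjugations, a translation or a reflection, is taken.\<close>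

lemma adjacent_mirrors:
  assumes "\<bar>j - i\<bar> = 1"
  obtains c where "c \<in> Dihedral"
    "(conjg c (mirror i) = \<delta>\<^sub>1 \<and> conjg c (mirror j) = \<delta>\<^sub>2) \<or> (conjg c (mirror i) = \<delta>\<^sub>2 \<and> conjg c (mirror j) = \<delta>\<^sub>1)"
proof -
  have *: "\<exists>c\<in>Dihedral. conjg c (mirror i) = \<delta>\<^sub>1 \<and> conjg c (mirror j) = \<delta>\<^sub>2"
    if "even i" "\<bar>j - i\<bar> = 1" for i j
  proof -
    obtain m where m: "i = 2 * m" using \<open>even i\<close> by blast
    have "j = i + 1 \<or> j = i - 1" using \<open>\<bar>j - i\<bar> = 1\<close> by linarith
    then show ?thesis
    proof (elim disjE)
      assume "j = i + 1"
      then show ?thesis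
        using m by (intro bexI[of _ "step (- m)"]) (simp_all only: conjg_mirror delta_mirror mirror_Dihedral, simp_all)
    next
      assume "j = i - 1"
      then show ?thesis
        using m by (intro bexI[of _ "mirror m"]) (simp_all only: conjg_mirror delta_mirror mirror_Dihedral, simp_all)
    qed
  qed
  show thesis
  proof (cases "even i")
    case True
    then show thesis using *[OF True assms] that by blast
  next
    case False
    then have "even j" using assms by presburger
    moreover have "\<bar>i - j\<bar> = 1" using assms by linarith
    ultimately show thesis using *[of j i] that by blast
  qed
qed

text \<open>The orthogonal complement of \<open>(I - A\<^sub>2)(Fix A\<^sub>1)\<close> in the \<open>(-1)\<close>-eigenspace of
  \<open>A\<^sub>2\<close>, for the inner product pulled back along \<open>C\<close>, lies in the \<open>(-1)\<close>-eigenspace of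
  \<open>A\<^sub>1\<close>.\<close>

lemma common_eigenvector_shift:
  fixes A\<^sub>1 A\<^sub>2 C :: "'a::euclidean_space \<Rightarrow> 'a"
  assumes L: "linear A\<^sub>1" "linear A\<^sub>2" "linear C" and C: "inj C" and V: "subspace V"
    and AV: "\<And>x. x \<in> V \<Longrightarrow> A\<^sub>1 x \<in> V" "\<And>x. x \<in> V \<Longrightarrow> A\<^sub>2 x \<in> V"
    and inv: "\<And>x. x \<in> V \<Longrightarrow> A\<^sub>1 (A\<^sub>1 x) = x" "\<And>x. x \<in> V \<Longrightarrow> A\<^sub>2 (A\<^sub>2 x) = x"
    and CA: "\<And>x. norm (C (A\<^sub>1 x)) = norm (C x)" "\<And>x. norm (C (A\<^sub>2 x)) = norm (C x)"
    and u: "u\<^sub>1 \<in> V" "A\<^sub>1 u\<^sub>1 = - u\<^sub>1" "u\<^sub>2 \<in> V" "A\<^sub>2 u\<^sub>2 = - u\<^sub>2"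
  obtains w v where "w \<in> V" "w - A\<^sub>1 w + u\<^sub>1 = 0" "v = w - A\<^sub>2 w + u\<^sub>2" "v \<in> V"
    "A\<^sub>1 v = - v" "A\<^sub>2 v = - v"
proof -
  note lin1 = linear_add[OF L(1)] linear_diff[OF L(1)] linear_neg[OF L(1)] linear_scale[OF L(1)]
  note lin2 = linear_add[OF L(2)] linear_diff[OF L(2)] linear_neg[OF L(2)] linear_scale[OF L(2)]
  note linC = linear_add[OF L(3)] linear_diff[OF L(3)] linear_neg[OF L(3)] linear_scale[OF L(3)]
  have CA2: "C (A\<^sub>2 x) \<bullet> C (A\<^sub>2 y) = C x \<bullet> C y" for x y
    using CA(2)[of "x + y"] CA(2)[of x] CA(2)[of y] by (simp add: dot_norm linC lin2)
  define F where "F = {x \<in> V. A\<^sub>1 x = x}"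
  have F: "subspace F"
    unfolding F_def
    by (rule subspaceI)
      (auto simp: lin1 linear_0[OF L(1)] subspace_0[OF V] subspace_add[OF V] subspace_scale[OF V])
  let ?T = "(\<lambda>x. C (x - A\<^sub>2 x)) ` F"
  have T: "subspace ?T"
    by (rule linear_subspace_image[OF _ F])
      (auto simp: linear_iff linC lin2 algebra_simps)
  \<comment> \<open>Taking -u_1/2 for \<open>w\<close> cancels u_1, which lies in the
    (-1)-eigenspace, and turns u_2 into \<open>e\<close>. The freedom left is to subtract from
    \<open>w\<close> a vector \<open>x\<close> fixed by A_1.\<close>
  define e where "e = u\<^sub>2 - (1/2) *\<^sub>R (u\<^sub>1 - A\<^sub>2 u\<^sub>1)"
  have eV: "e \<in> V" unfolding e_def
    using V u AV(2)[OF u(1)] by (intro subspace_diff subspace_scale)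
  have eE: "A\<^sub>2 e = - e" by (simp add: e_def lin2 u(4) inv(2)[OF u(1)]) (simp add: algebra_simps)
  obtain y z where yz: "y \<in> span ?T" "\<And>t. t \<in> span ?T \<Longrightarrow> orthogonal z t" "C e = y + z"
    using orthogonal_subspace_decomp_exists[of ?T "C e"] by metis
  have "span ?T = ?T" using T by (simp add: span_eq_iff)
  then have "y \<in> ?T" using yz(1) by (simp only:)
  then obtain x where x: "x \<in> F" "y = C (x - A\<^sub>2 x)" by blast
  define v where "v = e - (x - A\<^sub>2 x)"
  have xV: "x \<in> V" "A\<^sub>1 x = x" using x(1) by (simp_all add: F_def)
  have vV: "v \<in> V" unfolding v_def by (intro subspace_diff V eV xV AV(2))
  have vE2: "A\<^sub>2 v = - v" by (simp add: v_def lin2 eE inv(2)[OF xV(1)])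
  have Cv: "C v = z" using yz(3) x(2) by (simp add: v_def linC)
  \<comment> \<open>For the invariant product, A_2 v = - v makes v . A_2 f equal to - v . f, so
    orthogonality to f - A_2 f is orthogonality to 2 f.\<close>
  have orth: "C v \<bullet> C f = 0" if f: "f \<in> F" for f
  proof -
    have fV: "f \<in> V" using f by (simp add: F_def)
    have "C v \<bullet> C (f - A\<^sub>2 f) = 0"
      using yz(2)[OF span_base[of "C (f - A\<^sub>2 f)" ?T]] f by (simp add: Cv orthogonal_def)
    moreover have "C v \<bullet> C (A\<^sub>2 f) = - (C v \<bullet> C f)"
      using CA2[of v "A\<^sub>2 f"] by (simp add: vE2 inv(2)[OF fV] linC)
    ultimately show ?thesis by (simp add: linC inner_diff_right)
  qed
  \<comment> \<open>A vector fixed by A_1, hence orthogonal to \<open>v\<close>. As A_1 preserves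
    the product, its squared length is twice its product with \<open>v\<close>, so it
    vanishes.\<close>
  have "v + A\<^sub>1 v \<in> F"
    unfolding F_def using subspace_add[OF V vV AV(1)[OF vV]] by (simp add: lin1 inv(1)[OF vV] add.commute)
  then have "C v \<bullet> C (v + A\<^sub>1 v) = 0" by (rule orth)
  then have "C v \<bullet> C (A\<^sub>1 v) = - (C v \<bullet> C v)" by (simp add: linC inner_add_right)
  moreover have "C (A\<^sub>1 v) \<bullet> C (A\<^sub>1 v) = C v \<bullet> C v" using CA(1)[of v] by (simp add: norm_eq)
  ultimately have "C (v + A\<^sub>1 v) \<bullet> C (v + A\<^sub>1 v) = 0"
    by (simp add: linC inner_add_left inner_add_right inner_commute)
  then have "C (v + A\<^sub>1 v) = C 0" by (simp add: linear_0[OF L(3)])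
  then have "v + A\<^sub>1 v = 0" using C by (auto dest: injD)
  then have vE1: "A\<^sub>1 v = - v" by (simp add: eq_neg_iff_add_eq_0 add.commute)
  define w where "w = - (1/2) *\<^sub>R u\<^sub>1 - x"
  show thesis
  proof (rule that[OF _ _ _ vV vE1 vE2])
    show "w \<in> V" unfolding w_def by (intro subspace_diff subspace_scale V u xV)
    have "w - A\<^sub>1 w + u\<^sub>1 = u\<^sub>1 - ((1/2) *\<^sub>R u\<^sub>1 + (1/2) *\<^sub>R u\<^sub>1)"
      by (simp add: w_def lin1 u(2) xV(2))
    then show "w - A\<^sub>1 w + u\<^sub>1 = 0" by (simp add: scaleR_add_left[symmetric])
    show "v = w - A\<^sub>2 w + u\<^sub>2"
      by (simp add: w_def v_def e_def lin2 algebra_simps)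
  qed
qed

section \<open>Lifts over the dihedral group; sufficiency by shears\<close>

locale dihedral_orbifold = orbifold M for M :: "('a::euclidean_space \<Rightarrow> 'a) set"

sublocale dihedral_orbifold \<subseteq> orbifold_extension M Dihedral
  by unfold_locales (rule space_group_Dihedral)

context dihedral_orbifold
begin

text \<open>The elements of the dihedral group with a lift in \<open>H\<close> form a subgroup; it
  contains both generators and so is everything. Two lifts of the same element differ by
  \<open>M\<close>, which is contained in \<open>H\<close> by way of \<open>ext M\<close>.\<close>

lemma lifts_generated:
  assumes \<eta>: "hom_to_Aff \<eta>" and H: "bij_group H" "ext M \<subseteq> H"
    and gen: "\<And>d. d \<in> {\<delta>\<^sub>1, \<delta>\<^sub>2} \<Longrightarrow> \<exists>\<phi>. map_prod \<phi> d \<in> H \<and> map_prod \<phi> d \<in> lifts \<eta>"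
  shows "lifts \<eta> \<subseteq> H"
proof
  define K where "K = {d \<in> Dihedral. \<exists>\<phi>. map_prod \<phi> d \<in> H \<and> map_prod \<phi> d \<in> lifts \<eta>}"
  have bl: "bij_group (lifts \<eta>)" by (rule bij_group_lifts[OF \<eta>])
  have "bij_group K"
    unfolding bij_group_def
  proof (intro conjI ballI)
    show "id \<in> K"
      using bij_groupD(2)[OF H(1)] bij_groupD(2)[OF bl] bij_groupD(2)[OF bij_group_Dihedral]
      by (auto simp: K_def prod.map_id0[symmetric])
    fix d assume "d \<in> K"
    then obtain \<phi> where \<phi>: "d \<in> Dihedral" "map_prod \<phi> d \<in> H" "map_prod \<phi> d \<in> lifts \<eta>" by (auto simp: K_def)
    show bd: "bij d" by (rule bij_groupD(1)[OF bij_group_Dihedral \<phi>(1)])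
    have b\<phi>: "bij \<phi>" using \<phi>(3) by (simp add: map_prod_lifts NM_bij)
    have "map_prod (finv \<phi>) (finv d) \<in> H" "map_prod (finv \<phi>) (finv d) \<in> lifts \<eta>"
      using bij_groupD(4)[OF H(1) \<phi>(2)] bij_groupD(4)[OF bl \<phi>(3)] by (simp_all add: finv_map_prod b\<phi> bd)
    then show "finv d \<in> K" using bij_groupD(4)[OF bij_group_Dihedral \<phi>(1)] by (auto simp: K_def)
    fix e assume "e \<in> K"
    then obtain \<psi> where \<psi>: "e \<in> Dihedral" "map_prod \<psi> e \<in> H" "map_prod \<psi> e \<in> lifts \<eta>" by (auto simp: K_def)
    have "map_prod (\<phi> \<circ> \<psi>) (d \<circ> e) \<in> H" "map_prod (\<phi> \<circ> \<psi>) (d \<circ> e) \<in> lifts \<eta>"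
      using bij_groupD(3)[OF H(1) \<phi>(2) \<psi>(2)] bij_groupD(3)[OF bl \<phi>(3) \<psi>(3)] by (simp_all add: map_prod_comp)
    then show "d \<circ> e \<in> K" using bij_groupD(3)[OF bij_group_Dihedral \<phi>(1) \<psi>(1)] by (auto simp: K_def)
  qed
  then have "subgroup K Maps" by (simp add: subgroup_Maps_iff)
  moreover have "{\<delta>\<^sub>1, \<delta>\<^sub>2} \<subseteq> K" using gen delta_Dihedral by (auto simp: K_def)
  ultimately have DK: "Dihedral \<subseteq> K"
    using group.generate_subgroup_incl[OF group_BijGroup] unfolding Dihedral_def by blast
  fix \<gamma> assume \<gamma>l: "\<gamma> \<in> lifts \<eta>"
  then obtain \<phi> d where \<gamma>: "\<gamma> = map_prod \<phi> d" "d \<in> Dihedral" by (rule liftsE)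
  obtain \<psi> where \<psi>: "map_prod \<psi> d \<in> H" "map_prod \<psi> d \<in> lifts \<eta>" using DK \<gamma>(2) by (auto simp: K_def)
  obtain m where m: "m \<in> M" "\<phi> = m \<circ> \<psi>" using lifts_fiber[OF \<psi>(2)] \<gamma>l unfolding \<gamma>(1) by blast
  have "map_prod m id \<in> H" using H(2) m(1) by (auto simp: ext_def)
  then have "map_prod m id \<circ> map_prod \<psi> d \<in> H" using \<psi>(1) by (rule bij_groupD(3)[OF H(1)])
  then show "\<gamma> \<in> H" by (simp add: \<gamma>(1) m(2) map_prod_comp)
qed

definition shear :: "'a \<Rightarrow> 'a \<times> real \<Rightarrow> 'a \<times> real"
  where "shear v = (\<lambda>(x, t). (x + t *\<^sub>R v, t))"

lemma shear_finv: "bij (shear v)" "finv (shear v) = shear (- v)"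
proof -
  have *: "shear v (shear (- v) p) = p" "shear (- v) (shear v p) = p" for p
    by (simp_all add: shear_def split: prod.splits)
  show "bij (shear v)" by (rule o_bij[of "shear (- v)"]) (auto simp: *)
  show "finv (shear v) = shear (- v)" by (rule finv_eqI) (auto simp: *)
qed

text \<open>When \<phi> scales \<open>v\<close> by the same factor by which \<open>d\<close> scales
  the line, the terms proportional to t cancel and only the constant \<open>k\<close> of
  \<open>d\<close> survives. The pair (c, k) is (1, 0) for \<open>M\<close>, (-1, 0) for \<delta>_1
  and (-1, 1) for \<delta>_2.\<close>

lemma conjg_shear:
  assumes \<phi>: "\<phi> \<in> affinities" "lin \<phi> v = c *\<^sub>R v" and d: "\<And>t. d t = c * t + k"
  shows "conjg (shear v) (map_prod \<phi> d) = map_prod (shift (k *\<^sub>R v) \<circ> \<phi>) d"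
proof
  fix p :: "'a \<times> real"
  obtain x t where p: "p = (x, t)" by (cases p)
  have "\<phi> (x + (- t) *\<^sub>R v) = \<phi> x + (- t * c) *\<^sub>R v"
    using affinityD(3)[OF \<phi>(1), of x "(- t) *\<^sub>R v"] linear_scale[OF affinityD(1)[OF \<phi>(1)], of "- t" v] \<phi>(2) by simp
  then show "conjg (shear v) (map_prod \<phi> d) p = map_prod (shift (k *\<^sub>R v) \<circ> \<phi>) d p"
    unfolding conjg_def shear_finv p by (simp add: shear_def d algebra_simps)
qed

text \<open>A normalizing affinity permutes the linear parts of \<open>M\<close> by conjugation and
  therefore preserves their common fixed space.\<close>

lemma normalizer_center_span:
  assumes \<phi>: "\<phi> \<in> NM" and v: "v \<in> Span (center (grp M))"
  shows "lin \<phi> v \<in> Span (center (grp M))"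
proof (rule fixed_in_center_span[OF M])
  fix m assume m: "m \<in> M"
  have aff: "\<phi> \<in> affinities" "m \<in> affinities" using NM_aff[OF \<phi>] space_groupD(3)[OF M m] .
  have n: "finv \<phi> \<circ> m \<circ> \<phi> \<in> M" by (rule NM_conj(2)[OF \<phi> m])
  have "\<phi> \<circ> (finv \<phi> \<circ> m \<circ> \<phi>) = m \<circ> \<phi>" using NM_bij[OF \<phi>] by (simp add: fun_eq_iff)
  then have "lin \<phi> \<circ> lin (finv \<phi> \<circ> m \<circ> \<phi>) = lin m \<circ> lin \<phi>"
    using lin_comp[OF aff(1)] lin_comp[OF aff(2)] by metis
  then have "lin m (lin \<phi> v) = lin \<phi> (lin (finv \<phi> \<circ> m \<circ> \<phi>) v)" by (metis comp_apply)
  then show "lin m (lin \<phi> v) = lin \<phi> v" by (simp add: center_fixed[OF M v n])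
qed

text \<open>The isomorphism is conjugation by the shear followed by the product of \<alpha> with a
  map \<open>b\<close> of the line. It suffices to compare the groups on \<open>ext M\<close> and
  over the two generators: \<open>lifts_generated\<close> gives one inclusion for \<Psi> and the
  other for its inverse.\<close>

lemma shear_lifts_iso:
  assumes \<eta>: "hom_to_Aff \<eta>\<^sub>1" "hom_to_Aff \<eta>\<^sub>2" and \<phi>: "\<phi>\<^sub>1 \<in> NM" "\<phi>\<^sub>2 \<in> NM" "\<eta>\<^sub>1 \<delta>\<^sub>1 = st \<phi>\<^sub>1" "\<eta>\<^sub>1 \<delta>\<^sub>2 = st \<phi>\<^sub>2"
    and v: "v \<in> Span (center (grp M))" "lin \<phi>\<^sub>1 v = - v" "lin \<phi>\<^sub>2 v = - v" and \<alpha>: "\<alpha> \<in> NM"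
    and eq: "st (conjg \<alpha> \<phi>\<^sub>1) = \<eta>\<^sub>2 \<delta>\<^sub>1 \<and> st (conjg \<alpha> (shift v \<circ> \<phi>\<^sub>2)) = \<eta>\<^sub>2 \<delta>\<^sub>2 \<or>
      st (conjg \<alpha> \<phi>\<^sub>1) = \<eta>\<^sub>2 \<delta>\<^sub>2 \<and> st (conjg \<alpha> (shift v \<circ> \<phi>\<^sub>2)) = \<eta>\<^sub>2 \<delta>\<^sub>1"
  shows "lifts_iso \<eta>\<^sub>1 \<eta>\<^sub>2"
proof -
  \<comment> \<open>Reflection in 1/4 exchanges the fixed points 0 and 1/2 of the two generators. It
    takes care of the case where the unordered pairs match in the opposite order.\<close>
  have half_turn: "conjg (\<lambda>t. 1/2 - t) \<delta>\<^sub>1 = \<delta>\<^sub>2" "conjg (\<lambda>t. 1/2 - t) \<delta>\<^sub>2 = \<delta>\<^sub>1" "bij (\<lambda>t::real. 1/2 - t)"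
  proof -
    have "finv (\<lambda>t::real. 1/2 - t) = (\<lambda>t. 1/2 - t)" by (rule finv_eqI) auto
    then show "conjg (\<lambda>t. 1/2 - t) \<delta>\<^sub>1 = \<delta>\<^sub>2" "conjg (\<lambda>t. 1/2 - t) \<delta>\<^sub>2 = \<delta>\<^sub>1"
      by (simp_all add: conjg_def \<delta>\<^sub>1_def \<delta>\<^sub>2_def fun_eq_iff)
    show "bij (\<lambda>t::real. 1/2 - t)" by (rule o_bij[of "\<lambda>t. 1/2 - t"]) auto
  qed
  have "\<exists>b. bij b \<and> {conjg b \<delta>\<^sub>1, conjg b \<delta>\<^sub>2} = {\<delta>\<^sub>1, \<delta>\<^sub>2} \<and> st (conjg \<alpha> \<phi>\<^sub>1) = \<eta>\<^sub>2 (conjg b \<delta>\<^sub>1) \<and>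
      st (conjg \<alpha> (shift v \<circ> \<phi>\<^sub>2)) = \<eta>\<^sub>2 (conjg b \<delta>\<^sub>2)"
    using eq
  proof
    assume "st (conjg \<alpha> \<phi>\<^sub>1) = \<eta>\<^sub>2 \<delta>\<^sub>1 \<and> st (conjg \<alpha> (shift v \<circ> \<phi>\<^sub>2)) = \<eta>\<^sub>2 \<delta>\<^sub>2"
    then show ?thesis by (intro exI[of _ id]) (simp add: conjg_def)
  next
    assume "st (conjg \<alpha> \<phi>\<^sub>1) = \<eta>\<^sub>2 \<delta>\<^sub>2 \<and> st (conjg \<alpha> (shift v \<circ> \<phi>\<^sub>2)) = \<eta>\<^sub>2 \<delta>\<^sub>1"
    then show ?thesis
      by (intro exI[of _ "\<lambda>t. 1/2 - t"]) (simp add: half_turn insert_commute)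
  qed
  then obtain b where bijb: "bij b" and be: "{conjg b \<delta>\<^sub>1, conjg b \<delta>\<^sub>2} = {\<delta>\<^sub>1, \<delta>\<^sub>2}"
    and st\<alpha>: "st (conjg \<alpha> \<phi>\<^sub>1) = \<eta>\<^sub>2 (conjg b \<delta>\<^sub>1)" "st (conjg \<alpha> (shift v \<circ> \<phi>\<^sub>2)) = \<eta>\<^sub>2 (conjg b \<delta>\<^sub>2)"
    by blast
  have b\<alpha>: "bij \<alpha>" by (rule NM_bij[OF \<alpha>])
  define \<Psi> where "\<Psi> = map_prod \<alpha> b \<circ> shear v"
  have b\<Psi>: "bij \<Psi>" unfolding \<Psi>_def by (intro bij_comp shear_finv(1) bij_map_prod b\<alpha> bijb)
  have \<Psi>: "conjg \<Psi> g = conjg (map_prod \<alpha> b) (conjg (shear v) g)" for g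
    unfolding \<Psi>_def by (rule conjg_conjg[symmetric]) (simp_all add: bij_map_prod b\<alpha> bijb shear_finv)
  have NMc: "conjg \<alpha> \<phi> \<in> NM" if "\<phi> \<in> NM" for \<phi> using that \<alpha> by (simp add: conjg_def NM_comp NM_finv)
  have \<Psi>m: "conjg \<Psi> (map_prod m id) = map_prod (conjg \<alpha> m) id" if m: "m \<in> M" for m
    using conjg_shear[OF space_groupD(3)[OF M m], of v 1 id 0] center_fixed[OF M v(1) m]
    unfolding \<Psi> by (simp add: conjg_map_prod b\<alpha> bijb comp_def)
  have \<Psi>1: "conjg \<Psi> (map_prod \<phi>\<^sub>1 \<delta>\<^sub>1) = map_prod (conjg \<alpha> \<phi>\<^sub>1) (conjg b \<delta>\<^sub>1)"
    using conjg_shear[OF NM_aff[OF \<phi>(1)], of v "-1" \<delta>\<^sub>1 0] v(2)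
    unfolding \<Psi> by (simp add: conjg_map_prod b\<alpha> bijb \<delta>\<^sub>1_def comp_def)
  have \<Psi>2: "conjg \<Psi> (map_prod \<phi>\<^sub>2 \<delta>\<^sub>2) = map_prod (conjg \<alpha> (shift v \<circ> \<phi>\<^sub>2)) (conjg b \<delta>\<^sub>2)"
    using conjg_shear[OF NM_aff[OF \<phi>(2)], of v "-1" \<delta>\<^sub>2 1] v(3)
    unfolding \<Psi> by (simp add: conjg_map_prod b\<alpha> bijb \<delta>\<^sub>2_def)
  have g1: "map_prod \<phi>\<^sub>1 \<delta>\<^sub>1 \<in> lifts \<eta>\<^sub>1" and g2: "map_prod \<phi>\<^sub>2 \<delta>\<^sub>2 \<in> lifts \<eta>\<^sub>1"
    by (simp_all add: map_prod_lifts delta_Dihedral \<phi>)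
  have v\<phi>: "shift v \<circ> \<phi>\<^sub>2 \<in> NM" by (intro NM_comp shift_center_NM v \<phi>)
  have "{conjg b \<delta>\<^sub>1, conjg b \<delta>\<^sub>2} \<subseteq> Dihedral" unfolding be using delta_Dihedral by simp
  then have h: "conjg \<Psi> (map_prod \<phi>\<^sub>1 \<delta>\<^sub>1) \<in> lifts \<eta>\<^sub>2" "conjg \<Psi> (map_prod \<phi>\<^sub>2 \<delta>\<^sub>2) \<in> lifts \<eta>\<^sub>2"
    unfolding \<Psi>1 \<Psi>2 by (simp_all add: map_prod_lifts NMc[OF \<phi>(1)] NMc[OF v\<phi>] st\<alpha>)
  have bl: "bij_group (lifts \<eta>\<^sub>1)" "bij_group (lifts \<eta>\<^sub>2)" by (rule bij_group_lifts[OF \<eta>(1)], rule bij_group_lifts[OF \<eta>(2)])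
  have \<Psi>ext: "conjg \<Psi> ` ext M = ext M"
  proof -
    have "conjg \<Psi> ` ext M = ext (conjg \<alpha> ` M)" unfolding ext_def image_image by (intro image_cong refl \<Psi>m)
    then show ?thesis by (simp add: NM_conjg_image[OF \<alpha>])
  qed
  have \<Psi>ext': "conjg (finv \<Psi>) ` ext M = ext M"
    using conjg_image_inverse[OF b\<Psi>, of "ext M"] by (simp add: \<Psi>ext)
  have "lifts \<eta>\<^sub>2 \<subseteq> conjg \<Psi> ` lifts \<eta>\<^sub>1"
  proof (rule lifts_generated[OF \<eta>(2)])
    show "bij_group (conjg \<Psi> ` lifts \<eta>\<^sub>1)" by (rule bij_group_conjg[OF b\<Psi> bl(1)])
    show "ext M \<subseteq> conjg \<Psi> ` lifts \<eta>\<^sub>1"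
      using image_mono[OF ext_lifts[OF \<eta>(1)], of "conjg \<Psi>"] unfolding \<Psi>ext .
    fix d assume "d \<in> {\<delta>\<^sub>1, \<delta>\<^sub>2}"
    then have "d = conjg b \<delta>\<^sub>1 \<or> d = conjg b \<delta>\<^sub>2" using be by blast
    then show "\<exists>\<phi>. map_prod \<phi> d \<in> conjg \<Psi> ` lifts \<eta>\<^sub>1 \<and> map_prod \<phi> d \<in> lifts \<eta>\<^sub>2"
      using imageI[OF g1, of "conjg \<Psi>"] imageI[OF g2, of "conjg \<Psi>"] h unfolding \<Psi>1 \<Psi>2 by blast
  qed
  moreover have "lifts \<eta>\<^sub>1 \<subseteq> conjg (finv \<Psi>) ` lifts \<eta>\<^sub>2"
  proof (rule lifts_generated[OF \<eta>(1)])
    show "bij_group (conjg (finv \<Psi>) ` lifts \<eta>\<^sub>2)" by (rule bij_group_conjg[OF bij_finv[OF b\<Psi>] bl(2)])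
    show "ext M \<subseteq> conjg (finv \<Psi>) ` lifts \<eta>\<^sub>2"
      using image_mono[OF ext_lifts[OF \<eta>(2)], of "conjg (finv \<Psi>)"] unfolding \<Psi>ext' .
    have "map_prod \<phi>\<^sub>1 \<delta>\<^sub>1 \<in> conjg (finv \<Psi>) ` lifts \<eta>\<^sub>2" "map_prod \<phi>\<^sub>2 \<delta>\<^sub>2 \<in> conjg (finv \<Psi>) ` lifts \<eta>\<^sub>2"
      using imageI[OF h(1), of "conjg (finv \<Psi>)"] imageI[OF h(2), of "conjg (finv \<Psi>)"]
      by (simp_all add: conjg_inverse(1)[OF b\<Psi>])
    then show "\<exists>\<phi>. map_prod \<phi> d \<in> conjg (finv \<Psi>) ` lifts \<eta>\<^sub>2 \<and> map_prod \<phi> d \<in> lifts \<eta>\<^sub>1"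
      if "d \<in> {\<delta>\<^sub>1, \<delta>\<^sub>2}" for d using that g1 g2 by blast
  qed
  then have "conjg \<Psi> ` lifts \<eta>\<^sub>1 \<subseteq> lifts \<eta>\<^sub>2"
    using b\<Psi> by (auto dest!: subsetD)
  ultimately have "conjg \<Psi> ` lifts \<eta>\<^sub>1 = lifts \<eta>\<^sub>2" by blast
  then have "conjg \<Psi> \<in> iso (grp (lifts \<eta>\<^sub>1)) (grp (lifts \<eta>\<^sub>2))"
    using conjg_iso[OF b\<Psi> bl(1)] by simp
  then show ?thesis unfolding lifts_iso_def using \<Psi>ext by blast
qed

end

section \<open>Isomorphisms of groups of lifts\<close>

text \<open>The group generated by \<open>mirror i\<close> and \<open>mirror (i + r)\<close>; for
  \<open>r = 0\<close> it has two elements.\<close>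

definition mirror_group :: "int \<Rightarrow> int \<Rightarrow> (real \<Rightarrow> real) set"
  where "mirror_group i r = {d. \<exists>l. d = step (l * r) \<or> d = mirror (i + l * r)}"

lemma bij_group_mirror_group: "bij_group (mirror_group i r)"
  unfolding bij_group_def
proof (intro conjI ballI)
  have I: "step (l * r) \<in> mirror_group i r" "mirror (i + l * r) \<in> mirror_group i r" for l
    unfolding mirror_group_def by blast+
  have E: "(\<exists>l. g = step (l * r)) \<or> (\<exists>l. g = mirror (i + l * r))" if "g \<in> mirror_group i r" for g
    using that unfolding mirror_group_def by blast
  show "id \<in> mirror_group i r" using I(1)[of 0] by (simp add: id_def)
  fix g assume g: "g \<in> mirror_group i r"
  show "bij g" using E[OF g] by auto
  show "finv g \<in> mirror_group i r"
    using E[OF g]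
  proof (elim disjE exE)
    fix l assume "g = step (l * r)"
    then have "finv g = step (- l * r)" by (simp add: finv_shift)
    then show ?thesis using I(1) by metis
  next
    fix l assume "g = mirror (i + l * r)"
    then show ?thesis using I(2) by simp
  qed
  fix h assume h: "h \<in> mirror_group i r"
  have "step (l * r) \<circ> step (k * r) = step ((l + k) * r)"
    "step (l * r) \<circ> mirror (i + k * r) = mirror (i + (l + k) * r)"
    "mirror (i + l * r) \<circ> step (k * r) = mirror (i + (l - k) * r)"
    "mirror (i + l * r) \<circ> mirror (i + k * r) = step ((l - k) * r)" for k l
    by (simp_all add: mirror_def fun_eq_iff algebra_simps)
  then show "g \<circ> h \<in> mirror_group i r"
    using E[OF g] E[OF h] by (elim disjE exE) (simp_all only: I)
qed

context dihedral_orbifold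
begin

text \<open>On \<open>M\<close>, \<open>f\<close> is conjugation by an affinity \<open>\<alpha>\<close>. Hence \<open>f\<close> and conjugation by \<open>\<alpha>\<close> differ on
  a lift by an affinity centralizing \<open>M\<close>, that is, by a translation along the span of the center.\<close>

lemma lifts_iso_rigid:
  assumes \<eta>: "hom_to_Aff \<eta>\<^sub>1" "hom_to_Aff \<eta>\<^sub>2"
    and f: "bij_betw f (lifts \<eta>\<^sub>1) (lifts \<eta>\<^sub>2)" "f ` ext M = ext M"
    and hom: "\<And>g h. g \<in> lifts \<eta>\<^sub>1 \<Longrightarrow> h \<in> lifts \<eta>\<^sub>1 \<Longrightarrow> f (g \<circ> h) = f g \<circ> f h"
  obtains \<alpha> where "\<alpha> \<in> NM" "\<And>m. m \<in> M \<Longrightarrow> f (map_prod m id) = map_prod (conjg \<alpha> m) id"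
    "\<And>\<phi> d. map_prod \<phi> d \<in> lifts \<eta>\<^sub>1 \<Longrightarrow> \<exists>u d'. u \<in> Span (center (grp M)) \<and>
      f (map_prod \<phi> d) = map_prod (conjg \<alpha> (shift u \<circ> \<phi>)) d'"
proof -
  define F where "F m = fst_part (f (map_prod m id))" for m
  have ml: "map_prod m id \<in> lifts \<eta>\<^sub>1" if "m \<in> M" for m using that by (simp add: lifts_id[OF \<eta>(1)])
  have F: "f (map_prod m id) = map_prod (F m) id" "F m \<in> M" if m: "m \<in> M" for m
  proof -
    have "f (map_prod m id) \<in> ext M" using f(2) m by (auto simp: ext_def)
    then obtain m' where "m' \<in> M" "f (map_prod m id) = map_prod m' id" by (auto simp: ext_def)
    then show "f (map_prod m id) = map_prod (F m) id" "F m \<in> M" by (simp_all add: F_def)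
  qed
  have "bij_betw F M M"
    unfolding bij_betw_def
  proof
    show "inj_on F M"
    proof (rule inj_onI)
      fix m n assume mn: "m \<in> M" "n \<in> M" "F m = F n"
      then have "f (map_prod m id) = f (map_prod n id)" by (simp add: F)
      then have "map_prod m id = (map_prod n id :: 'a \<times> real \<Rightarrow> _)"
        using inj_onD[OF bij_betw_imp_inj_on[OF f(1)]] ml mn by blast
      then show "m = n" by (simp add: map_prod_inject)
    qed
    have "m \<in> F ` M" if "m \<in> M" for m
    proof -
      have "map_prod m id \<in> f ` ext M" unfolding f(2) using that by (simp add: map_prod_ext)
      then obtain n where n: "n \<in> M" "map_prod m id = f (map_prod n id)" by (auto simp: ext_def)
      then have "m = F n" by (simp add: F map_prod_inject)
      then show ?thesis using n(1) by blast
    qed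
    then show "F ` M = M" using F(2) by blast
  qed
  moreover have "F (m \<circ> n) = F m \<circ> F n" if mn: "m \<in> M" "n \<in> M" for m n
  proof -
    have "f (map_prod m id \<circ> map_prod n id) = map_prod (F m \<circ> F n) id"
      unfolding hom[OF ml[OF mn(1)] ml[OF mn(2)]] by (simp add: F mn map_prod_comp)
    then show ?thesis by (simp add: map_prod_comp F_def)
  qed
  ultimately obtain \<alpha> where \<alpha>: "\<alpha> \<in> affinities" "\<And>m. m \<in> M \<Longrightarrow> F m \<circ> \<alpha> = \<alpha> \<circ> m"
    using space_group_automorphism_affine[OF M, of F] by blast
  have b\<alpha>: "bij \<alpha>" by (rule affinityD(2)[OF \<alpha>(1)])
  have F\<alpha>: "F m = conjg \<alpha> m" if "m \<in> M" for m
  proof -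
    have "conjg \<alpha> m = F m \<circ> (\<alpha> \<circ> finv \<alpha>)" unfolding conjg_def \<alpha>(2)[OF that, symmetric] comp_assoc ..
    then show ?thesis by (simp add: finv_comp b\<alpha>)
  qed
  have \<alpha>N: "\<alpha> \<in> NM"
    unfolding mem_normalizer
  proof (intro conjI ballI)
    fix m assume m: "m \<in> M"
    show "\<alpha> \<circ> m \<circ> finv \<alpha> \<in> M" using F(2)[OF m] by (simp add: F\<alpha>[OF m] conjg_def)
    obtain n where n: "n \<in> M" "m = F n" using \<open>bij_betw F M M\<close> m unfolding bij_betw_def by blast
    have "finv \<alpha> \<circ> m \<circ> \<alpha> = n" by (simp add: n F\<alpha>[OF n(1)] conjg_def fun_eq_iff b\<alpha>)
    then show "finv \<alpha> \<circ> m \<circ> \<alpha> \<in> M" using n(1) by simp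
  qed (rule \<alpha>)
  show thesis
  proof (rule that[OF \<alpha>N])
    show "f (map_prod m id) = map_prod (conjg \<alpha> m) id" if "m \<in> M" for m
      using that by (simp add: F F\<alpha>)
    fix \<phi> d assume l: "map_prod \<phi> d \<in> lifts \<eta>\<^sub>1"
    have \<phi>: "\<phi> \<in> NM" using l by (simp add: map_prod_lifts)
    have "f (map_prod \<phi> d) \<in> lifts \<eta>\<^sub>2" using bij_betwE[OF f(1)] l by blast
    then obtain \<psi> d' where \<psi>: "f (map_prod \<phi> d) = map_prod \<psi> d'" "\<psi> \<in> NM" by (rule liftsE)
    define \<omega> where "\<omega> = conjg (finv \<alpha>) \<psi>"
    have \<psi>\<omega>: "\<psi> = conjg \<alpha> \<omega>" by (simp add: \<omega>_def b\<alpha>)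
    have \<omega>N: "\<omega> \<in> NM" using \<psi>(2) \<alpha>N by (simp add: \<omega>_def conjg_def NM_comp NM_finv)
    have key: "(\<phi> \<circ> m \<circ> finv \<phi>) \<circ> \<omega> = \<omega> \<circ> m" if m: "m \<in> M" for m
    proof -
      define m' where "m' = \<phi> \<circ> m \<circ> finv \<phi>"
      have m': "m' \<in> M" unfolding m'_def by (rule NM_conj(1)[OF \<phi> m])
      have "map_prod m' id \<circ> map_prod \<phi> d = map_prod \<phi> d \<circ> map_prod m id"
        unfolding map_prod_comp by (simp add: m'_def comp_assoc finv_comp NM_bij[OF \<phi>])
      then have "f (map_prod m' id) \<circ> f (map_prod \<phi> d) = f (map_prod \<phi> d) \<circ> f (map_prod m id)"
        using hom[OF ml[OF m'] l] hom[OF l ml[OF m]] by simp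
      then have "conjg \<alpha> m' \<circ> \<psi> = \<psi> \<circ> conjg \<alpha> m"
        by (simp add: F m m' F\<alpha> \<psi>(1) map_prod_comp map_prod_inject)
      then have "conjg \<alpha> (m' \<circ> \<omega>) = conjg \<alpha> (\<omega> \<circ> m)" by (simp add: conjg_comp b\<alpha> \<psi>\<omega>)
      then show ?thesis by (simp add: b\<alpha> m'_def)
    qed
    \<comment> \<open>By \<open>key\<close>, \<phi> and \<omega> conjugate \<open>M\<close> in the
      same way, so \<tau> centralizes \<open>M\<close> and \<open>centralizer_translation\<close>
      applies.\<close>
    define \<tau> where "\<tau> = \<omega> \<circ> finv \<phi>"
    have \<tau>N: "\<tau> \<in> NM" unfolding \<tau>_def by (intro NM_comp NM_finv \<omega>N \<phi>)
    have \<tau>: "\<tau> \<circ> m = m \<circ> \<tau>" if m: "m \<in> M" for m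
    proof -
      define n where "n = finv \<phi> \<circ> m \<circ> \<phi>"
      have n: "n \<in> M" unfolding n_def by (rule NM_conj(2)[OF \<phi> m])
      have mn: "\<phi> \<circ> n \<circ> finv \<phi> = m" using NM_bij[OF \<phi>] by (simp add: n_def fun_eq_iff)
      have "\<tau> \<circ> m = \<omega> \<circ> n \<circ> finv \<phi>"
        unfolding mn[symmetric] \<tau>_def using NM_bij[OF \<phi>] by (simp add: fun_eq_iff)
      also have "\<dots> = m \<circ> \<tau>" using key[OF n] unfolding mn by (simp add: \<tau>_def comp_assoc[symmetric])
      finally show ?thesis .
    qed
    define u where "u = \<tau> 0"
    have "lin \<tau> = id" by (rule centralizer_translation[OF M NM_aff[OF \<tau>N] \<tau>])
    then have \<tau>u: "\<tau> = shift u" unfolding u_def by (rule lin_eq_idD)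
    have "u \<in> Span (center (grp M))"
    proof (rule fixed_in_center_span[OF M])
      fix m assume m: "m \<in> M"
      have "shift u \<circ> m = shift (lin m u) \<circ> m"
        using \<tau>[OF m] unfolding \<tau>u comp_shift[OF space_groupD(3)[OF M m]] .
      from fun_cong[OF this, of 0] show "lin m u = u" by simp
    qed
    moreover have "\<omega> = shift u \<circ> \<phi>"
      unfolding \<tau>u[symmetric] \<tau>_def using NM_bij[OF \<phi>] by (simp add: fun_eq_iff)
    ultimately show "\<exists>u d'. u \<in> Span (center (grp M)) \<and>
        f (map_prod \<phi> d) = map_prod (conjg \<alpha> (shift u \<circ> \<phi>)) d'"
      using \<psi>(1) \<psi>\<omega> by blast
  qed
qed

text \<open>Up to inner automorphisms, the only automorphisms of \<open>Dihedral\<close> are the identity and the swap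
  of \<open>\<delta>\<^sub>1\<close> and \<open>\<delta>\<^sub>2\<close>.\<close>

lemma lifts_iso_normal_form:
  assumes \<eta>: "hom_to_Aff \<eta>\<^sub>1" "hom_to_Aff \<eta>\<^sub>2" and iso: "lifts_iso \<eta>\<^sub>1 \<eta>\<^sub>2"
    and g: "map_prod \<phi>\<^sub>1 \<delta>\<^sub>1 \<in> lifts \<eta>\<^sub>1" "map_prod \<phi>\<^sub>2 \<delta>\<^sub>2 \<in> lifts \<eta>\<^sub>1"
  obtains f where "bij_betw f (lifts \<eta>\<^sub>1) (lifts \<eta>\<^sub>2)" "f ` ext M = ext M"
    "\<And>g h. g \<in> lifts \<eta>\<^sub>1 \<Longrightarrow> h \<in> lifts \<eta>\<^sub>1 \<Longrightarrow> f (g \<circ> h) = f g \<circ> f h"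
    "snd_part (f (map_prod \<phi>\<^sub>1 \<delta>\<^sub>1)) = \<delta>\<^sub>1 \<and> snd_part (f (map_prod \<phi>\<^sub>2 \<delta>\<^sub>2)) = \<delta>\<^sub>2 \<or>
     snd_part (f (map_prod \<phi>\<^sub>1 \<delta>\<^sub>1)) = \<delta>\<^sub>2 \<and> snd_part (f (map_prod \<phi>\<^sub>2 \<delta>\<^sub>2)) = \<delta>\<^sub>1"
proof -
  have bl: "bij_group (lifts \<eta>\<^sub>1)" "bij_group (lifts \<eta>\<^sub>2)"
    by (rule bij_group_lifts[OF \<eta>(1)], rule bij_group_lifts[OF \<eta>(2)])
  obtain f where iso: "f \<in> iso (grp (lifts \<eta>\<^sub>1)) (grp (lifts \<eta>\<^sub>2))" "f ` ext M = ext M"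
    using iso unfolding lifts_iso_def by blast
  then have f: "bij_betw f (lifts \<eta>\<^sub>1) (lifts \<eta>\<^sub>2)" "f ` ext M = ext M"
    and hom: "\<And>g h. g \<in> lifts \<eta>\<^sub>1 \<Longrightarrow> h \<in> lifts \<eta>\<^sub>1 \<Longrightarrow> f (g \<circ> h) = f g \<circ> f h"
    using iso_grp_iff[OF bl] by blast+
  define s where "s \<gamma> = snd_part (f \<gamma>)" for \<gamma>
  have fl: "f \<gamma> \<in> lifts \<eta>\<^sub>2" if "\<gamma> \<in> lifts \<eta>\<^sub>1" for \<gamma> using bij_betwE[OF f(1)] that by blast
  have f_prod: "\<exists>\<psi>. f \<gamma> = map_prod \<psi> (s \<gamma>)" "s \<gamma> \<in> Dihedral" if \<gamma>: "\<gamma> \<in> lifts \<eta>\<^sub>1" for \<gamma>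
  proof -
    obtain \<psi> d where "f \<gamma> = map_prod \<psi> d" "d \<in> Dihedral" using fl[OF \<gamma>] by (rule liftsE)
    then show "\<exists>\<psi>. f \<gamma> = map_prod \<psi> (s \<gamma>)" "s \<gamma> \<in> Dihedral" by (auto simp: s_def)
  qed
  have s_comp: "s (\<gamma> \<circ> \<gamma>') = s \<gamma> \<circ> s \<gamma>'" if gg: "\<gamma> \<in> lifts \<eta>\<^sub>1" "\<gamma>' \<in> lifts \<eta>\<^sub>1" for \<gamma> \<gamma>'
  proof -
    obtain \<psi> \<psi>' where "f \<gamma> = map_prod \<psi> (s \<gamma>)" "f \<gamma>' = map_prod \<psi>' (s \<gamma>')" using f_prod(1) gg by metis
    then show ?thesis unfolding s_def[of "\<gamma> \<circ> \<gamma>'"] hom[OF gg] by (simp add: map_prod_comp)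
  qed
  have s_id: "s \<gamma> = id \<longleftrightarrow> \<gamma> \<in> ext M" if \<gamma>: "\<gamma> \<in> lifts \<eta>\<^sub>1" for \<gamma>
  proof -
    obtain \<psi> where \<psi>: "f \<gamma> = map_prod \<psi> (s \<gamma>)" using f_prod(1)[OF \<gamma>] by blast
    have "\<gamma> \<in> ext M \<longleftrightarrow> f \<gamma> \<in> f ` ext M"
      using bij_betw_imp_inj_on[OF f(1)] ext_lifts[OF \<eta>(1)] \<gamma> by (simp add: inj_on_image_mem_iff)
    also have "\<dots> \<longleftrightarrow> map_prod \<psi> (s \<gamma>) \<in> ext M" by (simp add: f(2) \<psi>)
    also have "\<dots> \<longleftrightarrow> s \<gamma> = id"
      using fl[OF \<gamma>] lifts_id[OF \<eta>(2), of \<psi>] by (auto simp: \<psi> map_prod_ext) (auto simp: ext_def map_prod_inject)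
    finally show ?thesis by simp
  qed
  \<comment> \<open>The lift of a mirror lies outside \<open>ext M\<close> while its square lies
    inside, so \<open>s\<close> sends it to a nontrivial involution; the involutions of the dihedral
    group are the mirrors.\<close>
  have mirror: "\<exists>k. s (map_prod \<phi> (mirror i)) = mirror k" if l: "map_prod \<phi> (mirror i) \<in> lifts \<eta>\<^sub>1" for \<phi> i
  proof -
    let ?g = "map_prod \<phi> (mirror i)"
    have "?g \<circ> ?g = map_prod (\<phi> \<circ> \<phi>) id" by (simp add: map_prod_comp mirror_comp id_def)
    moreover have gl: "?g \<circ> ?g \<in> lifts \<eta>\<^sub>1" by (rule bij_groupD(3)[OF bl(1) l l])
    ultimately have "?g \<circ> ?g \<in> ext M" using lifts_id[OF \<eta>(1)] by (simp add: map_prod_ext)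
    then have ss: "s ?g \<circ> s ?g = id" using s_id[OF gl] s_comp[OF l l] by simp
    have "?g \<notin> ext M"
    proof
      assume "?g \<in> ext M"
      then have "mirror i = step 0" by (auto simp: ext_def map_prod_inject id_def)
      then show False using mirror_neq_step by blast
    qed
    then have ne: "s ?g \<noteq> id" using s_id[OF l] by simp
    consider "\<exists>k. s ?g = step k" | "\<exists>k. s ?g = mirror k" using f_prod(2)[OF l] Dihedral_iff by blast
    then show ?thesis
    proof cases
      case 1
      then obtain k where k: "s ?g = step k" by blast
      then have "step (k + k) = step 0" using ss unfolding k mirror_comp by (simp add: id_def)
      then have "k = 0" unfolding step_inject by simp
      then show ?thesis using ne k by (simp add: id_def)
    qed
  qed
  obtain i where i: "s (map_prod \<phi>\<^sub>1 \<delta>\<^sub>1) = mirror i" using mirror g(1) unfolding delta_mirror by blast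
  obtain j where j: "s (map_prod \<phi>\<^sub>2 \<delta>\<^sub>2) = mirror j" using mirror g(2) unfolding delta_mirror by blast
  \<comment> \<open>All values of \<open>s\<close> lie in the group generated by the mirrors
    \<open>i\<close> and \<open>j\<close>. Since \<open>f\<close> is onto, this group contains the
    unit translation, which requires j - i to divide 1.\<close>
  define R where "R = mirror_group i (j - i)"
  have bR: "bij_group R" unfolding R_def by (rule bij_group_mirror_group)
  define H where "H = {\<gamma> \<in> lifts \<eta>\<^sub>1. s \<gamma> \<in> R}"
  have bH: "bij_group H"
    unfolding bij_group_def
  proof (intro conjI ballI)
    have "map_prod id id \<in> ext M" by (rule map_prod_ext[THEN iffD2, OF space_groupD(5)[OF M]])
    then have "id \<in> ext M" by (simp only: prod.map_id0)
    then show "id \<in> H"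
      using s_id[OF bij_groupD(2)[OF bl(1)]] bij_groupD(2)[OF bR] bij_groupD(2)[OF bl(1)] by (simp add: H_def)
    then have sid: "s id = id" using s_id[OF bij_groupD(2)[OF bl(1)]] \<open>id \<in> ext M\<close> by simp
    fix x assume x: "x \<in> H"
    then have xl: "x \<in> lifts \<eta>\<^sub>1" by (simp add: H_def)
    show bx: "bij x" by (rule bij_groupD(1)[OF bl(1) xl])
    have xi: "finv x \<in> lifts \<eta>\<^sub>1" by (rule bij_groupD(4)[OF bl(1) xl])
    have sx: "s x \<in> R" "bij (s x)" using x bij_groupD(1)[OF bR] by (auto simp: H_def)
    have "s x \<circ> s (finv x) = id" using s_comp[OF xl xi] by (simp add: finv_comp bx sid)
    then have "finv (s x) \<circ> (s x \<circ> s (finv x)) = finv (s x)" by simp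
    then have "s (finv x) = finv (s x)" using sx(2) by (simp add: comp_assoc[symmetric] finv_comp)
    then show "finv x \<in> H" using xi bij_groupD(4)[OF bR sx(1)] by (simp add: H_def)
    fix y assume "y \<in> H"
    then show "x \<circ> y \<in> H"
      using x s_comp bij_groupD(3)[OF bl(1)] bij_groupD(3)[OF bR] by (simp add: H_def)
  qed
  have "lifts \<eta>\<^sub>1 \<subseteq> H"
  proof (rule lifts_generated[OF \<eta>(1) bH])
    show "ext M \<subseteq> H"
    proof
      fix x assume x: "x \<in> ext M"
      then have xl: "x \<in> lifts \<eta>\<^sub>1" using ext_lifts[OF \<eta>(1)] by blast
      then have "s x = id" using s_id x by blast
      then show "x \<in> H" using xl bij_groupD(2)[OF bR] by (simp add: H_def)
    qed
    have "mirror (i + 0 * (j - i)) \<in> R" "mirror (i + 1 * (j - i)) \<in> R"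
      unfolding R_def mirror_group_def by blast+
    then have "map_prod \<phi>\<^sub>1 \<delta>\<^sub>1 \<in> H" "map_prod \<phi>\<^sub>2 \<delta>\<^sub>2 \<in> H" using g i j by (simp_all add: H_def)
    then show "\<exists>\<phi>. map_prod \<phi> d \<in> H \<and> map_prod \<phi> d \<in> lifts \<eta>\<^sub>1" if "d \<in> {\<delta>\<^sub>1, \<delta>\<^sub>2}" for d
      using that g by blast
  qed
  moreover obtain \<kappa>\<^sub>0 where "map_prod \<kappa>\<^sub>0 (step 1) \<in> lifts \<eta>\<^sub>2"
    using lifts_surj[OF \<eta>(2) mirror_Dihedral(2)] .
  moreover from this obtain \<gamma> where "\<gamma> \<in> lifts \<eta>\<^sub>1" "f \<gamma> = map_prod \<kappa>\<^sub>0 (step 1)"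
    using bij_betw_imp_surj_on[OF f(1)] by (metis imageE)
  ultimately have "step 1 \<in> R" by (auto simp: H_def s_def)
  then obtain l where "step 1 = step (l * (j - i)) \<or> step 1 = mirror (i + l * (j - i))"
    unfolding R_def mirror_group_def by blast
  then have "step 1 = step (l * (j - i))"
    using not_sym[OF mirror_neq_step[of "i + l * (j - i)" 1]] by blast
  then have "1 = l * (j - i)" unfolding step_inject .
  then have "\<bar>j - i\<bar> = 1" by (metis abs_zmult_eq_1 abs_one mult.commute)
  then obtain c where c: "c \<in> Dihedral"
    "(conjg c (mirror i) = \<delta>\<^sub>1 \<and> conjg c (mirror j) = \<delta>\<^sub>2) \<or> (conjg c (mirror i) = \<delta>\<^sub>2 \<and> conjg c (mirror j) = \<delta>\<^sub>1)"
    by (rule adjacent_mirrors)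
  \<comment> \<open>A lift of \<open>c\<close> makes the required conjugation in the dihedral group
    an inner automorphism of the target, which also preserves \<open>ext M\<close>.\<close>
  obtain \<kappa> where \<kappa>: "map_prod \<kappa> c \<in> lifts \<eta>\<^sub>2" by (rule lifts_surj[OF \<eta>(2) c(1)])
  let ?c = "map_prod \<kappa> c"
  have bc: "bij c" "bij \<kappa>" "\<kappa> \<in> NM"
    using bij_groupD(1)[OF bij_group_Dihedral c(1)] \<kappa> by (simp_all add: map_prod_lifts NM_bij)
  have bcc: "bij ?c" by (rule bij_map_prod[OF bc(2,1)])
  have cl: "conjg ?c x \<in> lifts \<eta>\<^sub>2" "conjg (finv ?c) x \<in> lifts \<eta>\<^sub>2" if "x \<in> lifts \<eta>\<^sub>2" for x
    using that \<kappa> bij_groupD(3,4)[OF bl(2)] bcc by (simp_all add: conjg_def)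
  have bcl: "bij_betw (conjg ?c) (lifts \<eta>\<^sub>2) (lifts \<eta>\<^sub>2)"
    by (rule bij_betw_byWitness[where f' = "conjg (finv ?c)"]) (use cl bcc in auto)
  have s_conj: "snd_part (conjg ?c (f x)) = conjg c (s x)" if x: "x \<in> lifts \<eta>\<^sub>1" for x
    using f_prod(1)[OF x] by (auto simp: conjg_map_prod bc)
  show thesis
  proof (rule that[of "conjg ?c \<circ> f"])
    show "bij_betw (conjg ?c \<circ> f) (lifts \<eta>\<^sub>1) (lifts \<eta>\<^sub>2)" by (rule bij_betw_trans[OF f(1) bcl])
    have "conjg ?c ` ext M = ext (conjg \<kappa> ` M)"
      unfolding ext_def image_image by (intro image_cong) (simp_all add: conjg_map_prod bc)
    then show "(conjg ?c \<circ> f) ` ext M = ext M"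
      by (simp only: image_comp[symmetric] f(2) NM_conjg_image[OF bc(3)])
    show "(conjg ?c \<circ> f) (x \<circ> y) = (conjg ?c \<circ> f) x \<circ> (conjg ?c \<circ> f) y"
      if "x \<in> lifts \<eta>\<^sub>1" "y \<in> lifts \<eta>\<^sub>1" for x y
      using that by (simp add: hom conjg_comp bcc)
    show "snd_part ((conjg ?c \<circ> f) (map_prod \<phi>\<^sub>1 \<delta>\<^sub>1)) = \<delta>\<^sub>1 \<and> snd_part ((conjg ?c \<circ> f) (map_prod \<phi>\<^sub>2 \<delta>\<^sub>2)) = \<delta>\<^sub>2 \<or>
        snd_part ((conjg ?c \<circ> f) (map_prod \<phi>\<^sub>1 \<delta>\<^sub>1)) = \<delta>\<^sub>2 \<and> snd_part ((conjg ?c \<circ> f) (map_prod \<phi>\<^sub>2 \<delta>\<^sub>2)) = \<delta>\<^sub>1"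
      using c(2) s_conj[OF g(1)] s_conj[OF g(2)] by (simp add: i j)
  qed
qed

section \<open>Necessity: from an isomorphism to a conjugating affinity\<close>

lemma conjg_shift_shift:
  assumes "\<phi> \<in> affinities"
  shows "conjg (shift (- w)) (shift a \<circ> \<phi>) = shift (a - w + lin \<phi> w) \<circ> \<phi>"
  unfolding conjg_def finv_shift comp_assoc minus_minus comp_shift[OF assms]
  by (simp add: fun_eq_iff algebra_simps)

lemma lifts_iso_imp_conjugate:
  assumes \<eta>: "hom_to_Aff \<eta>\<^sub>1" "hom_to_Aff \<eta>\<^sub>2" and iso: "lifts_iso \<eta>\<^sub>1 \<eta>\<^sub>2" and C: "rotates \<eta>\<^sub>1 C"
    and \<phi>: "\<phi>\<^sub>1 \<in> NM" "\<phi>\<^sub>2 \<in> NM" "\<eta>\<^sub>1 \<delta>\<^sub>1 = st \<phi>\<^sub>1" "\<eta>\<^sub>1 \<delta>\<^sub>2 = st \<phi>\<^sub>2"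
  obtains v \<alpha> where "v \<in> Span (center (grp M))" "lin \<phi>\<^sub>1 v = - v" "lin \<phi>\<^sub>2 v = - v" "\<alpha> \<in> NM"
    "st (conjg \<alpha> \<phi>\<^sub>1) = \<eta>\<^sub>2 \<delta>\<^sub>1 \<and> st (conjg \<alpha> (shift v \<circ> \<phi>\<^sub>2)) = \<eta>\<^sub>2 \<delta>\<^sub>2 \<or>
     st (conjg \<alpha> \<phi>\<^sub>1) = \<eta>\<^sub>2 \<delta>\<^sub>2 \<and> st (conjg \<alpha> (shift v \<circ> \<phi>\<^sub>2)) = \<eta>\<^sub>2 \<delta>\<^sub>1"
proof -
  let ?V = "Span (center (grp M))"
  have aff: "\<phi>\<^sub>1 \<in> affinities" "\<phi>\<^sub>2 \<in> affinities" using NM_aff \<phi> by blast+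
  have g: "map_prod \<phi>\<^sub>1 \<delta>\<^sub>1 \<in> lifts \<eta>\<^sub>1" "map_prod \<phi>\<^sub>2 \<delta>\<^sub>2 \<in> lifts \<eta>\<^sub>1"
    by (simp_all add: map_prod_lifts delta_Dihedral \<phi>)
  obtain f where f: "bij_betw f (lifts \<eta>\<^sub>1) (lifts \<eta>\<^sub>2)" "f ` ext M = ext M"
    and hom: "\<And>g h. g \<in> lifts \<eta>\<^sub>1 \<Longrightarrow> h \<in> lifts \<eta>\<^sub>1 \<Longrightarrow> f (g \<circ> h) = f g \<circ> f h"
    and snd: "snd_part (f (map_prod \<phi>\<^sub>1 \<delta>\<^sub>1)) = \<delta>\<^sub>1 \<and> snd_part (f (map_prod \<phi>\<^sub>2 \<delta>\<^sub>2)) = \<delta>\<^sub>2 \<or>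
     snd_part (f (map_prod \<phi>\<^sub>1 \<delta>\<^sub>1)) = \<delta>\<^sub>2 \<and> snd_part (f (map_prod \<phi>\<^sub>2 \<delta>\<^sub>2)) = \<delta>\<^sub>1"
    by (rule lifts_iso_normal_form[OF \<eta> iso g]) (rule that)
  obtain \<alpha> where \<alpha>: "\<alpha> \<in> NM" and f_ext: "\<And>m. m \<in> M \<Longrightarrow> f (map_prod m id) = map_prod (conjg \<alpha> m) id"
    and f_lift: "\<And>\<phi> d. map_prod \<phi> d \<in> lifts \<eta>\<^sub>1 \<Longrightarrow> \<exists>u d'. u \<in> ?V \<and>
      f (map_prod \<phi> d) = map_prod (conjg \<alpha> (shift u \<circ> \<phi>)) d'"
  proof (rule lifts_iso_rigid[OF \<eta> f])
    show "f (g \<circ> h) = f g \<circ> f h" if "g \<in> lifts \<eta>\<^sub>1" "h \<in> lifts \<eta>\<^sub>1" for g h by (rule hom[OF that])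
  qed (rule that)
  have b\<alpha>: "bij \<alpha>" by (rule NM_bij[OF \<alpha>])
  \<comment> \<open>The square of the lift of a mirror lies in \<open>ext M\<close>, where
    \<open>f\<close> is conjugation by \<alpha> without any defect. Comparing with the square of the
    image gives u + lin \<phi> u = 0.\<close>
  have sq: "\<phi> \<circ> \<phi> \<in> M" "lin \<phi> u = - u"
    if l: "map_prod \<phi> (mirror i) \<in> lifts \<eta>\<^sub>1" and u: "f (map_prod \<phi> (mirror i)) = map_prod (conjg \<alpha> (shift u \<circ> \<phi>)) d'"
    for \<phi> u i d'
  proof -
    let ?g = "map_prod \<phi> (mirror i)"
    have gg: "?g \<circ> ?g = map_prod (\<phi> \<circ> \<phi>) id" by (simp add: map_prod_comp mirror_comp id_def)
    have "?g \<circ> ?g \<in> lifts \<eta>\<^sub>1" by (rule bij_groupD(3)[OF bij_group_lifts[OF \<eta>(1)] l l])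
    then show m: "\<phi> \<circ> \<phi> \<in> M" using gg lifts_id[OF \<eta>(1)] by simp
    have "map_prod (conjg \<alpha> (\<phi> \<circ> \<phi>)) id = f ?g \<circ> f ?g" using hom[OF l l] f_ext[OF m] by (simp add: gg)
    then have "conjg \<alpha> (\<phi> \<circ> \<phi>) = conjg \<alpha> ((shift u \<circ> \<phi>) \<circ> (shift u \<circ> \<phi>))"
      by (simp add: u map_prod_comp map_prod_inject conjg_comp b\<alpha>)
    then have "\<phi> \<circ> \<phi> = (shift u \<circ> \<phi>) \<circ> (shift u \<circ> \<phi>)" by (simp add: b\<alpha>)
    from fun_cong[OF this, of 0] have "\<phi> (\<phi> 0) = u + \<phi> (\<phi> 0 + u)" by (simp add: add.commute)
    moreover have "\<phi> \<in> affinities" using l by (simp add: map_prod_lifts NM_aff)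
    ultimately have "u + lin \<phi> u = 0" using affinityD(3)[of \<phi> "\<phi> 0" u] by (simp add: algebra_simps)
    then show "lin \<phi> u = - u" by (simp add: eq_neg_iff_add_eq_0 add.commute)
  qed
  obtain u\<^sub>1 d\<^sub>1 where u1: "u\<^sub>1 \<in> ?V" "f (map_prod \<phi>\<^sub>1 \<delta>\<^sub>1) = map_prod (conjg \<alpha> (shift u\<^sub>1 \<circ> \<phi>\<^sub>1)) d\<^sub>1"
    using f_lift[OF g(1)] by blast
  obtain u\<^sub>2 d\<^sub>2 where u2: "u\<^sub>2 \<in> ?V" "f (map_prod \<phi>\<^sub>2 \<delta>\<^sub>2) = map_prod (conjg \<alpha> (shift u\<^sub>2 \<circ> \<phi>\<^sub>2)) d\<^sub>2"
    using f_lift[OF g(2)] by blast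
  note sq1 = sq[OF g(1)[unfolded delta_mirror] u1(2)[unfolded delta_mirror]]
  note sq2 = sq[OF g(2)[unfolded delta_mirror] u2(2)[unfolded delta_mirror]]
  have invol: "lin \<phi> (lin \<phi> x) = x" if "\<phi> \<in> affinities" "\<phi> \<circ> \<phi> \<in> M" "x \<in> ?V" for \<phi> x
    using center_fixed[OF M that(3,2)] lin_comp[OF that(1), of \<phi>] by simp
  have C': "linear C" "inj C" and Cn: "\<And>\<phi> d x. map_prod \<phi> d \<in> lifts \<eta>\<^sub>1 \<Longrightarrow> norm (C (lin \<phi> x)) = norm (C x)"
    using C by (auto simp: rotates_def bij_def)
  obtain w v where w: "w \<in> ?V" "w - lin \<phi>\<^sub>1 w + u\<^sub>1 = 0" and v: "v = w - lin \<phi>\<^sub>2 w + u\<^sub>2" "v \<in> ?V"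
    "lin \<phi>\<^sub>1 v = - v" "lin \<phi>\<^sub>2 v = - v"
  proof (rule common_eigenvector_shift[OF affinityD(1)[OF aff(1)] affinityD(1)[OF aff(2)] C', of ?V u\<^sub>1 u\<^sub>2])
    show "subspace ?V" by (simp add: Span_def)
    show "lin \<phi>\<^sub>1 x \<in> ?V" "lin \<phi>\<^sub>2 x \<in> ?V" if "x \<in> ?V" for x
      using normalizer_center_span that \<phi> by blast+
    show "lin \<phi>\<^sub>1 (lin \<phi>\<^sub>1 x) = x" "lin \<phi>\<^sub>2 (lin \<phi>\<^sub>2 x) = x" if "x \<in> ?V" for x
      using invol that aff sq1(1) sq2(1) by blast+
    show "norm (C (lin \<phi>\<^sub>1 x)) = norm (C x)" "norm (C (lin \<phi>\<^sub>2 x)) = norm (C x)" for x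
      using Cn g by blast+
  qed (use u1 u2 sq1 sq2 in blast)+
  \<comment> \<open>Conjugation by the translation by - w turns \<phi>_1 into u_1 + \<phi>_1 and v +
    \<phi>_2 into u_2 + \<phi>_2, so composing it with \<alpha> absorbs both defects except for
    \<open>v\<close>.\<close>
  define \<beta> where "\<beta> = \<alpha> \<circ> shift (- w)"
  have wN: "shift (- w) \<in> NM"
    using w(1) by (intro shift_center_NM) (simp add: Span_def span_neg)
  have \<beta>: "\<beta> \<in> NM" unfolding \<beta>_def by (rule NM_comp[OF \<alpha> wN])
  have "u\<^sub>1 = 0 - w + lin \<phi>\<^sub>1 w" using w(2) by (simp add: algebra_simps eq_neg_iff_add_eq_0)
  then have "conjg (shift (- w)) \<phi>\<^sub>1 = shift u\<^sub>1 \<circ> \<phi>\<^sub>1"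
    using conjg_shift_shift[OF aff(1), of w 0] by (simp add: comp_def)
  then have e1: "conjg \<alpha> (shift u\<^sub>1 \<circ> \<phi>\<^sub>1) = conjg \<beta> \<phi>\<^sub>1"
    unfolding \<beta>_def by (simp add: conjg_conjg[OF b\<alpha> NM_bij[OF wN], symmetric])
  have "u\<^sub>2 = v - w + lin \<phi>\<^sub>2 w" using v(1) by simp
  then have "conjg (shift (- w)) (shift v \<circ> \<phi>\<^sub>2) = shift u\<^sub>2 \<circ> \<phi>\<^sub>2"
    using conjg_shift_shift[OF aff(2), of w v] by simp
  then have e2: "conjg \<alpha> (shift u\<^sub>2 \<circ> \<phi>\<^sub>2) = conjg \<beta> (shift v \<circ> \<phi>\<^sub>2)"
    unfolding \<beta>_def by (simp add: conjg_conjg[OF b\<alpha> NM_bij[OF wN], symmetric])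
  have "f (map_prod \<phi>\<^sub>1 \<delta>\<^sub>1) \<in> lifts \<eta>\<^sub>2" "f (map_prod \<phi>\<^sub>2 \<delta>\<^sub>2) \<in> lifts \<eta>\<^sub>2"
    using bij_betwE[OF f(1)] g by blast+
  then have "st (conjg \<beta> \<phi>\<^sub>1) = \<eta>\<^sub>2 d\<^sub>1" "st (conjg \<beta> (shift v \<circ> \<phi>\<^sub>2)) = \<eta>\<^sub>2 d\<^sub>2"
    unfolding u1(2) u2(2) e1 e2 by (simp_all add: map_prod_lifts)
  then show thesis using snd that[OF v(2,3,4) \<beta>] unfolding u1(2) u2(2) by auto
qed

end

theorem theorem9:
  fixes M :: "('a::euclidean_space \<Rightarrow> 'a) set"
    and \<eta>\<^sub>1 \<eta>\<^sub>2 :: "(real \<Rightarrow> real) \<Rightarrow> ('a set \<Rightarrow> 'a set)"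
    and a\<^sub>1 a\<^sub>2 :: 'a
    and A\<^sub>1 A\<^sub>2 :: "'a \<Rightarrow> 'a"
    and E\<^sub>1 E\<^sub>2 :: "'a set"
  assumes "space_group M"
    and "\<eta>\<^sub>1 \<in> Hom_f Dihedral M" and "\<eta>\<^sub>2 \<in> Hom_f Dihedral M"
    and "linear A\<^sub>1" and "bij A\<^sub>1" and "(\<lambda>x. a\<^sub>1 + A\<^sub>1 x) \<in> affine_normalizer M"
    and "linear A\<^sub>2" and "bij A\<^sub>2" and "(\<lambda>x. a\<^sub>2 + A\<^sub>2 x) \<in> affine_normalizer M"
    and "\<eta>\<^sub>1 \<delta>\<^sub>1 = star M M (\<lambda>x. a\<^sub>1 + A\<^sub>1 x)"
    and "\<eta>\<^sub>1 \<delta>\<^sub>2 = star M M (\<lambda>x. a\<^sub>2 + A\<^sub>2 x)"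
    and "E\<^sub>1 = eigenspace_on (Span (center (grp M))) A\<^sub>1 (-1)"
    and "E\<^sub>2 = eigenspace_on (Span (center (grp M))) A\<^sub>2 (-1)"
  shows "psi Dihedral M (Aff_class Dihedral M \<eta>\<^sub>1) = psi Dihedral M (Aff_class Dihedral M \<eta>\<^sub>2) \<longleftrightarrow>
    (\<exists>v \<in> E\<^sub>1 \<inter> E\<^sub>2. \<exists>\<alpha> \<in> carrier (Aff M).
      conj_by (Aff M) \<alpha> ` {\<eta>\<^sub>1 \<delta>\<^sub>1, star M M (\<lambda>x. v + x) \<otimes>\<^bsub>Aff M\<^esub> \<eta>\<^sub>1 \<delta>\<^sub>2} =
        {\<eta>\<^sub>2 \<delta>\<^sub>1, \<eta>\<^sub>2 \<delta>\<^sub>2})"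
proof -
  interpret dihedral_orbifold M by unfold_locales (rule assms(1))
  let ?V = "Span (center (grp M))"
  define \<phi>\<^sub>1 \<phi>\<^sub>2 where "\<phi>\<^sub>1 = (\<lambda>x. a\<^sub>1 + A\<^sub>1 x)" and "\<phi>\<^sub>2 = (\<lambda>x. a\<^sub>2 + A\<^sub>2 x)"
  have \<phi>: "\<phi>\<^sub>1 \<in> NM" "\<phi>\<^sub>2 \<in> NM" "\<eta>\<^sub>1 \<delta>\<^sub>1 = st \<phi>\<^sub>1" "\<eta>\<^sub>1 \<delta>\<^sub>2 = st \<phi>\<^sub>2"
    using assms(6,9-11) by (simp_all add: \<phi>\<^sub>1_def \<phi>\<^sub>2_def)
  have lin: "lin \<phi>\<^sub>1 = A\<^sub>1" "lin \<phi>\<^sub>2 = A\<^sub>2"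
    using assms(4,7) by (simp_all add: \<phi>\<^sub>1_def \<phi>\<^sub>2_def lin_def linear_0)
  have E: "v \<in> E\<^sub>1 \<inter> E\<^sub>2 \<longleftrightarrow> v \<in> ?V \<and> lin \<phi>\<^sub>1 v = - v \<and> lin \<phi>\<^sub>2 v = - v" for v
    by (auto simp: assms(12,13) eigenspace_on_def lin)
  have \<eta>: "hom_to_Aff \<eta>\<^sub>1" "hom_to_Aff \<eta>\<^sub>2" using assms(2,3) by (simp_all add: Hom_f_iff)
  have conj: "conj_by (Aff M) (st \<alpha>) ` {\<eta>\<^sub>1 \<delta>\<^sub>1, st (shift v) \<otimes>\<^bsub>Aff M\<^esub> \<eta>\<^sub>1 \<delta>\<^sub>2} =
      {st (conjg \<alpha> \<phi>\<^sub>1), st (conjg \<alpha> (shift v \<circ> \<phi>\<^sub>2))}" if "\<alpha> \<in> NM" "v \<in> ?V" for \<alpha> v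
    using that shift_center_NM[OF that(2)] \<phi>
    by (simp add: st_comp[symmetric] conj_st NM_comp conjg_def)
  show ?thesis
    unfolding psi_eq_iff[OF assms(2,3)]
  proof
    assume iso: "lifts_iso \<eta>\<^sub>1 \<eta>\<^sub>2"
    obtain C p where C: "rotates \<eta>\<^sub>1 C" by (rule ex_realizes[OF assms(2)])
    obtain v \<alpha> where v: "v \<in> ?V" "lin \<phi>\<^sub>1 v = - v" "lin \<phi>\<^sub>2 v = - v" and \<alpha>: "\<alpha> \<in> NM"
      and eq: "st (conjg \<alpha> \<phi>\<^sub>1) = \<eta>\<^sub>2 \<delta>\<^sub>1 \<and> st (conjg \<alpha> (shift v \<circ> \<phi>\<^sub>2)) = \<eta>\<^sub>2 \<delta>\<^sub>2 \<or>
        st (conjg \<alpha> \<phi>\<^sub>1) = \<eta>\<^sub>2 \<delta>\<^sub>2 \<and> st (conjg \<alpha> (shift v \<circ> \<phi>\<^sub>2)) = \<eta>\<^sub>2 \<delta>\<^sub>1"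
      by (rule lifts_iso_imp_conjugate[OF \<eta> iso C \<phi>])
    have "conj_by (Aff M) (st \<alpha>) ` {\<eta>\<^sub>1 \<delta>\<^sub>1, st (shift v) \<otimes>\<^bsub>Aff M\<^esub> \<eta>\<^sub>1 \<delta>\<^sub>2} = {\<eta>\<^sub>2 \<delta>\<^sub>1, \<eta>\<^sub>2 \<delta>\<^sub>2}"
      unfolding conj[OF \<alpha> v(1)] using eq by auto
    moreover have "v \<in> E\<^sub>1 \<inter> E\<^sub>2" using v E by blast
    moreover have "st \<alpha> \<in> carrier (Aff M)" using \<alpha> by (simp add: carrier_Aff)
    ultimately show "\<exists>v \<in> E\<^sub>1 \<inter> E\<^sub>2. \<exists>\<alpha> \<in> carrier (Aff M).
        conj_by (Aff M) \<alpha> ` {\<eta>\<^sub>1 \<delta>\<^sub>1, st (shift v) \<otimes>\<^bsub>Aff M\<^esub> \<eta>\<^sub>1 \<delta>\<^sub>2} = {\<eta>\<^sub>2 \<delta>\<^sub>1, \<eta>\<^sub>2 \<delta>\<^sub>2}"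
      by blast
  next
    assume "\<exists>v \<in> E\<^sub>1 \<inter> E\<^sub>2. \<exists>\<alpha> \<in> carrier (Aff M).
        conj_by (Aff M) \<alpha> ` {\<eta>\<^sub>1 \<delta>\<^sub>1, st (shift v) \<otimes>\<^bsub>Aff M\<^esub> \<eta>\<^sub>1 \<delta>\<^sub>2} = {\<eta>\<^sub>2 \<delta>\<^sub>1, \<eta>\<^sub>2 \<delta>\<^sub>2}"
    then obtain v \<alpha> where v: "v \<in> E\<^sub>1 \<inter> E\<^sub>2" and \<alpha>: "\<alpha> \<in> NM"
      and eq: "conj_by (Aff M) (st \<alpha>) ` {\<eta>\<^sub>1 \<delta>\<^sub>1, st (shift v) \<otimes>\<^bsub>Aff M\<^esub> \<eta>\<^sub>1 \<delta>\<^sub>2} = {\<eta>\<^sub>2 \<delta>\<^sub>1, \<eta>\<^sub>2 \<delta>\<^sub>2}"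
      unfolding carrier_Aff by blast
    have v': "v \<in> ?V" "lin \<phi>\<^sub>1 v = - v" "lin \<phi>\<^sub>2 v = - v" using v E by blast+
    show "lifts_iso \<eta>\<^sub>1 \<eta>\<^sub>2"
      \<comment> \<open>Equality of unordered pairs splits into the two orderings treated in
        \<open>shear_lifts_iso\<close>.\<close>
      using eq unfolding conj[OF \<alpha> v'(1)] doubleton_eq_iff
      by (rule shear_lifts_iso[OF \<eta> \<phi> v' \<alpha>])
  qed
qed

end
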